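(* Let $\varphi:\mathbb{P}^2\dashrightarrow\mathbb{P}^2$ be a monomial rational map, written in reduced form, with exponent matrix $M_\varphi$ all of whose rows sum to $\delta$. Then $\varphi$ is a Cremona transformation (with multidegree $(1,\delta,1)$) if and only if, up to permuting the rows and permuting the columns of $M_\varphi$, one of the following holds: (I) $\varphi$ is the standard involution $\varphi:(x:y:z)\mapsto(xy:xz:yz)$; (II) $M_\varphi$ is of the form $$M_\varphi=\begin{pmatrix} 0 & 0 & \delta \\ 1 & \delta-1 & 0 \\ 0 & 1 & \delta-1 \end{pmatrix};$$ (III) $M_\varphi$ is of the form $$M_\varphi=\begin{pmatrix} 0 & 0 & \delta \\ a & b & 0 \\ c & d & e \end{pmatrix}$$ and the following equations are satisfied: (i) $a+b=\delta$ and $c+d+e=\delta$; (ii) $ad-bc=1$.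
   Context: Work over a fixed algebraically closed field, with homogeneous coordinates $(x:y:z)$ on $\mathbb{P}^2$. A monomial rational map $\varphi:\mathbb{P}^2\dashrightarrow\mathbb{P}^2$ is a map of the form $(x:y:z)\mapsto(x^{a_{11}}y^{a_{12}}z^{a_{13}}:x^{a_{21}}y^{a_{22}}z^{a_{23}}:x^{a_{31}}y^{a_{32}}z^{a_{33}})$ with nonnegative integer exponents and all three monomials of the same total degree $\delta$. Its exponent matrix is $M_\varphi=(a_{ij})$, so every row sums to $\delta$. The map is in reduced form if the three monomials share no common factor, i.e. every column of $M_\varphi$ contains a $0$. A Cremona transformation is a birational map $\mathbb{P}^2\dashrightarrow\mathbb{P}^2$. Permuting rows (resp. columns) of $M_\varphi$ corresponds to permuting the coordinates of the target (resp. source) $\mathbb{P}^2$. The multidegree of $\varphi$ is the triple $(\gamma_0,\gamma_1,\gamma_2)$ defined by $[\Gamma(\varphi)]=\gamma_0h_2^2+\gamma_1h_1h_2+\gamma_2h_1^2$ in the Chow ring of $\mathbb{P}^2\times\mathbb{P}^2$, where $\Gamma(\varphi)$ is the closure of the graph of $\varphi$ and $h_1,h_2$ are the pullbacks of the hyperplane class via the first and second projections. *)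

theory Defs
  imports
    "HOL-Analysis.Analysis"
    "HOL-Library.Poly_Mapping"
    "HOL-Computational_Algebra.Fraction_Field"
    "HOL-Algebra.Ideal"
begin

section \<open>Polynomials\<close>

text \<open>Polynomials over \<open>'k\<close> in the (finitely many) variables of type \<open>'v\<close>.
  The coordinates of the plane are indexed by the type \<open>3\<close>, so that \<open>x\<close>, \<open>y\<close>, \<open>z\<close> have the
  indices \<open>1\<close>, \<open>2\<close>, \<open>3\<close>.\<close>

type_synonym ('v, 'k) mpoly = "('v \<Rightarrow>\<^sub>0 nat) \<Rightarrow>\<^sub>0 'k"

definition Var :: "'v \<Rightarrow> ('v, 'k::comm_ring_1) mpoly" where
  "Var v = Poly_Mapping.single (Poly_Mapping.single v 1) 1"

definition mpoly_eval :: "('v::finite \<Rightarrow> 'k) \<Rightarrow> ('v, 'k::comm_ring_1) mpoly \<Rightarrow> 'k" where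
  "mpoly_eval p F =
     (\<Sum>m\<in>Poly_Mapping.keys F. Poly_Mapping.lookup F m * (\<Prod>v\<in>UNIV. p v ^ Poly_Mapping.lookup m v))"

definition mpoly_subst ::
    "('v::finite \<Rightarrow> ('w, 'k) mpoly) \<Rightarrow> ('v, 'k::comm_ring_1) mpoly \<Rightarrow> ('w, 'k) mpoly" where
  "mpoly_subst g F =
     (\<Sum>m\<in>Poly_Mapping.keys F. Poly_Mapping.single 0 (Poly_Mapping.lookup F m) *
                 (\<Prod>v\<in>UNIV. g v ^ Poly_Mapping.lookup m v))"

definition homogeneous :: "nat \<Rightarrow> ('v::finite, 'k::comm_ring_1) mpoly \<Rightarrow> bool" where
  "homogeneous d F \<longleftrightarrow> (\<forall>m\<in>Poly_Mapping.keys F. (\<Sum>v\<in>UNIV. Poly_Mapping.lookup m v) = d)"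


section \<open>Rational maps of the projective plane\<close>

text \<open>A rational map is represented by a triple of forms of the same degree, not all zero;
  two triples represent the same map iff they are proportional over the function field.\<close>

definition rational_map :: "((3, 'k::field) mpoly)^3 \<Rightarrow> bool" where
  "rational_map f \<longleftrightarrow> (\<exists>d. \<forall>i. homogeneous d (f $ i)) \<and> (\<exists>i. f $ i \<noteq> 0)"

definition same_map :: "((3, 'k::field) mpoly)^3 \<Rightarrow> ((3, 'k) mpoly)^3 \<Rightarrow> bool" where
  "same_map f g \<longleftrightarrow> (\<forall>i j. f $ i * g $ j = f $ j * g $ i)"

definition identity_map :: "((3, 'k::field) mpoly)^3" where
  "identity_map = (\<chi> i. Var i)"

text \<open>The composite \<open>g \<circ> f\<close>; it is defined as a rational map iff the resulting triple is not
  identically zero.\<close>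

definition compose_map :: "((3, 'k::field) mpoly)^3 \<Rightarrow> ((3, 'k) mpoly)^3 \<Rightarrow> ((3, 'k) mpoly)^3" where
  "compose_map g f = (\<chi> i. mpoly_subst (\<lambda>j. f $ j) (g $ i))"

definition cremona :: "((3, 'k::field) mpoly)^3 \<Rightarrow> bool" where
  "cremona f \<longleftrightarrow> rational_map f \<and>
     (\<exists>g. rational_map g \<and>
          rational_map (compose_map g f) \<and> same_map (compose_map g f) identity_map \<and>
          rational_map (compose_map f g) \<and> same_map (compose_map f g) identity_map)"

definition monomial_map :: "nat^3^3 \<Rightarrow> ((3, 'k::field) mpoly)^3" where
  "monomial_map M = (\<chi> i. \<Prod>j\<in>UNIV. Var j ^ (M $ i $ j))"

definition reduced_form :: "nat^3^3 \<Rightarrow> bool" where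
  "reduced_form M \<longleftrightarrow> (\<forall>j. \<exists>i. M $ i $ j = 0)"

definition equal_up_to_permutation :: "nat^3^3 \<Rightarrow> nat^3^3 \<Rightarrow> bool" where
  "equal_up_to_permutation M N \<longleftrightarrow>
     (\<exists>\<sigma> \<tau>. \<sigma> permutes UNIV \<and> \<tau> permutes UNIV \<and> N = (\<chi> i j. M $ \<sigma> i $ \<tau> j))"

definition standard_involution :: "((3, 'k::field) mpoly)^3" where
  "standard_involution = vector [Var 1 * Var 2, Var 1 * Var 3, Var 2 * Var 3]"


section \<open>Subvarieties of the product of two planes\<close>

text \<open>A subset of \<open>\<bbbP>\<^sup>2 \<times> \<bbbP>\<^sup>2\<close> is represented by the set of all pairs of (nonzero) homogeneous
  coordinate vectors of its points. In the bihomogeneous coordinate ring the variables \<open>Inl i\<close>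
  belong to the first factor and the variables \<open>Inr i\<close> to the second one.\<close>

type_synonym 'k bipoint = "('k^3) \<times> ('k^3)"
type_synonym 'k bipoly = "(3 + 3, 'k) mpoly"

text \<open>Some linear order on the variables is needed for polynomial rings to be an instance of
  class \<open>idom\<close>, and hence for the fraction field of the bihomogeneous coordinate ring.\<close>

instantiation sum :: (linorder, linorder) linorder
begin

definition less_eq_sum :: "'a + 'b \<Rightarrow> 'a + 'b \<Rightarrow> bool" where
  "less_eq_sum s t \<longleftrightarrow>
     (case s of Inl a \<Rightarrow> (case t of Inl b \<Rightarrow> a \<le> b | Inr _ \<Rightarrow> True)
              | Inr a \<Rightarrow> (case t of Inl _ \<Rightarrow> False | Inr b \<Rightarrow> a \<le> b))"

definition less_sum :: "'a + 'b \<Rightarrow> 'a + 'b \<Rightarrow> bool" where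
  "less_sum s t \<longleftrightarrow> s \<le> t \<and> \<not> t \<le> s"

instance
  by standard (auto simp: less_eq_sum_def less_sum_def split: sum.splits)

end

definition bihomogeneous :: "nat \<Rightarrow> nat \<Rightarrow> 'k::field bipoly \<Rightarrow> bool" where
  "bihomogeneous d e F \<longleftrightarrow>
     (\<forall>m\<in>Poly_Mapping.keys F. (\<Sum>i\<in>UNIV. Poly_Mapping.lookup m (Inl i)) = d \<and>
                 (\<Sum>i\<in>UNIV. Poly_Mapping.lookup m (Inr i)) = e)"

definition bieval :: "'k::field bipoint \<Rightarrow> 'k bipoly \<Rightarrow> 'k" where
  "bieval P F = mpoly_eval (case_sum (\<lambda>i. fst P $ i) (\<lambda>i. snd P $ i)) F"

definition zero_locus :: "'k::field bipoly set \<Rightarrow> 'k bipoint set" where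
  "zero_locus S = {(p, q). p \<noteq> 0 \<and> q \<noteq> 0 \<and> (\<forall>F\<in>S. bieval (p, q) F = 0)}"

definition zariski_closed :: "'k::field bipoint set \<Rightarrow> bool" where
  "zariski_closed Z \<longleftrightarrow> (\<exists>S. (\<forall>F\<in>S. \<exists>d e. bihomogeneous d e F) \<and> Z = zero_locus S)"

definition subvariety :: "'k::field bipoint set \<Rightarrow> bool" where
  "subvariety V \<longleftrightarrow> zariski_closed V \<and> V \<noteq> {} \<and>
     (\<forall>A B. zariski_closed A \<longrightarrow> zariski_closed B \<longrightarrow> V \<subseteq> A \<union> B \<longrightarrow> V \<subseteq> A \<or> V \<subseteq> B)"

text \<open>A codimension one subvariety of \<open>V\<close> is a maximal proper one, so no dimension theory is needed.\<close>

definition prime_divisor :: "'k::field bipoint set \<Rightarrow> 'k bipoint set \<Rightarrow> bool" where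
  "prime_divisor V W \<longleftrightarrow> subvariety W \<and> W \<subset> V \<and>
     (\<forall>Z. subvariety Z \<longrightarrow> W \<subseteq> Z \<longrightarrow> Z \<subseteq> V \<longrightarrow> Z = W \<or> Z = V)"

definition vanishes_on :: "'k::field bipoly \<Rightarrow> 'k bipoint set \<Rightarrow> bool" where
  "vanishes_on F V \<longleftrightarrow> (\<forall>P\<in>V. bieval P F = 0)"


section \<open>Orders of vanishing\<close>

text \<open>The germs along \<open>W\<close> of the regular functions \<open>F / H\<close> obtained from the form \<open>F\<close>.
  If \<open>F\<close> is nonzero they differ from each other by units of the local ring along \<open>W\<close>.\<close>

definition germs :: "'k::field bipoint set \<Rightarrow> 'k bipoly \<Rightarrow> 'k bipoly fract set" where
  "germs W F = {Fract F H | H. \<exists>d e. bihomogeneous d e F \<and> bihomogeneous d e H \<and> \<not> vanishes_on H W}"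

text \<open>The local ring of \<open>\<bbbP>\<^sup>2 \<times> \<bbbP>\<^sup>2\<close> along \<open>W\<close>.\<close>

definition local_ring :: "'k::field bipoint set \<Rightarrow> 'k bipoly fract ring" where
  "local_ring W = \<lparr>carrier = (\<Union>F. germs W F), monoid.mult = (*), one = 1, zero = 0, add = (+)\<rparr>"

text \<open>The length of \<open>R / (S)\<close> as an \<open>R\<close>-module: its submodules are the ideals of \<open>R\<close>
  containing \<open>S\<close>.\<close>

definition quotient_length :: "'a ring \<Rightarrow> 'a set \<Rightarrow> nat" where
  "quotient_length R S =
     Sup {n. \<exists>J. (\<forall>i\<le>n. ideal (J i) R \<and> S \<subseteq> J i) \<and> (\<forall>i<n. J i \<subset> J (Suc i))}"

text \<open>For a form \<open>F\<close> not vanishing on \<open>V\<close> and a prime divisor \<open>W\<close> of \<open>V\<close>, the length of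
  the quotient of the local ring of \<open>V\<close> along \<open>W\<close> by a local equation of \<open>F = 0\<close>. The local ring
  of \<open>V\<close> is the quotient of the one of the ambient space by the germs of the forms vanishing
  on \<open>V\<close>.\<close>

definition vanishing_order :: "'k::field bipoint set \<Rightarrow> 'k bipoint set \<Rightarrow> 'k bipoly \<Rightarrow> nat" where
  "vanishing_order V W F =
     quotient_length (local_ring W) (germs W F \<union> (\<Union>G\<in>{G. vanishes_on G V}. germs W G))"


section \<open>Cycles, rational equivalence and the multidegree\<close>

text \<open>Cycles of all dimensions; their group of rational equivalence classes is the direct sum
  of the Chow groups.\<close>

type_synonym 'k cycle = "'k bipoint set \<Rightarrow>\<^sub>0 int"

text \<open>The divisor on \<open>V\<close> of the rational function \<open>F / G\<close>.\<close>

definition principal_divisor :: "'k::field bipoint set \<Rightarrow> 'k bipoly \<Rightarrow> 'k bipoly \<Rightarrow> 'k cycle" where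
  "principal_divisor V F G =
     Abs_poly_mapping (\<lambda>W. if prime_divisor V W
                           then int (vanishing_order V W F) - int (vanishing_order V W G) else 0)"

inductive_set rationally_trivial :: "('k::field cycle) set" where
  zero: "0 \<in> rationally_trivial"
| principal: "principal_divisor V F G \<in> rationally_trivial"
    if "subvariety V" "bihomogeneous d e F" "bihomogeneous d e G"
       "\<not> vanishes_on F V" "\<not> vanishes_on G V"
| diff: "\<alpha> - \<beta> \<in> rationally_trivial"
    if "\<alpha> \<in> rationally_trivial" "\<beta> \<in> rationally_trivial"

definition rationally_equivalent :: "'k::field cycle \<Rightarrow> 'k cycle \<Rightarrow> bool" where
  "rationally_equivalent \<alpha> \<beta> \<longleftrightarrow> \<alpha> - \<beta> \<in> rationally_trivial"

definition graph_closure :: "((3, 'k::field) mpoly)^3 \<Rightarrow> 'k bipoint set" where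
  "graph_closure f =
     zariski_closed hull
       {(p, q). p \<noteq> 0 \<and> q \<noteq> 0 \<and> (\<exists>c. q = c *s (\<chi> i. mpoly_eval (\<lambda>j. p $ j) (f $ i)))}"

text \<open>Pullbacks of coordinate hyperplanes along the two projections. They represent the classes
  \<open>h\<^sub>1\<close> and \<open>h\<^sub>2\<close>; products of these classes are represented by the (transverse) intersections of
  distinct such hyperplanes.\<close>

definition hyperplane1 :: "3 \<Rightarrow> 'k::field bipoint set" where
  "hyperplane1 i = zero_locus {Var (Inl i)}"

definition hyperplane2 :: "3 \<Rightarrow> 'k::field bipoint set" where
  "hyperplane2 i = zero_locus {Var (Inr i)}"

text \<open>\<open>[\<Gamma>(f)] = \<gamma>\<^sub>0 h\<^sub>2\<^sup>2 + \<gamma>\<^sub>1 h\<^sub>1 h\<^sub>2 + \<gamma>\<^sub>2 h\<^sub>1\<^sup>2\<close> in the Chow ring.\<close>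

definition has_multidegree :: "((3, 'k::field) mpoly)^3 \<Rightarrow> nat \<times> nat \<times> nat \<Rightarrow> bool" where
  "has_multidegree f = (\<lambda>(\<gamma>\<^sub>0, \<gamma>\<^sub>1, \<gamma>\<^sub>2).
     rationally_equivalent
       (Poly_Mapping.single (graph_closure f) 1)
       (Poly_Mapping.single (hyperplane2 1 \<inter> hyperplane2 2) (int \<gamma>\<^sub>0) +
        Poly_Mapping.single (hyperplane1 1 \<inter> hyperplane2 1) (int \<gamma>\<^sub>1) +
        Poly_Mapping.single (hyperplane1 1 \<inter> hyperplane1 2) (int \<gamma>\<^sub>2)))"

end

theory Submission
  imports Defs "HOL-Number_Theory.Cong"
begin

text \<open>The classification is a matter of lattices. If \<open>g\<close> is an inverse of the monomial map \<open>\<phi>\<close>, then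
  comparing exponents in \<open>g\<^sub>i (\<phi>) x\<^sub>j = g\<^sub>j (\<phi>) x\<^sub>i\<close> shows that each difference of unit vectors is an
  integral combination, with coefficient sum zero, of the rows of \<open>M\<close> (\<open>cremona_lattice\<close>). So \<open>M\<close> induces
  an automorphism of the lattice of vectors with sum zero, and its determinant there is \<open>\<plusminus>1\<close>. Together with the
  zeros that the reduced form provides, this leaves only the types (I) and (III) up to permutations
  (\<open>classification\<close>); type (II) is the case \<open>a = d = 1\<close>, \<open>c = 0\<close> of (III). Conversely, both types have
  explicit monomial inverses (\<open>cremona_type_I\<close>, \<open>cremona_type_III\<close>).

  For the multidegree, the closure of the graph is placed as a prime divisor on a threefold \<open>V\<close> with an
  equation \<open>P = Q\<close> between coprime monomials, where it is the zero set of another binomial \<open>F\<close>, apart from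
  linear subspaces \<open>p = q = 0\<close> with variables \<open>p\<close> of \<open>P\<close> and \<open>q\<close> of \<open>Q\<close>. If \<open>G\<close> is a monomial
  in the variables of \<open>P\<close> and \<open>Q\<close>, the divisor of \<open>F / G\<close> on \<open>V\<close> thus expresses the class of the graph by
  classes of linear subspaces (\<open>section_rationally_trivial\<close>), and these are compared with each other on
  threefolds of the same kind (\<open>homologous_mixed\<close>, \<open>homologous_same\<close>).

  The point that requires work is the order of vanishing along \<open>p = q = 0\<close>. If \<open>p\<close> has the exponent \<open>a\<close> in
  \<open>P\<close> and \<open>q\<close> the exponent \<open>b\<close> in \<open>Q\<close>, then \<open>V\<close> looks there like the curve \<open>p\<^sup>a = q\<^sup>b\<close>, which is singular
  unless \<open>a\<close> or \<open>b\<close> is \<open>1\<close>. As \<open>a\<close> and \<open>b\<close> are coprime, the curve is unibranch, and the weights \<open>b\<close> of \<open>p\<close>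
  and \<open>a\<close> of \<open>q\<close> define a valuation whose graded pieces have dimension at most one over the residue
  field. The length of the quotient by a form is then the number of values lost on multiplying by it,
  which is its valuation (locale \<open>filtration\<close>, \<open>vanishing_order_eq\<close>). The valuation comes from a
  one-parameter group that acts on \<open>V\<close> and contracts it to \<open>p = q = 0\<close> (locale \<open>boundary\<close>). For type (III)
  the equation \<open>a d - b c = 1\<close> between the entries of \<open>M\<close> enters twice: it makes the exponents coprime,
  and it makes the valuations of the two terms of \<open>F\<close> differ by exactly \<open>1\<close>, which yields the
  coefficient of \<open>h\<^sub>1\<^sup>2\<close>.\<close>

section \<open>Polynomials as functions\<close>

abbreviation lookup :: "('a \<Rightarrow>\<^sub>0 'b::zero) \<Rightarrow> 'a \<Rightarrow> 'b" where "lookup \<equiv> Poly_Mapping.lookup"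
abbreviation keys :: "('a \<Rightarrow>\<^sub>0 'b::zero) \<Rightarrow> 'a set" where "keys \<equiv> Poly_Mapping.keys"
abbreviation single :: "'a \<Rightarrow> 'b \<Rightarrow> ('a \<Rightarrow>\<^sub>0 'b::zero)" where "single \<equiv> Poly_Mapping.single"

abbreviation mon :: "('v \<Rightarrow>\<^sub>0 nat) \<Rightarrow> ('v, 'k::comm_ring_1) mpoly" where
  "mon m \<equiv> single m 1"

definition mon_val :: "('v::finite \<Rightarrow> 'k) \<Rightarrow> ('v \<Rightarrow>\<^sub>0 nat) \<Rightarrow> 'k::comm_ring_1" where
  "mon_val x m = (\<Prod>v\<in>UNIV. x v ^ lookup m v)"

lemma mon_val_add: "mon_val x (m + n) = mon_val x m * mon_val x n"
  by (simp add: mon_val_def lookup_add power_add prod.distrib)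

lemma mon_val_0 [simp]: "mon_val x 0 = 1"
  by (simp add: mon_val_def)

lemma mon_val_single: "mon_val x (single v n) = x v ^ n"
proof -
  have "mon_val x (single v n) = (\<Prod>w\<in>{v}. x w ^ lookup (single v n) w)"
    unfolding mon_val_def by (rule prod.mono_neutral_right) (auto simp: lookup_single)
  then show ?thesis by simp
qed

lemma mon_val_eq_0:
  fixes x :: "'v::finite \<Rightarrow> 'k::field"
  shows "mon_val x m = 0 \<longleftrightarrow> (\<exists>v\<in>keys m. x v = 0)"
  by (auto simp: mon_val_def in_keys_iff)

lemma mon_val_cong: "(\<And>v. v \<in> keys m \<Longrightarrow> x v = y v) \<Longrightarrow> mon_val x m = mon_val y m"
  unfolding mon_val_def by (rule prod.cong[OF refl]) (metis in_keys_iff power_0)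

lemma mpoly_eval_alt: "mpoly_eval x F = (\<Sum>m\<in>keys F. lookup F m * mon_val x m)"
  by (simp add: mpoly_eval_def mon_val_def)

lemma mpoly_eval_superset:
  "finite A \<Longrightarrow> keys F \<subseteq> A \<Longrightarrow> mpoly_eval x F = (\<Sum>m\<in>A. lookup F m * mon_val x m)"
  unfolding mpoly_eval_alt by (rule sum.mono_neutral_left) (auto simp: in_keys_iff)

lemma mpoly_eval_0 [simp]: "mpoly_eval x 0 = 0"
  by (simp add: mpoly_eval_def)

lemma mpoly_eval_single: "mpoly_eval x (single m c) = c * mon_val x m"
  by (simp add: mpoly_eval_alt)

lemma mpoly_eval_1 [simp]: "mpoly_eval x 1 = 1"
  using mpoly_eval_single[of x 0 1] by simp

lemma mpoly_eval_Var [simp]: "mpoly_eval x (Var v) = x v"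
  by (simp add: Var_def mpoly_eval_single mon_val_single)

lemma mpoly_eval_add: "mpoly_eval x (F + G) = mpoly_eval x F + mpoly_eval x G"
proof -
  let ?A = "keys F \<union> keys G"
  have "mpoly_eval x (F + G) = (\<Sum>m\<in>?A. lookup (F + G) m * mon_val x m)"
    by (rule mpoly_eval_superset) (use keys_add[of F G] in auto)
  also have "\<dots> = (\<Sum>m\<in>?A. lookup F m * mon_val x m) + (\<Sum>m\<in>?A. lookup G m * mon_val x m)"
    by (simp add: lookup_add algebra_simps sum.distrib)
  also have "\<dots> = mpoly_eval x F + mpoly_eval x G"
    by (simp add: mpoly_eval_superset[of ?A F] mpoly_eval_superset[of ?A G])
  finally show ?thesis .
qed

lemma mpoly_eval_uminus: "mpoly_eval x (- F) = - mpoly_eval x F"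
  using mpoly_eval_add[of x F "-F"] by (simp add: eq_neg_iff_add_eq_0 add.commute)

lemma mpoly_eval_diff: "mpoly_eval x (F - G) = mpoly_eval x F - mpoly_eval x G"
  using mpoly_eval_add[of x F "-G"] by (simp add: mpoly_eval_uminus)

lemma mpoly_eval_sum: "mpoly_eval x (sum f A) = (\<Sum>a\<in>A. mpoly_eval x (f a))"
  by (induction A rule: infinite_finite_induct) (auto simp: mpoly_eval_add)

lemma mpoly_expand: "F = (\<Sum>m\<in>keys F. single m (lookup F m))"
  by (rule poly_mapping_eqI) (auto simp: lookup_sum lookup_single when_def in_keys_iff)

lemma mpoly_eval_mult: "mpoly_eval x (F * G) = mpoly_eval x F * mpoly_eval x G"
proof -
  have "F * G = (\<Sum>m\<in>keys F. \<Sum>n\<in>keys G.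
      single (m + n) (lookup F m * lookup G n))"
    by (subst mpoly_expand[of F], subst mpoly_expand[of G])
      (simp add: sum_product mult_single)
  then have "mpoly_eval x (F * G) = (\<Sum>m\<in>keys F. \<Sum>n\<in>keys G.
      (lookup F m * mon_val x m) * (lookup G n * mon_val x n))"
    by (simp add: mpoly_eval_sum mpoly_eval_single mon_val_add mult_ac)
  also have "\<dots> = mpoly_eval x F * mpoly_eval x G"
    by (simp add: sum_product mpoly_eval_alt)
  finally show ?thesis .
qed

lemma mpoly_eval_power: "mpoly_eval x (F ^ n) = mpoly_eval x F ^ n"
  by (induction n) (auto simp: mpoly_eval_mult)

lemma mpoly_eval_prod: "mpoly_eval x (prod f A) = (\<Prod>a\<in>A. mpoly_eval x (f a))"
  by (induction A rule: infinite_finite_induct) (auto simp: mpoly_eval_mult)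

lemma mpoly_eval_subst: "mpoly_eval x (mpoly_subst g F) = mpoly_eval (\<lambda>v. mpoly_eval x (g v)) F"
  by (simp add: mpoly_subst_def mpoly_eval_sum mpoly_eval_mult mpoly_eval_single mpoly_eval_prod
      mpoly_eval_power mpoly_eval_alt[of _ F] mon_val_def)

lemmas mpoly_eval_simps = mpoly_eval_add mpoly_eval_diff mpoly_eval_uminus mpoly_eval_mult
  mpoly_eval_sum mpoly_eval_single mpoly_eval_power mpoly_eval_prod

lemma mon_eq_prod_Var: "mon m = (\<Prod>v\<in>UNIV. Var v ^ lookup m v :: ('v::finite, 'k::comm_ring_1) mpoly)"
proof -
  have pow: "Var v ^ n = (mon (single v n) :: ('v, 'k) mpoly)" for v n
    by (induction n) (auto simp: Var_def mult_single single_add[symmetric])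
  have pr: "(\<Prod>v\<in>A. mon (f v)) = (mon (\<Sum>v\<in>A. f v) :: ('v, 'k) mpoly)" if "finite A" for A :: "'v set" and f
    using that by (induction A) (auto simp: mult_single)
  have "m = (\<Sum>v\<in>UNIV. single v (lookup m v))"
    by (rule poly_mapping_eqI) (auto simp: lookup_sum lookup_single when_def)
  then show ?thesis by (simp add: pow pr)
qed

lemma mpoly_induct [case_names Const Var add mult]:
  fixes F :: "('v::finite, 'k::comm_ring_1) mpoly"
  assumes C: "\<And>c. P (single 0 c)" and V: "\<And>v. P (Var v)"
    and A: "\<And>F G. P F \<Longrightarrow> P G \<Longrightarrow> P (F + G)" and M: "\<And>F G. P F \<Longrightarrow> P G \<Longrightarrow> P (F * G)"
  shows "P F"
proof -
  have 1: "P (Var v ^ n)" for v n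
    using C[of 1] by (induction n) (auto intro: M V)
  have "P (\<Prod>v\<in>A. Var v ^ f v)" if "finite A" for A :: "'v set" and f
    using that C[of 1] by (induction A) (auto intro: M 1)
  then have 2: "P (mon m)" for m by (simp add: mon_eq_prod_Var)
  have 3: "P (single m c)" for m c
    using M[OF C[of c] 2[of m]] by (simp add: mult_single)
  have "P (\<Sum>m\<in>A. single m (f m))" if "finite A" for A and f :: "('v \<Rightarrow>\<^sub>0 nat) \<Rightarrow> 'k"
    using that C[of 0] by (induction A) (auto intro: A 3)
  then show ?thesis by (subst mpoly_expand) auto
qed

section \<open>Weights and orbits of one-parameter groups\<close>

lemma infinite_alg_closed: "infinite (UNIV :: 'k::alg_closed_field set)"
proof
  assume fin: "finite (UNIV :: 'k set)"
  define p :: "'k poly" where "p = (\<Prod>a\<in>UNIV. [:- a, 1:]) + 1"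
  have "poly p x = 1" for x
  proof -
    have "(\<Prod>a\<in>UNIV. poly [:- a, 1:] x) = 0" using fin by (intro prod_zero) auto
    then show ?thesis by (simp add: p_def poly_prod)
  qed
  moreover have "degree p > 0"
  proof -
    have d: "degree (\<Prod>a\<in>UNIV. [:- a, 1:] :: 'k poly) = card (UNIV :: 'k set)"
      by (subst degree_prod_eq_sum_degree) auto
    have "card (UNIV :: 'k set) > 0" using fin by (simp add: card_gt_0_iff)
    then show ?thesis unfolding p_def using d by (subst degree_add_eq_left) auto
  qed
  ultimately show False using alg_closed_imp_poly_has_root[of p] by auto
qed

lemma poly_eq_by_eval:
  fixes p q :: "'k::alg_closed_field poly"
  assumes "\<And>t. t \<noteq> 0 \<Longrightarrow> poly p t = poly q t"
  shows "p = q"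
proof (rule ccontr)
  assume "p \<noteq> q"
  then have "finite {t. poly (p - q) t = 0}" by (intro poly_roots_finite) auto
  moreover have "UNIV - {0} \<subseteq> {t. poly (p - q) t = 0}" using assms by auto
  ultimately show False using infinite_alg_closed[where 'k='k] finite_subset by fastforce
qed

definition weight :: "('v::finite \<Rightarrow> nat) \<Rightarrow> ('v \<Rightarrow>\<^sub>0 nat) \<Rightarrow> nat" where
  "weight w m = (\<Sum>v\<in>UNIV. w v * lookup m v)"

definition scale :: "('v \<Rightarrow> nat) \<Rightarrow> 'k \<Rightarrow> ('v \<Rightarrow> 'k::comm_ring_1) \<Rightarrow> 'v \<Rightarrow> 'k" where
  "scale w t x = (\<lambda>v. t ^ w v * x v)"

definition component :: "('v::finite \<Rightarrow> nat) \<Rightarrow> nat \<Rightarrow> ('v, 'k::comm_ring_1) mpoly \<Rightarrow> ('v, 'k) mpoly" where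
  "component w n F = (\<Sum>m\<in>{m\<in>keys F. weight w m = n}. single m (lookup F m))"

text \<open>The one-parameter group with weights \<open>w\<close> moves \<open>x\<close> along a curve, and this is the restriction of
  \<open>F\<close> to that curve. Its coefficients are the values at \<open>x\<close> of the weight components of \<open>F\<close>, which
  turns questions about these components into questions about polynomials in one variable.\<close>

definition orbit_poly :: "('v::finite \<Rightarrow> nat) \<Rightarrow> ('v \<Rightarrow> 'k) \<Rightarrow> ('v, 'k::comm_ring_1) mpoly \<Rightarrow> 'k poly" where
  "orbit_poly w x F = (\<Sum>m\<in>keys F. monom (lookup F m * mon_val x m) (weight w m))"

lemma weight_add: "weight w (m + n) = weight w m + weight w n"
  by (simp add: weight_def lookup_add algebra_simps sum.distrib)

lemma weight_0 [simp]: "weight w 0 = 0"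
  by (simp add: weight_def)

lemma weight_single: "weight w (single v n) = w v * n"
proof -
  have "weight w (single v n) = (\<Sum>u\<in>{v}. w u * lookup (single v n) u)"
    unfolding weight_def by (rule sum.mono_neutral_right) (auto simp: lookup_single)
  then show ?thesis by simp
qed

lemma mon_val_scale: "mon_val (scale w t x) m = t ^ weight w m * mon_val x m"
  by (simp add: mon_val_def scale_def weight_def power_mult_distrib prod.distrib power_sum power_mult)

lemma poly_orbit_poly: "poly (orbit_poly w x F) t = mpoly_eval (scale w t x) F"
  by (simp add: orbit_poly_def mpoly_eval_alt poly_sum poly_monom mon_val_scale mult_ac)

lemma lookup_component: "lookup (component w n F) m = (if weight w m = n then lookup F m else 0)"
proof -
  have "lookup (component w n F) m = (\<Sum>l\<in>{l\<in>keys F. weight w l = n}. if l = m then lookup F m else 0)"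
    unfolding component_def lookup_sum lookup_single when_def by (rule sum.cong) auto
  then show ?thesis by (auto simp: in_keys_iff)
qed

lemma keys_component: "keys (component w n F) = {m\<in>keys F. weight w m = n}"
  by (auto simp: in_keys_iff lookup_component split: if_splits)

lemma coeff_orbit_poly: "coeff (orbit_poly w x F) n = mpoly_eval x (component w n F)"
proof -
  have "coeff (orbit_poly w x F) n =
      (\<Sum>m\<in>keys F. if weight w m = n then lookup F m * mon_val x m else 0)"
    by (simp add: orbit_poly_def coeff_sum)
  also have "\<dots> = (\<Sum>m\<in>{m\<in>keys F. weight w m = n}. lookup F m * mon_val x m)"
    by (rule sum.inter_filter[symmetric]) simp
  also have "\<dots> = mpoly_eval x (component w n F)"
    unfolding component_def by (simp add: mpoly_eval_simps)
  finally show ?thesis .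
qed

lemma orbit_poly_add: "orbit_poly w x (F + G) = orbit_poly w x F + (orbit_poly w x G :: 'k::alg_closed_field poly)"
  by (rule poly_eq_by_eval) (simp add: poly_orbit_poly mpoly_eval_simps)

lemma orbit_poly_diff: "orbit_poly w x (F - G) = orbit_poly w x F - (orbit_poly w x G :: 'k::alg_closed_field poly)"
  by (rule poly_eq_by_eval) (simp add: poly_orbit_poly mpoly_eval_simps)

lemma orbit_poly_mult: "orbit_poly w x (F * G) = orbit_poly w x F * (orbit_poly w x G :: 'k::alg_closed_field poly)"
  by (rule poly_eq_by_eval) (simp add: poly_orbit_poly mpoly_eval_simps)

lemma orbit_poly_single: "orbit_poly w x (single m c) = monom (c * mon_val x m) (weight w m)"
  by (simp add: orbit_poly_def)

definition vanish :: "('v::finite \<Rightarrow> 'k) set \<Rightarrow> ('v, 'k::comm_ring_1) mpoly \<Rightarrow> bool" where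
  "vanish T F \<longleftrightarrow> (\<forall>x\<in>T. mpoly_eval x F = 0)"

text \<open>On an orbit inside \<open>T\<close> the polynomial in the parameter has infinitely many zeros, so all its
  coefficients vanish. Hence the ideal of a set that is stable under a one-parameter group is graded.\<close>

lemma vanish_component:
  fixes F :: "('v::finite, 'k::alg_closed_field) mpoly"
  assumes inv: "\<And>x t. x \<in> T \<Longrightarrow> t \<noteq> 0 \<Longrightarrow> scale w t x \<in> T" and F: "vanish T F"
  shows "vanish T (component w n F)"
  unfolding vanish_def
proof
  fix x assume x: "x \<in> T"
  have "orbit_poly w x F = 0"
    using F inv[OF x] by (intro poly_eq_by_eval) (auto simp: poly_orbit_poly vanish_def)
  then show "mpoly_eval x (component w n F) = 0"
    by (simp flip: coeff_orbit_poly)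
qed

definition torus :: "('v \<Rightarrow> 'k::field) set" where
  "torus = {x. \<forall>v. x v \<noteq> 0}"

text \<open>The torus is stable under every one-parameter group. Splitting off the degree in one variable
  after the other isolates the single monomials of \<open>F\<close>, which do not vanish at \<open>(1, \<dots>, 1)\<close>.\<close>

lemma vanish_torus:
  fixes F :: "('v::finite, 'k::alg_closed_field) mpoly"
  assumes "vanish torus F"
  shows "F = 0"
proof -
  have "\<forall>F\<in>{F :: ('v, 'k) mpoly. vanish torus F}. \<forall>m. \<exists>G. vanish torus G \<and>
     (\<forall>l. lookup G l = (if \<forall>v\<in>A. lookup l v = lookup m v then lookup F l else 0))"
    if "finite A" for A :: "'v set"
    using that
  proof (induction A)
    case empty
    show ?case by auto
  next
    case (insert a A)
    show ?case
    proof (intro ballI allI)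
      fix F m assume "F \<in> {F :: ('v, 'k) mpoly. vanish torus F}"
      with insert.IH obtain G where G: "vanish torus G"
        "\<And>l. lookup G l = (if \<forall>v\<in>A. lookup l v = lookup m v then lookup F l else 0)" by blast
      define w :: "'v \<Rightarrow> nat" where "w = (\<lambda>v. if v = a then 1 else 0)"
      have w: "weight w l = lookup l a" for l
        unfolding weight_def w_def by (simp add: if_distrib[of "\<lambda>x. x * _"] cong: if_cong)
      show "\<exists>G. vanish torus G \<and> (\<forall>l. lookup G l =
          (if \<forall>v\<in>insert a A. lookup l v = lookup m v then lookup F l else 0))"
      proof (intro exI conjI allI)
        show "vanish torus (component w (lookup m a) G)"
          by (rule vanish_component[OF _ G(1)]) (auto simp: torus_def scale_def)
      qed (auto simp: lookup_component w G)
    qed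
  qed
  from this[of UNIV] assms have "\<exists>G. vanish torus G \<and>
     (\<forall>l. lookup G l = (if \<forall>v\<in>UNIV. lookup l v = lookup m v then lookup F l else 0))" for m
    by simp
  then have *: "\<exists>G. vanish torus G \<and> (\<forall>l. lookup G l = (if l = m then lookup F l else 0))" for m
    by (simp add: poly_mapping_eq_iff fun_eq_iff)
  show ?thesis
  proof (rule poly_mapping_eqI)
    fix m
    obtain G where G: "vanish torus G" "\<And>l. lookup G l = (if l = m then lookup F l else 0)"
      using * by blast
    have "G = single m (lookup F m)"
      by (rule poly_mapping_eqI) (auto simp: G(2) lookup_single when_def)
    then have "mpoly_eval (\<lambda>_. 1) G = lookup F m"
      by (simp add: mpoly_eval_single mon_val_def)
    with G(1) show "lookup F m = lookup 0 m" by (simp add: vanish_def torus_def)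
  qed
qed

section \<open>Bihomogeneous forms\<close>

text \<open>Bidegrees are vectors rather than pairs of numbers, so that they can be added and cancelled as a
  whole; this is what most of the bookkeeping below consists of.\<close>

definition bideg :: "(3 + 3 \<Rightarrow>\<^sub>0 nat) \<Rightarrow> nat^2" where
  "bideg m = vector [\<Sum>i\<in>UNIV. lookup m (Inl i), \<Sum>i\<in>UNIV. lookup m (Inr i)]"

definition bh :: "nat^2 \<Rightarrow> 'k::field bipoly \<Rightarrow> bool" where
  "bh D F \<longleftrightarrow> bihomogeneous (D $ 1) (D $ 2) F"

lemma bh_iff: "bh D F \<longleftrightarrow> (\<forall>m\<in>keys F. bideg m = D)"
  by (auto simp: bh_def bihomogeneous_def bideg_def vec_eq_iff forall_2)

lemma bihomogeneous_bh: "bihomogeneous d e F \<longleftrightarrow> bh (vector [d, e]) F"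
  by (simp add: bh_def)

lemma ex_degree: "(\<exists>d e. P (vector [d, e])) \<longleftrightarrow> (\<exists>D::nat^2. P D)"
proof
  assume "\<exists>D. P D"
  then obtain D where "P D" ..
  moreover have "vector [D $ 1, D $ 2] = D" by (simp add: vec_eq_iff forall_2)
  ultimately show "\<exists>d e. P (vector [d, e])" by metis
qed blast

lemma bideg_add: "bideg (m + n) = bideg m + bideg n"
  by (simp add: bideg_def lookup_add sum.distrib vec_eq_iff forall_2)

lemma bideg_0 [simp]: "bideg 0 = 0"
  by (simp add: bideg_def vec_eq_iff forall_2)

lemma bh_0 [simp]: "bh D 0"
  by (simp add: bh_iff)

lemma bh_single: "bh (bideg m) (single m c)"
  by (simp add: bh_iff)

lemma bh_1 [simp]: "bh 0 1"
  by (simp add: bh_iff)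

lemma bh_const [simp]: "bh 0 (single 0 c)"
  by (simp add: bh_iff)

lemma bh_add: "bh D F \<Longrightarrow> bh D G \<Longrightarrow> bh D (F + G)"
  unfolding bh_iff using keys_add[of F G] by blast

lemma bh_uminus: "bh D F \<Longrightarrow> bh D (- F)"
  by (simp add: bh_iff in_keys_iff)

lemma bh_diff: "bh D F \<Longrightarrow> bh D G \<Longrightarrow> bh D (F - G)"
  using bh_add[of D F "- G"] bh_uminus[of D G] by simp

lemma bh_mult: "bh D F \<Longrightarrow> bh E G \<Longrightarrow> bh (D + E) (F * G)"
  unfolding bh_iff using keys_mult[of F G] by (fastforce simp: bideg_add)

lemma bh_power_ex: "bh D F \<Longrightarrow> \<exists>E. bh E (F ^ n)"
proof (induction n)
  case 0
  show ?case by (rule exI[of _ 0]) simp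
next
  case (Suc n)
  then show ?case using bh_mult by (metis power_Suc)
qed

lemma bh_unique: "bh D F \<Longrightarrow> bh E F \<Longrightarrow> F \<noteq> 0 \<Longrightarrow> D = E"
  unfolding bh_iff by (metis all_not_in_conv keys_eq_empty)

lemma bh_component: "bh D F \<Longrightarrow> bh D (component w n F)"
  by (auto simp: bh_iff keys_component)

lemma bh_sum: "(\<And>a. a \<in> A \<Longrightarrow> bh D (f a)) \<Longrightarrow> bh D (sum f A)"
  by (induction A rule: infinite_finite_induct) (auto intro: bh_add)

section \<open>Closed sets\<close>

definition coords :: "'k bipoint \<Rightarrow> 3 + 3 \<Rightarrow> 'k" where
  "coords P = case_sum (\<lambda>i. fst P $ i) (\<lambda>i. snd P $ i)"

definition valid :: "(3 + 3 \<Rightarrow> 'k::field) \<Rightarrow> bool" where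
  "valid x \<longleftrightarrow> (\<exists>i. x (Inl i) \<noteq> 0) \<and> (\<exists>i. x (Inr i) \<noteq> 0)"

text \<open>Closed sets are generated by sets \<open>T\<close> of coordinate vectors, usually orbits of a torus on which
  polynomials are easy to evaluate; the forms vanishing on the closure are those vanishing on \<open>T\<close>.\<close>

definition closed_hull :: "(3 + 3 \<Rightarrow> 'k::field) set \<Rightarrow> 'k bipoint set" where
  "closed_hull T = zero_locus {F. (\<exists>D. bh D F) \<and> vanish T F}"

lemma bieval_coords: "bieval P F = mpoly_eval (coords P) F"
  by (simp add: bieval_def coords_def)

lemma coords_surj: "\<exists>P. coords P = x"
  by (rule exI[of _ "(\<chi> i. x (Inl i), \<chi> i. x (Inr i))"]) (auto simp: coords_def fun_eq_iff split: sum.splits)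

lemma valid_coords: "valid (coords P) \<longleftrightarrow> fst P \<noteq> 0 \<and> snd P \<noteq> 0"
  by (auto simp: valid_def coords_def vec_eq_iff)

lemma mem_zero_locus:
  "P \<in> zero_locus S \<longleftrightarrow> valid (coords P) \<and> (\<forall>F\<in>S. mpoly_eval (coords P) F = 0)"
  by (cases P) (auto simp: zero_locus_def valid_coords bieval_coords)

lemma mem_closed_hull:
  "P \<in> closed_hull T \<longleftrightarrow> valid (coords P) \<and> (\<forall>F D. bh D F \<longrightarrow> vanish T F \<longrightarrow> mpoly_eval (coords P) F = 0)"
  by (auto simp: closed_hull_def mem_zero_locus)

lemma zariski_closed_zero_locus: "(\<And>F. F \<in> S \<Longrightarrow> \<exists>D. bh D F) \<Longrightarrow> zariski_closed (zero_locus S)"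
  unfolding zariski_closed_def bh_def by (rule exI[of _ S]) blast

lemma zariski_closed_closed_hull: "zariski_closed (closed_hull T)"
  unfolding closed_hull_def by (rule zariski_closed_zero_locus) auto

lemma vanishes_on_iff: "vanishes_on F V \<longleftrightarrow> (\<forall>P\<in>V. mpoly_eval (coords P) F = 0)"
  by (simp add: vanishes_on_def bieval_coords)

lemma vanishes_on_closed_hull:
  assumes "T \<subseteq> Collect valid" "bh D F"
  shows "vanishes_on F (closed_hull T) \<longleftrightarrow> vanish T F"
proof
  assume *: "vanishes_on F (closed_hull T)"
  show "vanish T F" unfolding vanish_def
  proof
    fix x assume x: "x \<in> T"
    obtain P where P: "coords P = x" using coords_surj by blast
    have "P \<in> closed_hull T" using x assms(1) by (auto simp: mem_closed_hull P vanish_def)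
    with * P show "mpoly_eval x F = 0" by (auto simp: vanishes_on_iff)
  qed
next
  assume "vanish T F"
  then show "vanishes_on F (closed_hull T)"
    unfolding vanishes_on_iff by (metis assms(2) mem_closed_hull)
qed

lemma closed_hull_superset: "coords P \<in> T \<Longrightarrow> valid (coords P) \<Longrightarrow> P \<in> closed_hull T"
  by (auto simp: mem_closed_hull vanish_def)

lemma zariski_closed_valid: "zariski_closed Z \<Longrightarrow> P \<in> Z \<Longrightarrow> valid (coords P)"
  by (auto simp: zariski_closed_def mem_zero_locus)

text \<open>Closed sets are compared through the forms that vanish on them.\<close>

lemma zariski_closed_subsetI:
  assumes Z: "zariski_closed Z" and W: "\<And>P. P \<in> W \<Longrightarrow> valid (coords P)"
    and "\<And>F D. bh D F \<Longrightarrow> vanishes_on F Z \<Longrightarrow> vanishes_on F W"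
  shows "W \<subseteq> Z"
proof
  fix P assume P: "P \<in> W"
  obtain S where S: "\<forall>F\<in>S. \<exists>d e. bihomogeneous d e F" "Z = zero_locus S"
    using Z by (auto simp: zariski_closed_def)
  have "mpoly_eval (coords P) F = 0" if F: "F \<in> S" for F
  proof -
    obtain d e where "bihomogeneous d e F" using S(1) F by blast
    then have "bh (vector [d, e]) F" by (simp add: bihomogeneous_bh)
    moreover have "vanishes_on F Z" using F S(2) by (auto simp: vanishes_on_iff mem_zero_locus)
    ultimately show ?thesis using assms(3) P by (auto simp: vanishes_on_iff)
  qed
  with W[OF P] show "P \<in> Z" by (simp add: S(2) mem_zero_locus)
qed

lemma subvariety_closed: "subvariety V \<Longrightarrow> zariski_closed V"
  by (simp add: subvariety_def)

lemma subvariety_valid: "subvariety V \<Longrightarrow> P \<in> V \<Longrightarrow> valid (coords P)"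
  using subvariety_closed zariski_closed_valid by blast

lemma vanishes_on_mono: "vanishes_on F V \<Longrightarrow> W \<subseteq> V \<Longrightarrow> vanishes_on F W"
  by (auto simp: vanishes_on_iff)

lemma subvariety_prime:
  assumes V: "subvariety V" and "bh D F" "bh E G" and FG: "vanishes_on (F * G) V"
  shows "vanishes_on F V \<or> vanishes_on G V"
proof -
  have "V \<subseteq> zero_locus {F} \<union> zero_locus {G}"
    using FG subvariety_valid[OF V] by (auto simp: vanishes_on_iff mem_zero_locus mpoly_eval_mult)
  moreover have "zariski_closed (zero_locus {F})" "zariski_closed (zero_locus {G})"
    using assms by (auto intro!: zariski_closed_zero_locus)
  ultimately have "V \<subseteq> zero_locus {F} \<or> V \<subseteq> zero_locus {G}"
    using V by (auto simp: subvariety_def)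
  then show ?thesis by (auto simp: vanishes_on_iff mem_zero_locus)
qed

definition irreducible_set :: "(3 + 3 \<Rightarrow> 'k::field) set \<Rightarrow> bool" where
  "irreducible_set T \<longleftrightarrow> T \<noteq> {} \<and> T \<subseteq> Collect valid \<and> (\<forall>F G. vanish T (F * G) \<longrightarrow> vanish T F \<or> vanish T G)"

lemma subvariety_closed_hull:
  assumes "irreducible_set T"
  shows "subvariety (closed_hull T)"
  unfolding subvariety_def
proof (intro conjI allI impI)
  show "zariski_closed (closed_hull T)" by (rule zariski_closed_closed_hull)
  obtain x where x: "x \<in> T" "valid x" using assms by (auto simp: irreducible_set_def)
  obtain P where "coords P = x" using coords_surj by blast
  then show "closed_hull T \<noteq> {}" using x closed_hull_superset by blast
next
  fix A B assume A: "zariski_closed A" and B: "zariski_closed B" and AB: "closed_hull T \<subseteq> A \<union> B"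
  have T: "T \<subseteq> Collect valid" using assms by (simp add: irreducible_set_def)
  have val: "valid (coords P)" if "P \<in> closed_hull T" for P using that by (simp add: mem_closed_hull)
  show "closed_hull T \<subseteq> A \<or> closed_hull T \<subseteq> B"
  proof (rule ccontr)
    assume *: "\<not> ?thesis"
    then obtain F D where F: "bh D F" "vanishes_on F A" "\<not> vanishes_on F (closed_hull T)"
      using zariski_closed_subsetI[OF A val] by blast
    obtain G E where G: "bh E G" "vanishes_on G B" "\<not> vanishes_on G (closed_hull T)"
      using * zariski_closed_subsetI[OF B val] by blast
    have "vanishes_on (F * G) (closed_hull T)"
      using F(2) G(2) AB by (auto simp: vanishes_on_iff mpoly_eval_mult)
    then have "vanish T (F * G)"
      using vanishes_on_closed_hull[OF T bh_mult[OF F(1) G(1)]] by simp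
    then have "vanish T F \<or> vanish T G" using assms by (simp add: irreducible_set_def)
    with F G vanishes_on_closed_hull[OF T] show False by blast
  qed
qed

section \<open>The local ring along a subvariety\<close>

locale local_germs =
  fixes W :: "'k::field bipoint set"
  assumes subvar: "subvariety W"
begin

abbreviation nv :: "'k bipoly \<Rightarrow> bool" where "nv H \<equiv> \<not> vanishes_on H W"
abbreviation R where "R \<equiv> local_ring W"

definition is_frac :: "nat^2 \<Rightarrow> 'k bipoly \<Rightarrow> 'k bipoly \<Rightarrow> bool" where
  "is_frac D F H \<longleftrightarrow> bh D F \<and> bh D H \<and> nv H"

lemma nv_nonzero: "nv H \<Longrightarrow> H \<noteq> 0"
  by (auto simp: vanishes_on_iff)

lemma nv_mult: "nv F \<Longrightarrow> nv G \<Longrightarrow> bh D F \<Longrightarrow> bh E G \<Longrightarrow> nv (F * G)"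
  using subvariety_prime[OF subvar] by blast

lemma nv_1 [simp]: "nv 1"
  using subvar by (auto simp: vanishes_on_iff subvariety_def)

lemma nv_ex: "\<exists>H. bh D H \<and> nv H"
proof -
  obtain P where P: "P \<in> W" using subvar by (auto simp: subvariety_def)
  then obtain i j where ij: "coords P (Inl i) \<noteq> 0" "coords P (Inr j) \<noteq> 0"
    using subvariety_valid[OF subvar] unfolding valid_def by blast
  define m where "m = single (Inl i) (D $ 1) + single (Inr j) (D $ 2)"
  have "bideg m = D"
    by (simp add: m_def bideg_def lookup_add lookup_single when_def sum.distrib vec_eq_iff forall_2)
  then have "bh D (mon m)" using bh_single[of m 1] by simp
  moreover have "mpoly_eval (coords P) (mon m) \<noteq> 0"
    using ij by (simp add: m_def mpoly_eval_single mon_val_add mon_val_single)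
  ultimately show ?thesis using P by (auto simp: vanishes_on_iff)
qed

lemma germs_alt: "germs W F = {Fract F H | H. \<exists>D. is_frac D F H}"
  unfolding germs_def is_frac_def bihomogeneous_bh
  by (subst ex_degree[where P="\<lambda>D. bh D F \<and> bh D _ \<and> _"]) simp

lemma carrier_iff: "r \<in> carrier R \<longleftrightarrow> (\<exists>D F H. r = Fract F H \<and> is_frac D F H)"
  unfolding local_ring_def germs_alt by auto

lemma carrierI: "is_frac D F H \<Longrightarrow> Fract F H \<in> carrier R"
  unfolding carrier_iff by blast

lemma carrierE:
  assumes "r \<in> carrier R"
  obtains D F H where "r = Fract F H" "is_frac D F H"
  using assms by (auto simp: carrier_iff)

lemma R_simps [simp]:
  "x \<otimes>\<^bsub>R\<^esub> y = x * y" "x \<oplus>\<^bsub>R\<^esub> y = x + y" "\<one>\<^bsub>R\<^esub> = 1" "\<zero>\<^bsub>R\<^esub> = 0"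
  by (simp_all add: local_ring_def)

lemma is_frac_nz: "is_frac D F H \<Longrightarrow> H \<noteq> 0"
  by (simp add: is_frac_def nv_nonzero)

lemma is_frac_mult: "is_frac D F H \<Longrightarrow> is_frac E G K \<Longrightarrow> is_frac (D + E) (F * G) (H * K)"
  unfolding is_frac_def by (metis bh_mult nv_mult)

lemma is_frac_add: "is_frac D F H \<Longrightarrow> is_frac E G K \<Longrightarrow> is_frac (D + E) (F * K + G * H) (H * K)"
  unfolding is_frac_def by (metis add.commute bh_add bh_mult nv_mult)

lemma is_frac_uminus: "is_frac D F H \<Longrightarrow> is_frac D (- F) H"
  by (auto simp: is_frac_def intro: bh_uminus)

lemma is_frac_0: "is_frac 0 0 1" and is_frac_1: "is_frac 0 1 1"
  by (simp_all add: is_frac_def)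

lemma carrier_closed:
  assumes "r \<in> carrier R" "s \<in> carrier R"
  shows "r + s \<in> carrier R" "r * s \<in> carrier R" "- r \<in> carrier R"
proof -
  obtain D F H E G K where r: "r = Fract F H" "is_frac D F H" and s: "s = Fract G K" "is_frac E G K"
    using assms by (auto elim!: carrierE)
  have nz: "H \<noteq> 0" "K \<noteq> 0" using r s is_frac_nz by blast+
  have "r + s = Fract (F * K + G * H) (H * K)" "r * s = Fract (F * G) (H * K)" "- r = Fract (- F) H"
    using nz by (simp_all add: r s)
  then show "r + s \<in> carrier R" "r * s \<in> carrier R" "- r \<in> carrier R"
    using is_frac_add[OF r(2) s(2)] is_frac_mult[OF r(2) s(2)] is_frac_uminus[OF r(2)] carrierI by metis+
qed

lemma zero_one_carrier: "0 \<in> carrier R" "1 \<in> carrier R"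
  using carrierI[OF is_frac_0] carrierI[OF is_frac_1] by (simp_all add: Zero_fract_def One_fract_def)

lemma ring_R: "ring R"
proof (rule ringI)
  show "abelian_group R"
  proof (rule abelian_groupI)
    fix x assume "x \<in> carrier R"
    then have "- x \<in> carrier R" using carrier_closed(3) by blast
    then show "\<exists>y\<in>carrier R. y \<oplus>\<^bsub>R\<^esub> x = \<zero>\<^bsub>R\<^esub>" by (intro bexI[of _ "- x"]) simp_all
  qed (simp_all add: carrier_closed zero_one_carrier add_ac)
  show "Group.monoid R"
    by (rule monoidI) (simp_all add: carrier_closed zero_one_carrier mult_ac)
qed (simp_all add: algebra_simps)

lemma minus_R: "x \<in> carrier R \<Longrightarrow> \<ominus>\<^bsub>R\<^esub> x = - x"
proof -
  interpret ring R by (rule ring_R)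
  assume "x \<in> carrier R"
  then show ?thesis by (intro minus_equality) (auto simp: carrier_closed)
qed

text \<open>Whether the germs of a form belong to a given ideal does not depend on the denominator.\<close>

definition mem_form :: "'k bipoly fract set \<Rightarrow> 'k bipoly \<Rightarrow> bool" where
  "mem_form J F \<longleftrightarrow> (\<exists>D H. is_frac D F H \<and> Fract F H \<in> J)"

context
  fixes J assumes J: "ideal J R"
begin

interpretation J: ideal J R by (rule J)

lemma mem_form_iff:
  assumes "is_frac D F H"
  shows "mem_form J F \<longleftrightarrow> Fract F H \<in> J"
proof
  assume "mem_form J F"
  then obtain E K where K: "is_frac E F K" "Fract F K \<in> J" by (auto simp: mem_form_def)
  show "Fract F H \<in> J"
  proof (cases "F = 0")
    case True
    then show ?thesis using additive_subgroup.zero_closed[OF ideal.axioms(1)[OF J]] is_frac_nz[OF assms] by (simp add: fract_collapse)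
  next
    case False
    then have "D = E" using assms K bh_unique by (auto simp: is_frac_def)
    then have "Fract K H \<in> carrier R" using assms K by (intro carrierI[of D]) (auto simp: is_frac_def)
    from J.I_r_closed[OF K(2) this] have "Fract (F * K) (K * H) \<in> J" by simp
    also have "Fract (F * K) (K * H) = Fract F H"
      using is_frac_nz[OF assms] is_frac_nz[OF K(1)] by (simp add: eq_fract mult_ac)
    finally show ?thesis .
  qed
qed (use assms in \<open>auto simp: mem_form_def\<close>)

lemma mem_form_mult:
  assumes "mem_form J F" "bh E A"
  shows "mem_form J (F * A)"
proof -
  obtain D H where H: "is_frac D F H" "Fract F H \<in> J" using assms by (auto simp: mem_form_def)
  obtain K where K: "bh E K" "nv K" using nv_ex by blast
  have AK: "is_frac E A K" using K assms by (simp add: is_frac_def)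
  from J.I_r_closed[OF H(2) carrierI[OF AK]] have "Fract (F * A) (H * K) \<in> J" by simp
  then show ?thesis using is_frac_mult[OF H(1) AK] by (auto simp: mem_form_def)
qed

lemma mem_form_cancel:
  assumes "mem_form J (F * B)" "nv B" "bh D F" "bh E B"
  shows "mem_form J F"
proof -
  obtain K where K: "bh D K" "nv K" using nv_ex by blast
  have "is_frac (D + E) (F * B) (K * B)"
    using assms K unfolding is_frac_def by (metis bh_mult nv_mult)
  with assms(1) mem_form_iff have "Fract (F * B) (K * B) \<in> J" by blast
  also have "Fract (F * B) (K * B) = Fract F K"
    using nv_nonzero[OF K(2)] nv_nonzero[OF assms(2)] by (simp add: eq_fract mult_ac)
  finally show ?thesis using K assms by (auto simp: mem_form_def is_frac_def)
qed

lemma mem_form_add: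
  assumes "mem_form J F" "mem_form J G" "bh D F" "bh D G"
  shows "mem_form J (F + G)"
proof -
  obtain K where K: "bh D K" "nv K" using nv_ex by blast
  have fr: "is_frac D F K" "is_frac D G K" "is_frac D (F + G) K"
    using assms K by (auto simp: is_frac_def bh_add)
  have "Fract F K \<in> J" "Fract G K \<in> J"
    using assms mem_form_iff[OF fr(1)] mem_form_iff[OF fr(2)] by auto
  from additive_subgroup.a_closed[OF ideal.axioms(1)[OF J] this] have "Fract F K + Fract G K \<in> J" by simp
  also have "Fract F K + Fract G K = Fract (F + G) K"
    using nv_nonzero[OF K(2)] by (simp add: eq_fract algebra_simps)
  finally show ?thesis using fr by (auto simp: mem_form_def)
qed

lemma mem_form_diff:
  assumes "mem_form J F" "mem_form J G" "bh D F" "bh D G"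
  shows "mem_form J (F - G)"
proof -
  have "mem_form J (G * single 0 (-1))" using mem_form_mult[OF assms(2) bh_const] .
  moreover have "G * single 0 (-1) = - G" by (simp add: single_uminus)
  ultimately show ?thesis using mem_form_add[OF assms(1) _ assms(3) bh_uminus[OF assms(4)]] by simp
qed

lemma mem_form_subset:
  assumes J': "ideal J' R" and "\<And>F D. bh D F \<Longrightarrow> mem_form J F \<Longrightarrow> mem_form J' F"
  shows "J \<subseteq> J'"
proof
  fix r assume r: "r \<in> J"
  then obtain D F H where F: "r = Fract F H" "is_frac D F H" using J.Icarr[OF r] carrierE by blast
  then have "mem_form J F" using r by (auto simp: mem_form_def)
  then have "mem_form J' F" using assms(2) F by (auto simp: is_frac_def)
  then obtain E K where K: "is_frac E F K" "Fract F K \<in> J'" by (auto simp: mem_form_def)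
  show "r \<in> J'"
  proof (cases "F = 0")
    case True
    show ?thesis using True additive_subgroup.zero_closed[OF ideal.axioms(1)[OF J']] is_frac_nz[OF F(2)] F by (simp add: fract_collapse)
  next
    case False
    then have DE: "D = E" using F(2) K bh_unique by (auto simp: is_frac_def)
    have "Fract K H \<in> carrier R" using F K DE by (intro carrierI[of D]) (auto simp: is_frac_def)
    from ideal.I_r_closed[OF J' K(2) this] have "Fract (F * K) (K * H) \<in> J'" by simp
    also have "Fract (F * K) (K * H) = r"
      using is_frac_nz[OF F(2)] is_frac_nz[OF K(1)] by (simp add: F(1) eq_fract mult_ac)
    finally show ?thesis .
  qed
qed

lemma germs_subset_iff: "bh D F \<Longrightarrow> germs W F \<subseteq> J \<longleftrightarrow> mem_form J F"
proof -
  assume "bh D F"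
  then obtain H where "is_frac D F H" using nv_ex by (auto simp: is_frac_def)
  then show ?thesis using mem_form_iff unfolding germs_alt by blast
qed

end

text \<open>Conversely, a set of forms that is stable under addition, multiples, and division by
  forms invertible along \<open>W\<close> determines an ideal.\<close>

definition ideal_of :: "('k bipoly \<Rightarrow> bool) \<Rightarrow> 'k bipoly fract set" where
  "ideal_of S = {Fract F H | F H. \<exists>D. is_frac D F H \<and> S F}"

lemma ideal_ofI: "is_frac D F H \<Longrightarrow> S F \<Longrightarrow> Fract F H \<in> ideal_of S"
  unfolding ideal_of_def by blast

lemma ideal_ofE:
  assumes "r \<in> ideal_of S"
  obtains D F H where "r = Fract F H" "is_frac D F H" "S F"
  using assms unfolding ideal_of_def by blast

lemma ideal_ideal_of:
  assumes 0: "S 0" and add: "\<And>D F G. bh D F \<Longrightarrow> bh D G \<Longrightarrow> S F \<Longrightarrow> S G \<Longrightarrow> S (F + G)"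
    and mult: "\<And>D E F G. bh D F \<Longrightarrow> bh E G \<Longrightarrow> S F \<Longrightarrow> S (F * G)"
  shows "ideal (ideal_of S) R"
proof (rule idealI[OF ring_R])
  have mulc: "a * x \<in> ideal_of S" if a: "a \<in> ideal_of S" and x: "x \<in> carrier R" for a x
  proof -
    obtain D F H where F: "a = Fract F H" "is_frac D F H" "S F" using a by (rule ideal_ofE)
    obtain E G K where G: "x = Fract G K" "is_frac E G K" using x by (rule carrierE)
    have "S (F * G)" using mult F(2,3) G(2) unfolding is_frac_def by blast
    from ideal_ofI[where S = S, OF is_frac_mult[OF F(2) G(2)] this] show ?thesis by (simp add: F(1) G(1))
  qed
  have carr: "a \<in> carrier R" if "a \<in> ideal_of S" for a
    using that by (rule ideal_ofE) (simp add: carrierI)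
  show "subgroup (ideal_of S) (add_monoid R)"
  proof (rule subgroup.intro)
    show "ideal_of S \<subseteq> carrier (add_monoid R)" using carr by auto
    show "\<one>\<^bsub>add_monoid R\<^esub> \<in> ideal_of S"
      using ideal_ofI[where S = S, OF is_frac_0 0] by (simp add: Zero_fract_def)
    fix a assume a: "a \<in> ideal_of S"
    have "a * (- 1) \<in> ideal_of S"
      using mulc[OF a carrier_closed(3)[OF zero_one_carrier(2) zero_one_carrier(2)]] .
    then show "inv\<^bsub>add_monoid R\<^esub> a \<in> ideal_of S"
      using minus_R[OF carr[OF a]] by (simp add: a_inv_def)
    fix b assume b: "b \<in> ideal_of S"
    obtain D F H where F: "a = Fract F H" "is_frac D F H" "S F" using a by (rule ideal_ofE)
    obtain E G K where G: "b = Fract G K" "is_frac E G K" "S G" using b by (rule ideal_ofE)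
    have bhs: "bh (D + E) (F * K)" "bh (D + E) (G * H)"
      using F(2) G(2) bh_mult[of D F E K] bh_mult[of E G D H] by (simp_all add: is_frac_def add.commute)
    have "S (F * K)" "S (G * H)" using mult F(2,3) G(2,3) unfolding is_frac_def by blast+
    then have "S (F * K + G * H)" using add bhs by blast
    from ideal_ofI[where S = S, OF is_frac_add[OF F(2) G(2)] this]
    show "a \<otimes>\<^bsub>add_monoid R\<^esub> b \<in> ideal_of S"
      using is_frac_nz[OF F(2)] is_frac_nz[OF G(2)] by (simp add: F(1) G(1))
  qed
  fix a x assume "a \<in> ideal_of S" "x \<in> carrier R"
  then show "x \<otimes>\<^bsub>R\<^esub> a \<in> ideal_of S" "a \<otimes>\<^bsub>R\<^esub> x \<in> ideal_of S"
    using mulc[of a x] by (simp_all add: mult.commute)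
qed

lemma mem_form_ideal_of:
  assumes cancel: "\<And>D E F B. bh D F \<Longrightarrow> bh E B \<Longrightarrow> nv B \<Longrightarrow> S (F * B) \<Longrightarrow> S F"
    and mult: "\<And>D E F G. bh D F \<Longrightarrow> bh E G \<Longrightarrow> S F \<Longrightarrow> S (F * G)"
    and "bh D F"
  shows "mem_form (ideal_of S) F \<longleftrightarrow> S F"
proof
  assume "mem_form (ideal_of S) F"
  then obtain E H where 1: "is_frac E F H" "Fract F H \<in> ideal_of S"
    unfolding mem_form_def by blast
  from 1(2) obtain E' G K where 2: "Fract F H = Fract G K" "is_frac E' G K" "S G" by (rule ideal_ofE)
  have eq: "F * K = G * H" using 2(1) is_frac_nz[OF 1(1)] is_frac_nz[OF 2(2)] by (simp add: eq_fract)
  have "S (G * H)" using mult 2(2,3) 1(1) unfolding is_frac_def by blast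
  with eq have "S (F * K)" by simp
  then show "S F" using cancel[OF assms(3), of E' K] 2(2) by (simp add: is_frac_def)
next
  assume "S F"
  moreover obtain K where K: "bh D K" "nv K" using nv_ex by blast
  moreover have "is_frac D F K" using K assms(3) by (simp add: is_frac_def)
  ultimately show "mem_form (ideal_of S) F" unfolding mem_form_def by (blast intro: ideal_ofI)
qed

lemma germs_in_carrier: "germs W F \<subseteq> carrier R"
  unfolding germs_alt using carrierI by blast

text \<open>The form analogue of the chains of ideals whose lengths define the order of vanishing.\<close>

definition admissible :: "'k bipoint set \<Rightarrow> 'k bipoly \<Rightarrow> 'k bipoly fract set \<Rightarrow> bool" where
  "admissible V F J \<longleftrightarrow> ideal J R \<and> mem_form J F \<and>
     (\<forall>D G. bh D G \<longrightarrow> vanishes_on G V \<longrightarrow> mem_form J G)"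

lemma germs_empty: "(\<nexists>D. bh D G) \<Longrightarrow> germs W G = {}"
  unfolding germs_alt is_frac_def by blast

lemma admissible_iff:
  assumes "bh D F"
  shows "admissible V F J \<longleftrightarrow>
    ideal J R \<and> germs W F \<union> (\<Union>G\<in>{G. vanishes_on G V}. germs W G) \<subseteq> J"
proof (cases "ideal J R")
  case True
  have "(\<Union>G\<in>{G. vanishes_on G V}. germs W G) \<subseteq> J \<longleftrightarrow>
      (\<forall>D G. bh D G \<longrightarrow> vanishes_on G V \<longrightarrow> germs W G \<subseteq> J)"
    using germs_empty by blast
  then show ?thesis
    unfolding admissible_def using True germs_subset_iff[OF True] assms by (metis Un_subset_iff)
qed (simp add: admissible_def)

lemma vanishing_order_eqI:
  assumes F: "bh D F"
    and upper: "\<And>m I. (\<And>i. i \<le> m \<Longrightarrow> admissible V F (I i)) \<Longrightarrow> (\<And>i. i < m \<Longrightarrow> I i \<subset> I (Suc i)) \<Longrightarrow> m \<le> n"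
    and lower: "\<And>i. i \<le> n \<Longrightarrow> admissible V F (J i)" "\<And>i. i < n \<Longrightarrow> J i \<subset> J (Suc i)"
  shows "vanishing_order V W F = n"
proof -
  have "vanishing_order V W F =
      Sup {m. \<exists>I. (\<forall>i\<le>m. admissible V F (I i)) \<and> (\<forall>i<m. I i \<subset> I (Suc i))}"
    unfolding vanishing_order_def quotient_length_def admissible_iff[OF F] ..
  also have "\<dots> = n"
    by (rule cSup_eq_maximum) (use upper lower in blast)+
  finally show ?thesis .
qed

text \<open>The germs of \<open>F\<close> are units, so the only ideal that counts is the whole ring.\<close>

lemma vanishing_order_not_vanishing:
  assumes F: "bh D F" "nv F"
  shows "vanishing_order V W F = 0"
proof -
  have J: "J = carrier R" if J: "admissible V F J" for J
  proof -
    have id: "ideal J R" and "mem_form J F" using J by (simp_all add: admissible_def)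
    moreover have fr: "is_frac D F F" using F by (simp add: is_frac_def)
    ultimately have "Fract F F \<in> J" using mem_form_iff by blast
    moreover have "Fract F F = \<one>\<^bsub>R\<^esub>"
      using nv_nonzero[OF F(2)] by (simp add: One_fract_def eq_fract)
    ultimately show ?thesis using ideal.one_imp_carrier[OF id] by simp
  qed
  show ?thesis
  proof (rule vanishing_order_eqI[OF F(1), where J = "\<lambda>_. carrier R"])
    fix m I assume *: "\<And>i. i \<le> m \<Longrightarrow> admissible V F (I i)" "\<And>i. i < m \<Longrightarrow> I i \<subset> I (Suc i)"
    show "m \<le> 0"
    proof (rule ccontr)
      assume "\<not> m \<le> 0"
      then show False using J[OF *(1)[of 0]] J[OF *(1)[of 1]] *(2)[of 0] by simp
    qed
  next
    have "(\<Union>G\<in>{G. vanishes_on G V}. germs W G) \<subseteq> carrier R" using germs_in_carrier by blast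
    then show "admissible V F (carrier R)"
      using germs_in_carrier[of F] ring.oneideal[OF ring_R] by (simp add: admissible_iff[OF F(1)])
  qed simp
qed

end

section \<open>Orders of vanishing from filtrations\<close>

lemma vanishes_on_add: "vanishes_on F V \<Longrightarrow> vanishes_on G V \<Longrightarrow> vanishes_on (F + G) V"
  by (simp add: vanishes_on_iff mpoly_eval_simps)

lemma vanishes_on_diff: "vanishes_on F V \<Longrightarrow> vanishes_on G V \<Longrightarrow> vanishes_on (F - G) V"
  by (simp add: vanishes_on_iff mpoly_eval_simps)

lemma vanishes_on_mult: "vanishes_on F V \<Longrightarrow> vanishes_on (F * G) V" "vanishes_on F V \<Longrightarrow> vanishes_on (G * F) V"
  by (simp_all add: vanishes_on_iff mpoly_eval_simps)

lemma vanishes_on_0 [simp]: "vanishes_on 0 V"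
  by (simp add: vanishes_on_iff)

definition exact :: "(nat \<Rightarrow> 'a \<Rightarrow> bool) \<Rightarrow> nat \<Rightarrow> 'a \<Rightarrow> bool" where
  "exact ge n F \<longleftrightarrow> ge n F \<and> \<not> ge (Suc n) F"

text \<open>Let \<open>W\<close> have codimension one in \<open>V\<close>. The local ring of \<open>V\<close> along \<open>W\<close> need not be normal, but in the
  cases of interest its normalization is a discrete valuation ring with the same residue field. The
  predicate \<open>ge n\<close> stands for "the valuation is at least \<open>n\<close>", on forms instead of germs.
  The assumption \<open>residue\<close> says that two forms of the same value agree up to a unit modulo higher
  values, \<open>uniform\<close> that every form of large value is divisible by \<open>q\<close>, and \<open>large\<close> that
  all large numbers are values. As in the theory of unibranch curve singularities, these facts force
  the length of the quotient by \<open>f\<close> to be the value of \<open>f\<close>: the ideals are told apart by their sets of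
  values, and multiplication by \<open>f\<close> removes as many values as its own value indicates.\<close>

locale filtration = local_germs W for W :: "'k::field bipoint set" +
  fixes V :: "'k bipoint set" and ge :: "nat \<Rightarrow> 'k bipoly \<Rightarrow> bool"
    and q :: "'k bipoly" and Dq :: "nat^2" and \<alpha> C N :: nat
  assumes subvar_V: "subvariety V" and W_V: "W \<subseteq> V"
    and ge_mono: "\<And>m n F. ge n F \<Longrightarrow> m \<le> n \<Longrightarrow> ge m F"
    and ge_add: "\<And>n F G. ge n F \<Longrightarrow> ge n G \<Longrightarrow> ge n (F + G)"
    and ge_0: "\<And>F. ge 0 F"
    and ge_mult: "\<And>m n F G. ge m F \<Longrightarrow> ge n G \<Longrightarrow> ge (m + n) (F * G)"
    and vanishes_iff_ge: "\<And>D F. bh D F \<Longrightarrow> vanishes_on F V \<longleftrightarrow> (\<forall>n. ge n F)"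
    and vanishes_W_iff_ge: "\<And>D F. bh D F \<Longrightarrow> vanishes_on F W \<longleftrightarrow> ge 1 F"
    and exact_mult: "\<And>D E m n F G. bh D F \<Longrightarrow> bh E G \<Longrightarrow> exact ge m F \<Longrightarrow> exact ge n G \<Longrightarrow> exact ge (m + n) (F * G)"
    and residue: "\<And>D E n F G. bh D F \<Longrightarrow> bh E G \<Longrightarrow> exact ge n F \<Longrightarrow> exact ge n G \<Longrightarrow>
      \<exists>A B DA DB. bh DA A \<and> bh DB B \<and> nv A \<and> nv B \<and> D + DB = E + DA \<and> ge (Suc n) (F * B - G * A)"
    and bh_q: "bh Dq q" and exact_q: "exact ge \<alpha> q" and \<alpha>_pos: "0 < \<alpha>"
    and uniform: "\<And>D F. bh D F \<Longrightarrow> ge C F \<Longrightarrow>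
      \<exists>U X DU DX. bh DU U \<and> nv U \<and> bh DX X \<and> DU + D = Dq + DX \<and> vanishes_on (U * F - q * X) V"
    and large: "\<And>n. N \<le> n \<Longrightarrow> \<exists>D F. bh D F \<and> exact ge n F"
begin

abbreviation val where "val \<equiv> exact ge"

lemma val_unique: "val m F \<Longrightarrow> val n F \<Longrightarrow> m = n"
  unfolding exact_def by (metis Suc_leI ge_mono linorder_neqE_nat)

lemma ge_0_form [simp]: "ge n 0"
  using vanishes_iff_ge[of _ 0] bh_0 by simp

lemma ge_uminus: "ge n F \<Longrightarrow> ge n (- F)"
  using ge_mult[of n F 0 "- 1"] ge_0 by simp

lemma ge_diff: "ge n F \<Longrightarrow> ge n G \<Longrightarrow> ge n (F - G)"
  using ge_add[of n F "- G"] ge_uminus by simp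

lemma ge_cong: "ge n (F - G) \<Longrightarrow> ge n F \<longleftrightarrow> ge n G"
  using ge_add[of n "F - G" G] ge_diff[of n F "F - G"] by auto

lemma val_cong: "ge (Suc n) (F - G) \<Longrightarrow> val n F \<longleftrightarrow> val n G"
  unfolding exact_def using ge_cong ge_mono[of "Suc n" "F - G" n] by auto

lemma not_ge_val: "\<not> ge n F \<Longrightarrow> \<exists>k<n. val k F"
proof (induction n)
  case 0
  then show ?case using ge_0 by simp
next
  case (Suc n)
  show ?case
  proof (cases "ge n F")
    case True
    then show ?thesis using Suc.prems by (auto simp: exact_def)
  next
    case False
    then show ?thesis using Suc.IH less_SucI by blast
  qed
qed

lemma val_ex: "bh D F \<Longrightarrow> \<not> vanishes_on F V \<Longrightarrow> \<exists>n. val n F"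
  using vanishes_iff_ge not_ge_val by blast

lemma val_not_vanishes: "bh D F \<Longrightarrow> val n F \<Longrightarrow> \<not> vanishes_on F V"
  using vanishes_iff_ge by (auto simp: exact_def)

lemma nv_iff: "bh D U \<Longrightarrow> nv U \<longleftrightarrow> val 0 U"
  using vanishes_W_iff_ge ge_0 by (simp add: exact_def)

lemma vanishes_ge: "bh D F \<Longrightarrow> vanishes_on F V \<Longrightarrow> ge n F"
  using vanishes_iff_ge by blast

lemma ge_cancel:
  assumes "bh D F" "bh E G" "val m F" "ge (m + n) (F * G)"
  shows "ge n G"
proof (rule ccontr)
  assume "\<not> ge n G"
  then obtain k where k: "k < n" "val k G" using not_ge_val by blast
  have "\<not> ge (Suc (m + k)) (F * G)"
    using exact_mult[OF assms(1,2,3) k(2)] by (simp add: exact_def)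
  moreover have "Suc (m + k) \<le> m + n" using k by simp
  ultimately show False using assms(4) ge_mono by blast
qed

lemma val_power: "val (n * \<alpha>) (q ^ n)"
proof (induction n)
  case 0
  show ?case using nv_iff[OF bh_1] by simp
next
  case (Suc n)
  then show ?case using exact_mult[OF bh_q _ exact_q] bh_power_ex[OF bh_q] by fastforce
qed

text \<open>Iterated division by \<open>q\<close>; each step lowers the value by the value of \<open>q\<close>, so the quotient after
  \<open>L\<close> steps still has a large value if there was enough room at the start.\<close>

lemma divide_power:
  "\<exists>Dp. bh Dp (q ^ L) \<and> (\<forall>F D C'. bh D F \<longrightarrow> C \<le> C' \<longrightarrow> ge (C' + L * \<alpha>) F \<longrightarrow>
    (\<exists>U X DU DX. bh DU U \<and> nv U \<and> bh DX X \<and> DU + D = Dp + DX \<and>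
       vanishes_on (U * F - q ^ L * X) V \<and> ge C' X))"
proof (induction L)
  case 0
  show ?case
  proof (rule exI[of _ 0], intro conjI allI impI)
    fix F D C' assume "bh D F" "C \<le> C'" "ge (C' + 0 * \<alpha>) F"
    then show "\<exists>U X DU DX. bh DU U \<and> nv U \<and> bh DX X \<and> DU + D = 0 + DX \<and>
       vanishes_on (U * F - q ^ 0 * X) V \<and> ge C' X"
      by (intro exI[of _ 1] exI[of _ F] exI[of _ 0] exI[of _ D]) simp
  qed simp
next
  case (Suc L)
  then obtain Dp where Dp: "bh Dp (q ^ L)" and IH: "\<And>F D C'. bh D F \<Longrightarrow> C \<le> C' \<Longrightarrow> ge (C' + L * \<alpha>) F \<Longrightarrow>
    (\<exists>U X DU DX. bh DU U \<and> nv U \<and> bh DX X \<and> DU + D = Dp + DX \<and>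
       vanishes_on (U * F - q ^ L * X) V \<and> ge C' X)" by blast
  show ?case
  proof (rule exI[of _ "Dq + Dp"], intro conjI allI impI)
    show "bh (Dq + Dp) (q ^ Suc L)" using bh_mult[OF bh_q Dp] by simp
    fix F D C' assume F: "bh D F" "C \<le> C'" "ge (C' + Suc L * \<alpha>) F"
    have "C \<le> C' + \<alpha>" "ge (C' + \<alpha> + L * \<alpha>) F" using F by (simp_all add: add.assoc)
    from IH[OF F(1) this] obtain U X DU DX where U: "bh DU U" "nv U" "bh DX X" "DU + D = Dp + DX"
       "vanishes_on (U * F - q ^ L * X) V" "ge (C' + \<alpha>) X" by blast
    have "ge C X" using U(6) F(2) ge_mono by (meson trans_le_add1)
    from uniform[OF U(3) this] obtain U' X' DU' DX' where U': "bh DU' U'" "nv U'" "bh DX' X'"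
      "DU' + DX = Dq + DX'" "vanishes_on (U' * X - q * X') V" by blast
    have b: "bh (DU' + DX) (U' * X - q * X')"
      using bh_diff[OF bh_mult[OF U'(1) U(3)]] bh_mult[OF bh_q U'(3)] U'(4) by simp
    have "ge (0 + (C' + \<alpha>)) (U' * X)" using ge_mult[OF ge_0 U(6)] .
    then have "ge (\<alpha> + C') (q * X')"
      using ge_cong[OF vanishes_ge[OF b U'(5)]] by (simp add: add.commute)
    then have "ge C' X'" using ge_cancel[OF bh_q U'(3) exact_q] by blast
    moreover have "vanishes_on (U' * (U * F - q ^ L * X) + q ^ L * (U' * X - q * X')) V"
      by (intro vanishes_on_add vanishes_on_mult(2) U(5) U'(5))
    then have "vanishes_on (U' * U * F - q ^ Suc L * X') V" by (simp add: algebra_simps)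
    moreover have "DU' + DU + D = Dq + Dp + DX'"
      using U(4) U'(4) by (metis add.assoc add.commute)
    ultimately show "\<exists>U X DU DX. bh DU U \<and> nv U \<and> bh DX X \<and> DU + D = Dq + Dp + DX \<and>
       vanishes_on (U * F - q ^ Suc L * X) V \<and> ge C' X"
      using bh_mult[OF U'(1) U(1)] nv_mult[OF U'(2) U(2) U'(1) U(1)] U'(3) by blast
  qed
qed

text \<open>Multiples of \<open>f\<close> approximate \<open>g\<close> to any order: if the value of the difference exceeds that of \<open>f\<close> by a
  number that is itself a value, then \<open>residue\<close> permits to cancel the leading term by a multiple of \<open>f\<close>.\<close>

lemma approximation_by_multiples:
  assumes f: "bh Df f" "val n f" and g: "bh Dg g" "val m g" "n + N \<le> m"
  shows "\<exists>U X DU DX. bh DU U \<and> nv U \<and> bh DX X \<and> DU + Dg = Df + DX \<and> ge (m + j) (U * g - f * X)"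
proof (induction j)
  case 0
  obtain U where U: "bh Df U" "nv U" using nv_ex by blast
  have "ge (0 + m) (U * g)" using g(2) by (intro ge_mult ge_0) (simp add: exact_def)
  then show ?case using U by (intro exI[of _ U] exI[of _ 0] exI[of _ Df] exI[of _ Dg]) simp
next
  case (Suc j)
  then obtain U X DU DX where U: "bh DU U" "nv U" "bh DX X" "DU + Dg = Df + DX"
    "ge (m + j) (U * g - f * X)" by blast
  define Y where "Y = U * g - f * X"
  have Y: "bh (DU + Dg) Y"
    unfolding Y_def using bh_diff[OF bh_mult[OF U(1) g(1)]] bh_mult[OF f(1) U(3)] U(4) by simp
  show ?case
  proof (cases "ge (m + Suc j) Y")
    case True
    then show ?thesis using U unfolding Y_def by blast
  next
    case False
    then have vY: "val (m + j) Y" using U(5) by (simp add: exact_def Y_def)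
    have "N \<le> m + j - n" using g(3) by simp
    then obtain Ds s where s: "bh Ds s" "val (m + j - n) s" using large by blast
    have "val (n + (m + j - n)) (f * s)" using exact_mult[OF f(1) s(1) f(2) s(2)] .
    then have "val (m + j) (f * s)" using g(3) by simp
    from residue[OF Y bh_mult[OF f(1) s(1)] vY this] obtain A B DA DB where
      A: "bh DA A" "bh DB B" "nv A" "nv B" "DU + Dg + DB = Df + Ds + DA" "ge (Suc (m + j)) (Y * B - f * s * A)"
      by blast
    have "Df + (DX + DB) = Df + (Ds + DA)" using A(5) U(4) by (simp add: add.assoc)
    then have deg: "DX + DB = Ds + DA" by simp
    have "bh (DX + DB) (X * B + s * A)"
      using bh_add[OF bh_mult[OF U(3) A(2)]] bh_mult[OF s(1) A(1)] deg by simp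
    moreover have "ge (m + Suc j) (U * B * g - f * (X * B + s * A))"
      using A(6) by (simp add: Y_def algebra_simps)
    moreover have "DU + DB + Dg = Df + (DX + DB)" using U(4) by (metis add.assoc add.commute)
    ultimately show ?thesis using bh_mult[OF U(1) A(2)] nv_mult[OF U(2) A(4) U(1) A(2)] by blast
  qed
qed

text \<open>Approximate \<open>q\<^sup>L\<close> by a multiple of \<open>f\<close> so well that the error is divisible by \<open>q\<^sup>L\<close> with a
  quotient in the maximal ideal; one minus this quotient is then a unit. This replaces the noetherian
  argument that the quotient by \<open>f\<close> has finite length.\<close>

lemma power_in_ideal:
  assumes f: "bh Df f" "val n f"
  shows "\<exists>L U X DU DX Dp. bh Dp (q ^ L) \<and> bh DU U \<and> nv U \<and> bh DX X \<and> DU + Dp = Df + DX \<and>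
    vanishes_on (U * q ^ L - f * X) V"
proof -
  define L where "L = n + N"
  define C' where "C' = max C 1"
  obtain Dp where Dp: "bh Dp (q ^ L)" and div: "\<And>F D C'. bh D F \<Longrightarrow> C \<le> C' \<Longrightarrow> ge (C' + L * \<alpha>) F \<Longrightarrow>
    (\<exists>U X DU DX. bh DU U \<and> nv U \<and> bh DX X \<and> DU + D = Dp + DX \<and>
       vanishes_on (U * F - q ^ L * X) V \<and> ge C' X)" using divide_power by blast
  have "n + N \<le> L * \<alpha>" using \<alpha>_pos by (simp add: L_def)
  from approximation_by_multiples[OF f Dp val_power this] obtain U X DU DX where U: "bh DU U" "nv U" "bh DX X"
    "DU + Dp = Df + DX" "ge (L * \<alpha> + C') (U * q ^ L - f * X)" by blast
  have bY: "bh (DU + Dp) (U * q ^ L - f * X)"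
    using bh_diff[OF bh_mult[OF U(1) Dp]] bh_mult[OF f(1) U(3)] U(4) by simp
  have "C \<le> C'" "ge (C' + L * \<alpha>) (U * q ^ L - f * X)" using U(5) by (simp_all add: C'_def add.commute)
  from div[OF bY this] obtain U' X' DU' DX' where U': "bh DU' U'" "nv U'" "bh DX' X'"
    "DU' + (DU + Dp) = Dp + DX'" "vanishes_on (U' * (U * q ^ L - f * X) - q ^ L * X') V" "ge C' X'" by blast
  have "Dp + (DU' + DU) = Dp + DX'" using U'(4) by (metis add.assoc add.commute)
  then have deg: "DU' + DU = DX'" by simp
  have bUU: "bh DX' (U' * U)" "nv (U' * U)"
    using bh_mult[OF U'(1) U(1)] nv_mult[OF U'(2) U(2) U'(1) U(1)] deg by simp_all
  have "ge 1 X'" using U'(6) ge_mono by (auto simp: C'_def)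
  then have "vanishes_on X' W" using vanishes_W_iff_ge[OF U'(3)] by simp
  then have "nv (U' * U - X')" using bUU(2) vanishes_on_add[of "U' * U - X'" W X'] by auto
  moreover have "bh DX' (U' * U - X')" using bh_diff[OF bUU(1) U'(3)] .
  moreover have "vanishes_on ((U' * U - X') * q ^ L - f * (U' * X)) V"
    using U'(5) by (simp add: algebra_simps)
  moreover have "DX' + Dp = Df + (DU' + DX)" using U(4) deg by (metis add.assoc add.commute)
  ultimately show ?thesis using Dp bh_mult[OF U'(1) U(3)] by blast
qed

lemma ge_in_ideal:
  assumes f: "bh Df f" "val n f"
  shows "\<exists>M. \<forall>F D. bh D F \<longrightarrow> ge M F \<longrightarrow> (\<exists>U X DU DX. bh DU U \<and> nv U \<and> bh DX X \<and> DU + D = Df + DX \<and>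
    vanishes_on (U * F - f * X) V)"
proof -
  obtain L U X DU DX Dp where U: "bh Dp (q ^ L)" "bh DU U" "nv U" "bh DX X" "DU + Dp = Df + DX"
    "vanishes_on (U * q ^ L - f * X) V" using power_in_ideal[OF f] by blast
  obtain Dp' where Dp': "bh Dp' (q ^ L)" and div: "\<And>F D C'. bh D F \<Longrightarrow> C \<le> C' \<Longrightarrow> ge (C' + L * \<alpha>) F \<Longrightarrow>
    (\<exists>U X DU DX. bh DU U \<and> nv U \<and> bh DX X \<and> DU + D = Dp' + DX \<and>
       vanishes_on (U * F - q ^ L * X) V \<and> ge C' X)" using divide_power by blast
  have "q ^ L \<noteq> 0" using val_not_vanishes[OF U(1) val_power] by (metis vanishes_on_0)
  then have Dp: "Dp' = Dp" using bh_unique[OF Dp' U(1)] by simp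
  show ?thesis
  proof (rule exI[of _ "C + L * \<alpha>"], intro allI impI)
    fix F D assume F: "bh D F" "ge (C + L * \<alpha>) F"
    from div[OF F(1) order_refl F(2)] obtain U' X' DU' DX' where U': "bh DU' U'" "nv U'" "bh DX' X'"
      "DU' + D = Dp + DX'" "vanishes_on (U' * F - q ^ L * X') V" using Dp by blast
    have "vanishes_on (U * (U' * F - q ^ L * X') + X' * (U * q ^ L - f * X)) V"
      by (intro vanishes_on_add vanishes_on_mult(2) U(6) U'(5))
    then have "vanishes_on (U * U' * F - f * (X * X')) V" by (simp add: algebra_simps)
    moreover have "DU + DU' + D = Df + (DX + DX')" using U(5) U'(4) by (metis add.assoc)
    ultimately show "\<exists>U X DU DX. bh DU U \<and> nv U \<and> bh DX X \<and> DU + D = Df + DX \<and>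
       vanishes_on (U * F - f * X) V"
      using bh_mult[OF U(2) U'(1)] nv_mult[OF U(3) U'(2) U(2) U'(1)] bh_mult[OF U(4) U'(3)] by blast
  qed
qed

text \<open>A form \<open>f\<close> that vanishes on \<open>Z\<close> but not on \<open>V\<close> would divide a unit times a power of \<open>q\<close> modulo the
  ideal of \<open>V\<close>, although neither factor vanishes on \<open>Z\<close>.\<close>

lemma overvariety:
  assumes Z: "subvariety Z" "W \<subseteq> Z" "Z \<subseteq> V" and q: "\<not> vanishes_on q Z"
  shows "Z = V"
proof
  show "V \<subseteq> Z"
  proof (rule zariski_closed_subsetI[OF subvariety_closed[OF Z(1)] subvariety_valid[OF subvar_V]])
    fix F D assume F: "bh D F" "vanishes_on F Z"
    show "vanishes_on F V"
    proof (rule ccontr)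
      assume "\<not> vanishes_on F V"
      then obtain n where "val n F" using val_ex[OF F(1)] by blast
      from power_in_ideal[OF F(1) this] obtain L U X DU DX Dp where
        U: "bh Dp (q ^ L)" "bh DU U" "nv U" "vanishes_on (U * q ^ L - F * X) V" by blast
      have "vanishes_on (U * q ^ L) Z"
        using vanishes_on_add[OF vanishes_on_mono[OF U(4) Z(3)] vanishes_on_mult(1)[OF F(2), of X]] by simp
      then have "vanishes_on U Z \<or> vanishes_on (q ^ L) Z" using subvariety_prime[OF Z(1) U(2,1)] by blast
      moreover have "\<not> vanishes_on U Z" using U(3) vanishes_on_mono Z(2) by blast
      moreover have "\<not> vanishes_on (q ^ L) Z" using q by (auto simp: vanishes_on_iff mpoly_eval_power)
      ultimately show False by blast
    qed
  qed
qed (rule Z)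

definition value_set :: "nat set" where "value_set = {k. \<exists>D F. bh D F \<and> val k F}"

lemma card_values: "N \<le> K \<Longrightarrow> card (value_set \<inter> {..<K + n}) = card (value_set \<inter> {..<K}) + n"
proof (induction n)
  case (Suc n)
  have "K + n \<in> value_set" using large[of "K + n"] Suc.prems by (auto simp: value_set_def)
  then have "value_set \<inter> {..<K + Suc n} = insert (K + n) (value_set \<inter> {..<K + n})"
    by (auto simp: less_Suc_eq)
  then show ?case using Suc by simp
qed simp

lemma card_shift: "card ((+) n ` value_set \<inter> {..<K + n}) = card (value_set \<inter> {..<K})"
proof -
  have "(+) n ` value_set \<inter> {..<K + n} = (+) n ` (value_set \<inter> {..<K})" by auto
  then show ?thesis by (simp add: card_image)
qed

text \<open>Two nested ideals with the same values (below a bound beyond which everything belongs to both) are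
  equal: a form of the larger one is corrected by forms of the smaller one, and its value increases
  with each correction.\<close>

lemma ideal_values_strict:
  assumes I: "ideal I R" and J: "ideal J R" and "J \<subseteq> I"
    and K: "\<And>D F. bh D F \<Longrightarrow> ge K F \<Longrightarrow> mem_form J F"
    and vals: "\<And>k D F. k < K \<Longrightarrow> bh D F \<Longrightarrow> mem_form I F \<Longrightarrow> val k F \<Longrightarrow> \<exists>D G. bh D G \<and> mem_form J G \<and> val k G"
  shows "I \<subseteq> J"
proof (rule mem_form_subset[OF I J])
  have "mem_form J F" if "bh D F" "mem_form I F" "ge (K - d) F" for d D F
    using that
  proof (induction d arbitrary: D F)
    case 0
    then show ?case using K by simp
  next
    case (Suc d)
    show ?case
    proof (cases "ge (K - d) F")
      case True
      then show ?thesis using Suc by blast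
    next
      case False
      then have k: "K - d = Suc (K - Suc d)" using ge_0 Suc.prems(3) by (metis Suc_diff_Suc diff_is_0_eq not_le_imp_less)
      then have v: "val (K - Suc d) F" using False Suc.prems(3) by (simp add: exact_def)
      have "K - Suc d < K" using k by simp
      then obtain E G where G: "bh E G" "mem_form J G" "val (K - Suc d) G"
        using vals[OF _ Suc.prems(1,2) v] by blast
      from residue[OF Suc.prems(1) G(1) v G(3)] obtain A B DA DB where
        A: "bh DA A" "bh DB B" "nv A" "nv B" "D + DB = E + DA" "ge (Suc (K - Suc d)) (F * B - G * A)" by blast
      have deg: "bh (D + DB) (F * B)" "bh (D + DB) (G * A)"
        using bh_mult[OF Suc.prems(1) A(2)] bh_mult[OF G(1) A(1)] A(5) by simp_all
      have GA: "mem_form J (G * A)" using mem_form_mult[OF J G(2) A(1)] .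
      have "mem_form I G" using G(2) \<open>J \<subseteq> I\<close> by (auto simp: mem_form_def)
      then have "mem_form I (F * B - G * A)"
        using mem_form_diff[OF I mem_form_mult[OF I Suc.prems(2) A(2)] mem_form_mult[OF I _ A(1)] deg] by blast
      then have "mem_form J (F * B - G * A)"
        using Suc.IH[OF bh_diff[OF deg]] A(6) k by simp
      from mem_form_add[OF J this GA bh_diff[OF deg] deg(2)] have "mem_form J (F * B)" by simp
      then show ?thesis using mem_form_cancel[OF J _ A(4) Suc.prems(1) A(2)] by blast
    qed
  qed
  from this[where d = K] show "mem_form J F" if "bh D F" "mem_form I F" for D F
    using that ge_0 by simp
qed

text \<open>Along a strict chain of ideals the sets of values grow strictly, starting from the values of the
  multiples of \<open>f\<close>; exactly \<open>n\<close> values are missing there.\<close>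

lemma chain_length_le:
  assumes f: "bh Df f" "val n f"
    and I: "\<And>i. i \<le> m \<Longrightarrow> admissible V f (I i)" and str: "\<And>i. i < m \<Longrightarrow> I i \<subset> I (Suc i)"
  shows "m \<le> n"
proof -
  obtain M where M: "\<And>F D. bh D F \<Longrightarrow> ge M F \<Longrightarrow> (\<exists>U X DU DX. bh DU U \<and> nv U \<and> bh DX X \<and> DU + D = Df + DX \<and>
    vanishes_on (U * F - f * X) V)" using ge_in_ideal[OF f] by blast
  define K where "K = max M N"
  have id: "ideal (I i) R" and memf: "mem_form (I i) f"
    and memV: "\<And>D G. bh D G \<Longrightarrow> vanishes_on G V \<Longrightarrow> mem_form (I i) G" if "i \<le> m" for i
    using I[OF that] by (auto simp: admissible_def)
  have big: "mem_form (I i) F" if i: "i \<le> m" and F: "bh D F" "ge (K + n) F" for i D F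
  proof -
    have "ge M F" by (rule ge_mono[OF F(2)]) (simp add: K_def)
    from M[OF F(1) this] obtain U X DU DX where U: "bh DU U" "nv U" "bh DX X" "DU + D = Df + DX"
      "vanishes_on (U * F - f * X) V" by blast
    have b: "bh (DU + D) (U * F)" "bh (DU + D) (f * X)"
      using bh_mult[OF U(1) F(1)] bh_mult[OF f(1) U(3)] U(4) by simp_all
    have "mem_form (I i) (U * F - f * X + f * X)"
      by (rule mem_form_add[OF id[OF i] memV[OF i bh_diff[OF b] U(5)] _ bh_diff[OF b] b(2)])
        (rule mem_form_mult[OF id[OF i] memf[OF i] U(3)])
    then have "mem_form (I i) (F * U)" by (simp add: mult.commute)
    then show ?thesis using mem_form_cancel[OF id[OF i] _ U(2) F(1) U(1)] by blast
  qed
  define A where "A i = {k. \<exists>D F. bh D F \<and> mem_form (I i) F \<and> val k F} \<inter> {..<K + n}" for i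
  have A_psub: "A i \<subset> A (Suc i)" if i: "i < m" for i
  proof -
    have sub: "A i \<subseteq> A (Suc i)" using str[OF i] unfolding A_def mem_form_def by blast
    have "A i \<noteq> A (Suc i)"
    proof
      assume eq: "A i = A (Suc i)"
      have "I (Suc i) \<subseteq> I i"
      proof (rule ideal_values_strict[OF id id])
        show "\<And>D F. bh D F \<Longrightarrow> ge (K + n) F \<Longrightarrow> mem_form (I i) F" using big i by simp
        fix k D F assume "k < K + n" "bh D F" "mem_form (I (Suc i)) F" "val k F"
        then have "k \<in> A (Suc i)" unfolding A_def by blast
        then have "k \<in> A i" using eq by simp
        then show "\<exists>D G. bh D G \<and> mem_form (I i) G \<and> val k G" unfolding A_def by blast
      qed (use str[OF i] i in auto)
      then show False using str[OF i] by blast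
    qed
    with sub show ?thesis by blast
  qed
  have fin: "finite (A i)" for i by (simp add: A_def)
  have "card (A 0) + i \<le> card (A i)" if "i \<le> m" for i
    using that
  proof (induction i)
    case (Suc i)
    then have "card (A i) < card (A (Suc i))" using psubset_card_mono[OF fin A_psub] by simp
    then show ?case using Suc by simp
  qed simp
  then have "card (A 0) + m \<le> card (A m)" by simp
  also have "\<dots> \<le> card (value_set \<inter> {..<K + n})"
    by (rule card_mono) (auto simp: A_def value_set_def)
  also have "\<dots> = card (value_set \<inter> {..<K}) + n" by (rule card_values) (simp add: K_def)
  also have "card (value_set \<inter> {..<K}) = card ((+) n ` value_set \<inter> {..<K + n})" by (rule card_shift[symmetric])
  also have "\<dots> \<le> card (A 0)"
  proof (rule card_mono[OF fin], rule)
    fix k assume k: "k \<in> (+) n ` value_set \<inter> {..<K + n}"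
    then obtain D F l where F: "bh D F" "val l F" "k = n + l" unfolding value_set_def by blast
    have "val k (f * F)" unfolding F(3) by (rule exact_mult[OF f(1) F(1) f(2) F(2)])
    moreover have "mem_form (I 0) (f * F)" using mem_form_mult[OF id memf F(1)] by simp
    ultimately show "k \<in> A 0" using k bh_mult[OF f(1) F(1)] unfolding A_def by blast
  qed
  finally show ?thesis by simp
qed

text \<open>The ideals generated by \<open>f\<close> and the forms of value at least \<open>k\<close>, where \<open>k\<close> runs downwards through the
  \<open>n\<close> values that no multiple of \<open>f\<close> has, form a strict chain.\<close>

lemma chain_exists:
  assumes f: "bh Df f" "val n f"
  shows "\<exists>J. (\<forall>i\<le>n. admissible V f (J i)) \<and> (\<forall>i<n. J i \<subset> J (Suc i))"
proof -
  define S where "S k F \<longleftrightarrow> (\<exists>D U X DU DX. bh D F \<and> bh DU U \<and> nv U \<and> bh DX X \<and> DU + D = Df + DX \<and>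
     ge k (U * F - f * X))" for k F
  have S_I: "S k F" if "bh D F" "bh DU U" "nv U" "bh DX X" "DU + D = Df + DX" "ge k (U * F - f * X)"
    for k D F U X DU DX
    unfolding S_def using that by blast
  obtain U0 where U0: "bh Df U0" "nv U0" using nv_ex by blast
  have S_ge: "S k F" if "bh D F" "ge k F" for k D F
  proof -
    have "ge (0 + k) (U0 * F)" using ge_mult[OF ge_0 that(2)] .
    then show ?thesis unfolding S_def using that U0
      by (intro exI[of _ D] exI[of _ U0] exI[of _ 0] exI[of _ Df] exI[of _ D]) simp
  qed
  have S_f: "S k f" for k
    unfolding S_def using f(1)
    by (intro exI[of _ Df] exI[of _ 1] exI[of _ 1] exI[of _ 0] exI[of _ 0]) simp
  have S_0: "S k 0" for k by (rule S_ge[of 0]) simp_all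
  have S_E: "\<exists>U X DU DX. bh DU U \<and> nv U \<and> bh DX X \<and> DU + D = Df + DX \<and> ge k (U * F - f * X)"
    if "S k F" "bh D F" "F \<noteq> 0" for k D F
    using that bh_unique unfolding S_def by blast
  have S_add: "S k (F + G)" if FG: "bh D F" "bh D G" "S k F" "S k G" for k D F G
  proof (cases "F = 0 \<or> G = 0")
    case True
    then show ?thesis using FG(3,4) by (elim disjE) simp_all
  next
    case False
    obtain U X DU DX where U: "bh DU U" "nv U" "bh DX X" "DU + D = Df + DX" "ge k (U * F - f * X)"
      using S_E[OF FG(3,1)] False by blast
    obtain U' X' DU' DX' where U': "bh DU' U'" "nv U'" "bh DX' X'" "DU' + D = Df + DX'" "ge k (U' * G - f * X')"
      using S_E[OF FG(4,2)] False by blast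
    have "Df + (DU' + DX) = DU' + (Df + DX)" by (simp only: add.left_commute)
    also have "\<dots> = DU + (DU' + D)" by (simp only: U(4)[symmetric] add.left_commute)
    also have "\<dots> = Df + (DU + DX')" by (simp only: U'(4) add.left_commute)
    finally have deg: "DU' + DX = DU + DX'" by simp
    have "bh (DU' + DX) (U' * X + U * X')"
      using bh_add[OF bh_mult[OF U'(1) U(3)]] bh_mult[OF U(1) U'(3)] deg by simp
    moreover have "ge (0 + k) (U' * (U * F - f * X))" "ge (0 + k) (U * (U' * G - f * X'))"
      by (intro ge_mult ge_0 U U')+
    from ge_add[OF this] have "ge k (U' * U * (F + G) - f * (U' * X + U * X'))" by (simp add: algebra_simps)
    moreover have "DU' + DU + D = Df + (DU' + DX)" using U(4) by (metis add.assoc add.commute)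
    ultimately show ?thesis
      by (intro S_I[OF bh_add[OF FG(1,2)] bh_mult[OF U'(1) U(1)] nv_mult[OF U'(2) U(2) U'(1) U(1)]])
  qed
  have S_mult: "S k (F * G)" if FG: "bh D F" "bh E G" "S k F" for k D E F G
  proof (cases "F = 0")
    case False
    obtain U X DU DX where U: "bh DU U" "nv U" "bh DX X" "DU + D = Df + DX" "ge k (U * F - f * X)"
      using S_E[OF FG(3,1) False] by blast
    have "ge (0 + k) (G * (U * F - f * X))" by (intro ge_mult ge_0 U)
    then have "ge k (U * (F * G) - f * (X * G))" by (simp add: algebra_simps)
    moreover have "DU + (D + E) = Df + (DX + E)" using U(4) by (metis add.assoc)
    ultimately show ?thesis
      by (intro S_I[OF bh_mult[OF FG(1,2)] U(1,2) bh_mult[OF U(3) FG(2)]])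
  qed (simp add: S_0)
  have S_cancel: "S k F" if FG: "bh D F" "bh E B" "nv B" "S k (F * B)" for k D E F B
  proof (cases "F = 0")
    case False
    then have "F * B \<noteq> 0" using nv_nonzero[OF FG(3)] by simp
    then obtain U X DU DX where U: "bh DU U" "nv U" "bh DX X" "DU + (D + E) = Df + DX" "ge k (U * (F * B) - f * X)"
      using S_E[OF FG(4) bh_mult[OF FG(1,2)]] by blast
    have "ge k (U * B * F - f * X)" using U(5) by (simp add: algebra_simps)
    moreover have "DU + E + D = Df + DX" using U(4) by (metis add.assoc add.commute)
    ultimately show ?thesis
      by (intro S_I[OF FG(1) bh_mult[OF U(1) FG(2)] nv_mult[OF U(2) FG(3) U(1) FG(2)] U(3)])
  qed (simp add: S_0)
  define J where "J k = ideal_of (S k)" for k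
  have mem_J: "mem_form (J k) F \<longleftrightarrow> S k F" if "bh D F" for k D F
    unfolding J_def by (rule mem_form_ideal_of[where S = "S k", OF S_cancel S_mult that])
  have adm: "admissible V f (J k)" for k
    unfolding admissible_def
  proof (intro conjI allI impI)
    show "ideal (J k) R" unfolding J_def by (rule ideal_ideal_of[where S = "S k", OF S_0 S_add S_mult])
    show "mem_form (J k) f" using mem_J[OF f(1)] S_f by simp
    show "mem_form (J k) G" if "bh D G" "vanishes_on G V" for D G
      using mem_J[OF that(1)] S_ge[OF that(1) vanishes_ge[OF that]] by simp
  qed
  have J_mono: "J k \<subseteq> J l" if "l \<le> k" for k l
    unfolding J_def ideal_of_def S_def using ge_mono[OF _ that] by blast
  define gaps where "gaps = value_set - (+) n ` value_set"
  have sub: "(+) n ` value_set \<subseteq> value_set"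
  proof
    fix k assume "k \<in> (+) n ` value_set"
    then obtain D F l where F: "bh D F" "val l F" "k = n + l" unfolding value_set_def by blast
    have "val k (f * F)" unfolding F(3) by (rule exact_mult[OF f(1) F(1) f(2) F(2)])
    then show "k \<in> value_set" using bh_mult[OF f(1) F(1)] unfolding value_set_def by blast
  qed
  have gaps_eq: "gaps = value_set \<inter> {..<N + n} - (+) n ` value_set \<inter> {..<N + n}"
  proof -
    have "k \<in> (+) n ` value_set" if "N + n \<le> k" for k
    proof -
      have "k - n \<in> value_set" using large[of "k - n"] that unfolding value_set_def by auto
      then show ?thesis using that by (intro image_eqI[of _ _ "k - n"]) auto
    qed
    then show ?thesis unfolding gaps_def by (auto simp: not_le[symmetric])
  qed
  have "card gaps = card (value_set \<inter> {..<N + n}) - card ((+) n ` value_set \<inter> {..<N + n})"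
    unfolding gaps_eq by (rule card_Diff_subset) (use sub in auto)
  then have card_gaps: "card gaps = n" by (simp add: card_shift card_values)
  have fin_gaps: "finite gaps" unfolding gaps_eq by simp
  define a where "a = sorted_list_of_set gaps"
  have len: "length a = n" by (simp add: a_def card_gaps)
  have a_gaps: "a ! i \<in> gaps" if "i < n" for i
    using that len fin_gaps nth_mem[of i a] by (simp add: a_def)
  have a_less: "a ! i < a ! j" if "i < j" "j < n" for i j
    using sorted_wrt_nth_less[OF strict_sorted_list_of_set[of gaps]] that len by (simp add: a_def)
  \<comment> \<open>The \<open>i\<close>-th ideal is meant to contain the \<open>i\<close> largest gaps; at \<open>i = n\<close> the bound \<open>0\<close> gives the whole ring.\<close>
  define \<kappa> where "\<kappa> i = (if i < n then Suc (a ! (n - 1 - i)) else 0)" for i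
  have "J (\<kappa> i) \<subset> J (\<kappa> (Suc i))" if i: "i < n" for i
  proof -
    define g where "g = a ! (n - 1 - i)"
    have \<kappa>g: "\<kappa> i = Suc g" "\<kappa> (Suc i) \<le> g"
      using i a_less[of "n - 1 - Suc i" "n - 1 - i"] by (auto simp: \<kappa>_def g_def Suc_le_eq)
    have "g \<in> gaps" using a_gaps[of "n - 1 - i"] i by (simp add: g_def)
    then obtain D F where F: "bh D F" "val g F" and g: "g \<notin> (+) n ` value_set"
      unfolding gaps_def value_set_def by blast
    have "ge g F" using F(2) by (simp add: exact_def)
    then have "S (\<kappa> (Suc i)) F" using S_ge[OF F(1) ge_mono] \<kappa>g(2) by blast
    moreover have "\<not> S (\<kappa> i) F"
    proof
      assume "S (\<kappa> i) F"
      then obtain D U X DU DX where U: "bh DU U" "nv U" "bh DX X" "ge (Suc g) (U * F - f * X)"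
        unfolding S_def \<kappa>g(1) by blast
      have "val (0 + g) (U * F)" using exact_mult[OF U(1) F(1) _ F(2)] U(2) nv_iff[OF U(1)] by blast
      then have v: "val g (f * X)" using val_cong[OF U(4)] by simp
      then have "\<not> vanishes_on (f * X) V" using val_not_vanishes[OF bh_mult[OF f(1) U(3)]] by blast
      then have "\<not> vanishes_on X V" using vanishes_on_mult by blast
      then obtain l where l: "val l X" using val_ex[OF U(3)] by blast
      have "g = n + l" using val_unique[OF v exact_mult[OF f(1) U(3) f(2) l]] .
      then show False using g l U(3) unfolding value_set_def by blast
    qed
    ultimately have "J (\<kappa> i) \<noteq> J (\<kappa> (Suc i))" using mem_J[OF F(1)] by metis
    moreover have "J (\<kappa> i) \<subseteq> J (\<kappa> (Suc i))" using J_mono \<kappa>g by simp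
    ultimately show ?thesis by blast
  qed
  then show ?thesis using adm by (intro exI[of _ "\<lambda>i. J (\<kappa> i)"]) simp
qed

theorem vanishing_order_eq:
  assumes "bh Df f" "val n f"
  shows "vanishing_order V W f = n"
proof -
  obtain J where J: "\<forall>i\<le>n. admissible V f (J i)" "\<forall>i<n. J i \<subset> J (Suc i)"
    using chain_exists[OF assms] by blast
  show ?thesis
  proof (rule vanishing_order_eqI[OF assms(1), where J = J])
    fix m I assume "\<And>i. i \<le> m \<Longrightarrow> admissible V f (I i)" "\<And>i. i < m \<Longrightarrow> I i \<subset> I (Suc i)"
    then show "m \<le> n" by (rule chain_length_le[OF assms])
  qed (use J in simp_all)
qed

end

section \<open>Irreducible parametrized sets\<close>

text \<open>A rational map \<open>\<tau>\<close> that is regular on the torus pulls polynomials back to fractions of polynomials.\<close>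

lemma rational_pullback:
  fixes \<tau> :: "('v::finite \<Rightarrow> 'k) \<Rightarrow> ('v \<Rightarrow> 'k::field)" and F :: "('v, 'k) mpoly"
  assumes "\<And>v. \<exists>N D :: ('v, 'k) mpoly. \<forall>x\<in>torus. mpoly_eval x D \<noteq> 0 \<and> \<tau> x v * mpoly_eval x D = mpoly_eval x N"
  shows "\<exists>N D :: ('v, 'k) mpoly. \<forall>x\<in>torus. mpoly_eval x D \<noteq> 0 \<and> mpoly_eval (\<tau> x) F * mpoly_eval x D = mpoly_eval x N"
proof (induction F rule: mpoly_induct)
  case (Const c)
  show ?case by (intro exI[of _ "single 0 c"] exI[of _ 1]) (simp add: mpoly_eval_single)
next
  case (Var v)
  then show ?case using assms by simp
next
  case (add F G)
  obtain N D N' D' where *: "\<forall>x\<in>torus. mpoly_eval x D \<noteq> 0 \<and> mpoly_eval (\<tau> x) F * mpoly_eval x D = mpoly_eval x N"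
    "\<forall>x\<in>torus. mpoly_eval x D' \<noteq> 0 \<and> mpoly_eval (\<tau> x) G * mpoly_eval x D' = mpoly_eval x N'"
    using add by blast
  have "mpoly_eval (\<tau> x) (F + G) * mpoly_eval x (D * D') = mpoly_eval x (N * D' + N' * D)" if "x \<in> torus" for x
    using * that by (simp add: mpoly_eval_simps flip: * ) (simp add: algebra_simps)
  then show ?case using * by (intro exI[of _ "N * D' + N' * D"] exI[of _ "D * D'"]) (simp add: mpoly_eval_mult)
next
  case (mult F G)
  obtain N D N' D' where *: "\<forall>x\<in>torus. mpoly_eval x D \<noteq> 0 \<and> mpoly_eval (\<tau> x) F * mpoly_eval x D = mpoly_eval x N"
    "\<forall>x\<in>torus. mpoly_eval x D' \<noteq> 0 \<and> mpoly_eval (\<tau> x) G * mpoly_eval x D' = mpoly_eval x N'"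
    using mult by blast
  have "mpoly_eval (\<tau> x) (F * G) * mpoly_eval x (D * D') = mpoly_eval x (N * N')" if "x \<in> torus" for x
    using * that by (simp add: mpoly_eval_simps flip: * )
  then show ?case using * by (intro exI[of _ "N * N'"] exI[of _ "D * D'"]) (simp add: mpoly_eval_mult)
qed

text \<open>The image of the torus under a rational map is irreducible, since polynomials on the torus form an
  integral domain.\<close>

lemma irreducible_image:
  fixes \<tau> :: "(3 + 3 \<Rightarrow> 'k) \<Rightarrow> (3 + 3 \<Rightarrow> 'k::alg_closed_field)"
  assumes "\<And>v. \<exists>N D :: 'k bipoly. \<forall>x\<in>torus. mpoly_eval x D \<noteq> 0 \<and> \<tau> x v * mpoly_eval x D = mpoly_eval x N"
    and T: "T = \<tau> ` torus" "T \<subseteq> Collect valid"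
  shows "irreducible_set T"
  unfolding irreducible_set_def
proof (intro conjI allI impI)
  have "(\<lambda>_. 1) \<in> (torus :: (3 + 3 \<Rightarrow> 'k) set)" by (simp add: torus_def)
  then show "T \<noteq> {}" using T(1) by blast
  fix F G :: "'k bipoly" assume FG: "vanish T (F * G)"
  obtain N D where F: "\<forall>x\<in>torus. mpoly_eval x D \<noteq> 0 \<and> mpoly_eval (\<tau> x) F * mpoly_eval x D = mpoly_eval x N"
    using rational_pullback[of \<tau>, OF assms(1)] by blast
  obtain N' D' where G: "\<forall>x\<in>torus. mpoly_eval x D' \<noteq> 0 \<and> mpoly_eval (\<tau> x) G * mpoly_eval x D' = mpoly_eval x N'"
    using rational_pullback[of \<tau>, OF assms(1)] by blast
  have "mpoly_eval x (N * N') = 0" if x: "x \<in> torus" for x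
  proof -
    have "mpoly_eval (\<tau> x) (F * G) = 0" using FG x by (simp add: T(1) vanish_def)
    then have "mpoly_eval x N = 0 \<or> mpoly_eval x N' = 0"
      using F G x by (metis mpoly_eval_mult mult_eq_0_iff)
    then show ?thesis by (auto simp: mpoly_eval_mult)
  qed
  then have "N * N' = 0" by (intro vanish_torus) (simp add: vanish_def)
  then have "N = 0 \<or> N' = 0" by simp
  then show "vanish T F \<or> vanish T G"
  proof
    assume "N = 0"
    then have "mpoly_eval (\<tau> x) F = 0" if "x \<in> torus" for x using F that by fastforce
    then show ?thesis by (simp add: T(1) vanish_def)
  next
    assume "N' = 0"
    then have "mpoly_eval (\<tau> x) G = 0" if "x \<in> torus" for x using G that by fastforce
    then show ?thesis by (simp add: T(1) vanish_def)
  qed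
qed (use T in blast)

lemma torus_valid: "torus \<subseteq> Collect valid"
  by (auto simp: torus_def valid_def)

section \<open>Linear subspaces of codimension two\<close>

definition lin :: "3 + 3 \<Rightarrow> 3 + 3 \<Rightarrow> 'k::field bipoint set" where
  "lin p q = zero_locus {Var p, Var q}"

definition lin_torus :: "3 + 3 \<Rightarrow> 3 + 3 \<Rightarrow> (3 + 3 \<Rightarrow> 'k::field) set" where
  "lin_torus p q = {x. \<forall>v. x v = 0 \<longleftrightarrow> v = p \<or> v = q}"

lemma mem_lin: "P \<in> lin p q \<longleftrightarrow> valid (coords P) \<and> coords P p = 0 \<and> coords P q = 0"
  by (simp add: lin_def mem_zero_locus)

lemma lin_commute: "lin p q = lin q p"
  by (simp add: lin_def insert_commute)

lemma bh_Var: "bh (bideg (single v 1)) (Var v)"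
  by (simp add: Var_def bh_single)

lemma lin_torus_valid: "lin_torus p q \<subseteq> Collect valid"
proof
  fix x :: "3 + 3 \<Rightarrow> 'a" assume x: "x \<in> lin_torus p q"
  have card: "card (g ` (UNIV :: 3 set)) = 3" if "inj g" for g :: "3 \<Rightarrow> 3 + 3"
    using card_image[OF that] by simp
  have "\<exists>i. g i \<noteq> p \<and> g i \<noteq> q" if g: "inj g" for g :: "3 \<Rightarrow> 3 + 3"
  proof (rule ccontr)
    assume "\<not> ?thesis"
    then have "g ` UNIV \<subseteq> {p, q}" by auto
    then have "card (g ` UNIV) \<le> card {p, q}" by (intro card_mono) auto
    also have "\<dots> \<le> 2" by (simp add: card_insert_if)
    finally show False using card[OF g] by simp
  qed
  from this[of Inl] this[of Inr] show "x \<in> Collect valid"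
    using x by (auto simp: valid_def lin_torus_def)
qed

lemma irreducible_lin_torus: "irreducible_set (lin_torus p q :: (3 + 3 \<Rightarrow> 'k::alg_closed_field) set)"
proof (rule irreducible_image[where \<tau> = "\<lambda>x v. if v = p \<or> v = q then 0 else x v"])
  fix v
  show "\<exists>N D :: 'k bipoly. \<forall>x\<in>torus. mpoly_eval x D \<noteq> 0 \<and>
     (if v = p \<or> v = q then 0 else x v) * mpoly_eval x D = mpoly_eval x N"
    by (rule exI[of _ "if v = p \<or> v = q then 0 else Var v"], rule exI[of _ 1]) simp
  show "lin_torus p q = (\<lambda>x v. if v = p \<or> v = q then 0 else x v) ` (torus :: (3 + 3 \<Rightarrow> 'k) set)"
  proof (intro equalityI subsetI)
    fix x :: "3 + 3 \<Rightarrow> 'k" assume x: "x \<in> lin_torus p q"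
    then show "x \<in> (\<lambda>x v. if v = p \<or> v = q then 0 else x v) ` torus"
      by (intro image_eqI[of _ _ "\<lambda>v. if v = p \<or> v = q then 1 else x v"])
        (auto simp: lin_torus_def torus_def fun_eq_iff)
  qed (auto simp: lin_torus_def torus_def split: if_splits)
qed (rule lin_torus_valid)

text \<open>Setting \<open>p\<close> and \<open>q\<close> to zero in \<open>F\<close> gives a polynomial that vanishes on the torus, hence is zero; so \<open>F\<close>
  vanishes at all points of the subspace, including those outside of its open orbit.\<close>

lemma closed_hull_lin_torus: "closed_hull (lin_torus p q) = (lin p q :: 'k::alg_closed_field bipoint set)"
proof (intro equalityI subsetI)
  fix P :: "'k bipoint" assume "P \<in> closed_hull (lin_torus p q)"
  moreover have "vanish (lin_torus p q) (Var p :: 'k bipoly)" "vanish (lin_torus p q) (Var q :: 'k bipoly)"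
    by (simp_all add: vanish_def lin_torus_def)
  ultimately have "valid (coords P)" "mpoly_eval (coords P) (Var p) = 0" "mpoly_eval (coords P) (Var q) = 0"
    using bh_Var unfolding mem_closed_hull by blast+
  then show "P \<in> lin p q" by (simp add: mem_lin)
next
  fix P :: "'k bipoint" assume P: "P \<in> lin p q"
  have "mpoly_eval (coords P) F = 0" if F: "vanish (lin_torus p q) F" for F
  proof -
    define g :: "3 + 3 \<Rightarrow> 'k bipoly" where "g v = (if v = p \<or> v = q then 0 else Var v)" for v
    have g: "mpoly_eval x (g v) = (if v = p \<or> v = q then 0 else x v)" for x v by (simp add: g_def)
    have "mpoly_subst g F = 0"
    proof (rule vanish_torus, unfold vanish_def, rule)
      fix x :: "3 + 3 \<Rightarrow> 'k" assume "x \<in> torus"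
      then have "(\<lambda>v. if v = p \<or> v = q then 0 else x v) \<in> lin_torus p q"
        by (auto simp: lin_torus_def torus_def)
      then show "mpoly_eval x (mpoly_subst g F) = 0"
        using F by (simp add: mpoly_eval_subst g vanish_def)
    qed
    then have "mpoly_eval (\<lambda>v. mpoly_eval (coords P) (g v)) F = 0"
      by (simp flip: mpoly_eval_subst)
    moreover have "(\<lambda>v. mpoly_eval (coords P) (g v)) = coords P"
      using P by (auto simp: g mem_lin fun_eq_iff)
    ultimately show ?thesis by simp
  qed
  then show "P \<in> closed_hull (lin_torus p q)" using P by (simp add: mem_closed_hull mem_lin)
qed

lemma subvariety_lin: "subvariety (lin p q :: 'k::alg_closed_field bipoint set)"
  using subvariety_closed_hull[OF irreducible_lin_torus] by (simp add: closed_hull_lin_torus)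

lemma lin_torus_point: "\<exists>P \<in> (lin p q :: 'k::field bipoint set). coords P \<in> lin_torus p q"
proof -
  obtain P where P: "coords P = (\<lambda>v. if v = p \<or> v = q then 0 else 1 :: 'k)" using coords_surj by blast
  then have "coords P \<in> lin_torus p q" by (simp add: lin_torus_def)
  then show ?thesis using lin_torus_valid by (intro bexI[of _ P]) (auto simp: mem_lin lin_torus_def)
qed

lemma lin_subset_iff:
  assumes "lin p q \<subseteq> (lin p' q' :: 'k::field bipoint set)"
  shows "p' \<in> {p, q}" "q' \<in> {p, q}"
proof -
  obtain P :: "'k bipoint" where P: "P \<in> lin p q" "coords P \<in> lin_torus p q" using lin_torus_point by blast
  have "P \<in> lin p' q'" using P(1) assms by blast
  then have "coords P p' = 0" "coords P q' = 0" by (simp_all add: mem_lin)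
  moreover have "\<And>v. coords P v = 0 \<longleftrightarrow> v = p \<or> v = q" using P(2) by (simp add: lin_torus_def)
  ultimately have "p' = p \<or> p' = q" "q' = p \<or> q' = q" by blast+
  then show "p' \<in> {p, q}" "q' \<in> {p, q}" by auto
qed

lemma prime_mon:
  assumes Z: "subvariety Z" and "vanishes_on (mon m) Z"
  shows "\<exists>v\<in>keys m. vanishes_on (Var v) Z"
proof -
  have pw: "\<exists>D. bh D (Var v ^ n :: 'a bipoly)" for v n using bh_power_ex[OF bh_Var] .
  have pw_van: "vanishes_on (Var v) Z" if "vanishes_on (Var v ^ n) Z" for v n
    using that by (auto simp: vanishes_on_iff mpoly_eval_power)
  have Z1: "\<not> vanishes_on 1 Z" using Z by (auto simp: subvariety_def vanishes_on_iff)
  have "(\<exists>D. bh D (\<Prod>v\<in>A. Var v ^ lookup m v :: 'a bipoly)) \<and>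
      (vanishes_on (\<Prod>v\<in>A. Var v ^ lookup m v) Z \<longrightarrow> (\<exists>v\<in>A. lookup m v \<noteq> 0 \<and> vanishes_on (Var v) Z))"
    if "finite A" for A
    using that
  proof (induction A)
    case empty
    then show ?case using Z1 bh_1 by (simp add: exI[of _ 0])
  next
    case (insert a A)
    obtain D where D: "bh D (Var a ^ lookup m a :: 'a bipoly)" using pw by blast
    obtain E where E: "bh E (\<Prod>v\<in>A. Var v ^ lookup m v :: 'a bipoly)" using insert by blast
    have "\<exists>v\<in>insert a A. lookup m v \<noteq> 0 \<and> vanishes_on (Var v) Z"
      if "vanishes_on (\<Prod>v\<in>insert a A. Var v ^ lookup m v) Z"
    proof -
      have "vanishes_on (Var a ^ lookup m a * (\<Prod>v\<in>A. Var v ^ lookup m v)) Z" using that insert by simp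
      from subvariety_prime[OF Z D E this] show ?thesis
      proof
        assume *: "vanishes_on (Var a ^ lookup m a) Z"
        then have "lookup m a \<noteq> 0" using Z1 by (metis power_0)
        then show ?thesis using pw_van[OF *] by blast
      qed (use insert in blast)
    qed
    moreover have "bh (D + E) (\<Prod>v\<in>insert a A. Var v ^ lookup m v :: 'a bipoly)"
      using bh_mult[OF D E] insert by simp
    ultimately show ?case by blast
  qed
  from this[of UNIV] assms(2) show ?thesis by (auto simp: mon_eq_prod_Var in_keys_iff)
qed

section \<open>Binomial hypersurfaces\<close>

definition rep :: "nat \<Rightarrow> ('v \<Rightarrow>\<^sub>0 nat) \<Rightarrow> ('v \<Rightarrow>\<^sub>0 nat)" where
  "rep k m = ((+) m ^^ k) 0"

lemma rep_simps [simp]: "rep 0 m = 0" "rep (Suc k) m = m + rep k m"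
  by (simp_all add: rep_def)

lemma lookup_rep [simp]: "lookup (rep k m) v = k * lookup m v"
  by (induction k) (simp_all add: lookup_add)

lemma mon_val_rep: "mon_val x (rep k m) = mon_val x m ^ k"
  by (induction k) (simp_all add: mon_val_add)

lemma bideg_rep: "bideg m = bideg n \<Longrightarrow> bideg (rep k m) = bideg (rep k n)"
  by (induction k) (simp_all add: bideg_add)

definition bin_torus :: "(3 + 3 \<Rightarrow>\<^sub>0 nat) \<Rightarrow> (3 + 3 \<Rightarrow>\<^sub>0 nat) \<Rightarrow> (3 + 3 \<Rightarrow> 'k::field) set" where
  "bin_torus P Q = {x\<in>torus. mon_val x P = mon_val x Q}"

definition bin_var :: "(3 + 3 \<Rightarrow>\<^sub>0 nat) \<Rightarrow> (3 + 3 \<Rightarrow>\<^sub>0 nat) \<Rightarrow> 'k::field bipoint set" where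
  "bin_var P Q = closed_hull (bin_torus P Q)"

text \<open>The threefold \<open>P = Q\<close> is taken as the closure of its part \<open>T\<close> in the torus. The variable \<open>r\<close>
  occurs linearly in \<open>P\<close>, so \<open>T\<close> is the graph of \<open>r = Q / P'\<close> and therefore irreducible. The type argument
  \<open>ty\<close> fixes the ground field, which the exponents do not mention.\<close>

locale binomial =
  fixes ty :: "'k::alg_closed_field itself" and P Q P' :: "3 + 3 \<Rightarrow>\<^sub>0 nat" and r :: "3 + 3"
  assumes disj: "keys P \<inter> keys Q = {}" and bideg_eq: "bideg P = bideg Q"
    and P_r: "P = single r 1 + P'" and P'_r: "lookup P' r = 0"
begin

abbreviation T :: "(3 + 3 \<Rightarrow> 'k) set" where "T \<equiv> bin_torus P Q"
abbreviation V :: "'k bipoint set" where "V \<equiv> bin_var P Q"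

lemma Q_r: "lookup Q r = 0"
proof -
  have "r \<in> keys P" by (simp add: in_keys_iff P_r lookup_add)
  then show ?thesis using disj by (auto simp: in_keys_iff)
qed

lemma T_torus: "T \<subseteq> torus"
  by (auto simp: bin_torus_def)

lemma T_valid: "T \<subseteq> Collect valid"
  using T_torus torus_valid by blast

lemma mon_val_nz: "x \<in> torus \<Longrightarrow> mon_val x m \<noteq> 0"
  by (auto simp: mon_val_eq_0 torus_def)

lemma irreducible_T: "irreducible_set T"
proof (rule irreducible_image[where \<tau> = "\<lambda>x. x(r := mon_val x Q / mon_val x P')"])
  fix v
  show "\<exists>N D :: 'k bipoly. \<forall>x\<in>torus. mpoly_eval x D \<noteq> 0 \<and>
     (x(r := mon_val x Q / mon_val x P')) v * mpoly_eval x D = mpoly_eval x N"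
    by (rule exI[of _ "if v = r then mon Q else Var v"], rule exI[of _ "if v = r then mon P' else 1"])
      (simp add: mpoly_eval_single mon_val_nz)
  have upd: "mon_val (x(r := c)) P = c * mon_val x P'" "mon_val (x(r := c)) Q = mon_val x Q"
    for x :: "3 + 3 \<Rightarrow> 'k" and c
  proof -
    have 1: "mon_val (x(r := c)) P' = mon_val x P'" by (rule mon_val_cong) (use P'_r in \<open>auto simp: in_keys_iff\<close>)
    show "mon_val (x(r := c)) P = c * mon_val x P'"
      by (subst P_r) (simp add: mon_val_add mon_val_single 1)
    show "mon_val (x(r := c)) Q = mon_val x Q" by (rule mon_val_cong) (use Q_r in \<open>auto simp: in_keys_iff\<close>)
  qed
  show "T = (\<lambda>x. x(r := mon_val x Q / mon_val x P')) ` torus"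
  proof (intro equalityI subsetI)
    fix x assume x: "x \<in> T"
    then have "mon_val x P' \<noteq> 0" "mon_val x P = mon_val x Q"
      using mon_val_nz T_torus by (auto simp: bin_torus_def)
    then have "x r = mon_val x Q / mon_val x P'"
      using upd(1)[of x "x r"] by (simp add: field_simps)
    then show "x \<in> (\<lambda>x. x(r := mon_val x Q / mon_val x P')) ` torus"
      using x T_torus by (intro image_eqI[of _ _ x]) auto
  next
    fix y :: "3 + 3 \<Rightarrow> 'k" assume "y \<in> (\<lambda>x. x(r := mon_val x Q / mon_val x P')) ` torus"
    then obtain x where x: "x \<in> torus" "y = x(r := mon_val x Q / mon_val x P')" by blast
    then show "y \<in> T"
      using mon_val_nz[OF x(1)] by (auto simp: bin_torus_def upd) (simp add: torus_def)
  qed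
qed (rule T_valid)

lemma subvariety_V: "subvariety V"
  unfolding bin_var_def by (rule subvariety_closed_hull[OF irreducible_T])

lemma vanishes_on_V: "bh D F \<Longrightarrow> vanishes_on F V \<longleftrightarrow> vanish T F"
  unfolding bin_var_def by (rule vanishes_on_closed_hull[OF T_valid])

lemma vanish_prime: "vanish T (F * G) \<Longrightarrow> vanish T F \<or> vanish T G"
  using irreducible_T unfolding irreducible_set_def by blast

lemma vanish_mon: "\<not> vanish T (mon m)"
proof -
  obtain x where "x \<in> T" using irreducible_T by (auto simp: irreducible_set_def)
  then show ?thesis using mon_val_nz T_torus by (force simp: vanish_def mpoly_eval_single)
qed

lemma mon_P_eq_Q: "z \<in> V \<Longrightarrow> mon_val (coords z) P = mon_val (coords z) Q"
proof -
  assume z: "z \<in> V"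
  have b: "bh (bideg P) (mon P - mon Q :: 'k bipoly)"
    by (rule bh_diff) (use bh_single[of P "1::'k"] bh_single[of Q "1::'k"] bideg_eq in simp_all)
  have "vanish T (mon P - mon Q)"
    by (auto simp: vanish_def bin_torus_def mpoly_eval_simps)
  then have "vanishes_on (mon P - mon Q :: 'k bipoly) V" using vanishes_on_V[OF b] by simp
  then show ?thesis using z by (simp add: vanishes_on_iff mpoly_eval_simps)
qed

lemma bin_relation:
  assumes "x \<in> T" "m + rep k Q = n + rep k P"
  shows "mon_val x m = mon_val x n"
proof -
  have "mon_val x m * mon_val x Q ^ k = mon_val x n * mon_val x P ^ k"
    using arg_cong[OF assms(2), of "mon_val x"] by (simp add: mon_val_add mon_val_rep)
  moreover have "mon_val x P = mon_val x Q" "mon_val x Q \<noteq> 0"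
    using assms(1) mon_val_nz T_torus by (auto simp: bin_torus_def)
  ultimately show ?thesis by simp
qed

text \<open>If each monomial of \<open>F\<close>, multiplied by \<open>c\<close>, can be turned into a multiple of \<open>\<mu>\<close> by exchanging
  some copies of \<open>P\<close> for \<open>Q\<close>, then so can \<open>F\<close>. The predicate \<open>R\<close> keeps track of the quotients.\<close>

lemma rewrite_monomials:
  fixes F :: "'k bipoly"
  assumes F: "bh D F" "F \<noteq> 0"
    and ex: "\<And>m. m \<in> keys F \<Longrightarrow> \<exists>m' k. R m' \<and> m + c + rep k Q = \<mu> + m' + rep k P"
  shows "\<exists>X DX. bh DX X \<and> D + bideg c = bideg \<mu> + DX \<and> (\<forall>m\<in>keys X. R m) \<and>
     vanish T (F * mon c - mon \<mu> * X)"
proof -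
  obtain f k where f: "\<And>m. m \<in> keys F \<Longrightarrow> R (f m) \<and> m + c + rep (k m) Q = \<mu> + f m + rep (k m) P"
    using ex by metis
  define X where "X = (\<Sum>m\<in>keys F. single (f m) (lookup F m))"
  have keysX: "keys X \<subseteq> f ` keys F"
    unfolding X_def by (rule order_trans[OF keys_sum]) auto
  have deg: "bideg \<mu> + bideg (f m) = D + bideg c" if "m \<in> keys F" for m
  proof -
    have "bideg (m + c + rep (k m) Q) = bideg (\<mu> + f m + rep (k m) P)" using f that by simp
    then have "bideg m + bideg c = bideg \<mu> + bideg (f m)"
      using bideg_rep[OF bideg_eq, of "k m"] by (simp add: bideg_add)
    then show ?thesis using F(1) that by (simp add: bh_iff)
  qed
  obtain m0 where m0: "m0 \<in> keys F" using F(2) by (metis all_not_in_conv keys_eq_empty)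
  have "bideg m = bideg (f m0)" if m: "m \<in> keys X" for m
  proof -
    obtain m1 where m1: "m1 \<in> keys F" "m = f m1" using keysX m by blast
    have "bideg \<mu> + bideg (f m1) = bideg \<mu> + bideg (f m0)" using deg[OF m1(1)] deg[OF m0] by simp
    then show ?thesis using m1(2) by simp
  qed
  then have "bh (bideg (f m0)) X" by (simp add: bh_iff)
  moreover have "D + bideg c = bideg \<mu> + bideg (f m0)" using deg[OF m0] by simp
  moreover have "\<forall>m\<in>keys X. R m" using keysX f by blast
  moreover have "vanish T (F * mon c - mon \<mu> * X)"
    unfolding vanish_def
  proof
    fix x assume x: "x \<in> T"
    have eq: "mon_val x m * mon_val x c = mon_val x \<mu> * mon_val x (f m)" if "m \<in> keys F" for m
      using bin_relation[OF x conjunct2[OF f[OF that]]] by (simp add: mon_val_add)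
    have "mpoly_eval x (F * mon c) = (\<Sum>m\<in>keys F. lookup F m * (mon_val x m * mon_val x c))"
      by (simp add: mpoly_eval_simps mpoly_eval_alt[of x F] sum_distrib_right mult.assoc)
    also have "\<dots> = (\<Sum>m\<in>keys F. lookup F m * (mon_val x \<mu> * mon_val x (f m)))"
      by (intro sum.cong refl) (simp add: eq)
    also have "\<dots> = mpoly_eval x (mon \<mu> * X)"
      by (simp add: X_def mpoly_eval_simps sum_distrib_left mult_ac)
    finally show "mpoly_eval x (F * mon c - mon \<mu> * X) = 0" by (simp add: mpoly_eval_diff)
  qed
  ultimately show ?thesis by blast
qed

end

text \<open>The valuation along the linear subspace \<open>p = q = 0\<close> of the hypersurface \<open>P = Q\<close>: if
  \<open>P = p\<^sup>a \<sqdot> P\<^sub>0\<close> and \<open>Q = q\<^sup>b \<sqdot> Q\<^sub>0\<close>, then \<open>p\<close> has weight \<open>b\<close> and \<open>q\<close> has weight \<open>a\<close>.\<close>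

definition pq_weight :: "(3 + 3 \<Rightarrow>\<^sub>0 nat) \<Rightarrow> (3 + 3 \<Rightarrow>\<^sub>0 nat) \<Rightarrow> 3 + 3 \<Rightarrow> 3 + 3 \<Rightarrow> 3 + 3 \<Rightarrow> nat" where
  "pq_weight P Q p q = (\<lambda>v. if v = p then lookup Q q else if v = q then lookup P p else 0)"

locale boundary = binomial +
  fixes p q
  assumes p: "p \<in> keys P" and q: "q \<in> keys Q" and cop: "coprime (lookup P p) (lookup Q q)"
begin

definition a where "a = lookup P p"
definition b where "b = lookup Q q"
abbreviation w where "w \<equiv> pq_weight P Q p q"

lemma a_pos: "0 < a" and b_pos: "0 < b"
  using p q by (simp_all add: a_def b_def in_keys_iff)

lemma pq: "p \<noteq> q" "lookup P q = 0" "lookup Q p = 0"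
  using p q disj by (auto simp: in_keys_iff)

lemma w_simps: "w p = b" "w q = a" "v \<noteq> p \<Longrightarrow> v \<noteq> q \<Longrightarrow> w v = 0"
  using pq by (auto simp: pq_weight_def a_def b_def)

lemma weight_w: "weight w m = b * lookup m p + a * lookup m q"
proof -
  have "weight w m = (\<Sum>v\<in>{p, q}. w v * lookup m v)"
    unfolding weight_def by (rule sum.mono_neutral_right) (auto simp: w_simps)
  then show ?thesis using pq(1) by (simp add: w_simps)
qed

definition ge :: "nat \<Rightarrow> 'a bipoly \<Rightarrow> bool" where
  "ge n F \<longleftrightarrow> (\<forall>x\<in>T. \<forall>k<n. coeff (orbit_poly w x F) k = 0)"

text \<open>Both sides of \<open>P = Q\<close> have the same weight \<open>a \<sqdot> b\<close>.\<close>

lemma scale_T: "x \<in> T \<Longrightarrow> t \<noteq> 0 \<Longrightarrow> scale w t x \<in> T"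
proof -
  have "weight w P = weight w Q" using pq by (simp add: weight_w a_def b_def)
  then show "x \<in> T \<Longrightarrow> t \<noteq> 0 \<Longrightarrow> scale w t x \<in> T"
    by (simp add: bin_torus_def mon_val_scale torus_def) (simp add: scale_def)
qed

lemma vanish_iff_ge: "vanish T F \<longleftrightarrow> (\<forall>n. ge n F)"
proof
  assume F: "vanish T F"
  have "orbit_poly w x F = 0" if "x \<in> T" for x
    using F scale_T[OF that] by (intro poly_eq_by_eval) (auto simp: poly_orbit_poly vanish_def)
  then show "\<forall>n. ge n F" by (simp add: ge_def)
next
  assume F: "\<forall>n. ge n F"
  have "mpoly_eval x F = 0" if x: "x \<in> T" for x
  proof -
    have "orbit_poly w x F = 0"
      by (rule poly_eqI) (use F x in \<open>auto simp: ge_def\<close>)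
    then have "mpoly_eval (scale w 1 x) F = 0" by (simp flip: poly_orbit_poly)
    then show ?thesis by (simp add: scale_def)
  qed
  then show "vanish T F" by (simp add: vanish_def)
qed

lemma ge_mult: "ge m F \<Longrightarrow> ge n G \<Longrightarrow> ge (m + n) (F * G)"
  unfolding ge_def
proof (intro ballI allI impI)
  fix x k assume F: "\<forall>x\<in>T. \<forall>k<m. coeff (orbit_poly w x F) k = 0"
    and G: "\<forall>x\<in>T. \<forall>k<n. coeff (orbit_poly w x G) k = 0" and x: "x \<in> T" and k: "k < m + n"
  have "coeff (orbit_poly w x F) i * coeff (orbit_poly w x G) (k - i) = 0" if "i \<le> k" for i
  proof (cases "i < m")
    case False
    then have "k - i < n" using k that by arith
    then show ?thesis using G x by simp
  qed (use F x in simp)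
  then show "coeff (orbit_poly w x (F * G)) k = 0"
    unfolding orbit_poly_mult coeff_mult by (intro sum.neutral) simp
qed

lemma coeff_lowest:
  assumes "ge m F" "ge n G" "x \<in> T"
  shows "coeff (orbit_poly w x (F * G)) (m + n) = coeff (orbit_poly w x F) m * coeff (orbit_poly w x G) n"
proof -
  have "coeff (orbit_poly w x (F * G)) (m + n) =
      (\<Sum>i\<le>m + n. coeff (orbit_poly w x F) i * coeff (orbit_poly w x G) (m + n - i))"
    by (simp add: orbit_poly_mult coeff_mult)
  also have "\<dots> = (\<Sum>i\<in>{m}. coeff (orbit_poly w x F) i * coeff (orbit_poly w x G) (m + n - i))"
  proof (rule sum.mono_neutral_right)
    show "\<forall>i\<in>{..m + n} - {m}. coeff (orbit_poly w x F) i * coeff (orbit_poly w x G) (m + n - i) = 0"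
    proof
      fix i assume i: "i \<in> {..m + n} - {m}"
      show "coeff (orbit_poly w x F) i * coeff (orbit_poly w x G) (m + n - i) = 0"
      proof (cases "i < m")
        case False
        then have "m + n - i < n" using i by auto
        then show ?thesis using assms by (simp add: ge_def)
      qed (use assms in \<open>simp add: ge_def\<close>)
    qed
  qed auto
  finally show ?thesis by simp
qed

lemma exact_iff: "exact ge n F \<longleftrightarrow> ge n F \<and> \<not> vanish T (component w n F)"
  unfolding exact_def ge_def vanish_def coeff_orbit_poly[symmetric] by (auto simp: less_Suc_eq)

text \<open>The lowest component of a product is the product of the lowest components, and the ideal of \<open>T\<close> is
  prime.\<close>

lemma exact_mult:
  assumes "exact ge m F" "exact ge n G"
  shows "exact ge (m + n) (F * G)"
proof -
  have ge: "ge m F" "ge n G" using assms by (simp_all add: exact_iff)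
  have "\<not> vanish T (component w m F * component w n G)"
    using assms vanish_prime by (auto simp: exact_iff)
  then have "\<not> vanish T (component w (m + n) (F * G))"
    using coeff_lowest[OF ge] by (auto simp: vanish_def mpoly_eval_mult coeff_orbit_poly)
  then show ?thesis using ge_mult[OF ge] by (simp add: exact_iff)
qed

text \<open>A root of degree \<open>a\<close> completes a point of the linear subspace, after changing \<open>p\<close> and \<open>q\<close>, to a point
  of the threefold.\<close>

lemma lin_torus_extend:
  assumes x: "x \<in> lin_torus p q"
  shows "\<exists>y\<in>T. \<forall>v. v \<noteq> p \<longrightarrow> v \<noteq> q \<longrightarrow> y v = x v"
proof -
  define z where "z = x(p := 1, q := 1)"
  have z: "z v \<noteq> 0" for v using x pq(1) by (auto simp: z_def lin_torus_def)
  then have zt: "z \<in> torus" by (simp add: torus_def)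
  obtain \<rho> where \<rho>: "\<rho> ^ a = mon_val z Q / mon_val z P" using nth_root_exists[OF a_pos] by blast
  define y where "y = z(p := \<rho>)"
  have "\<rho> \<noteq> 0" using \<rho> mon_val_nz[OF zt] a_pos by (metis divide_eq_0_iff power_eq_0_iff)
  then have "y \<in> torus" using z by (simp add: y_def torus_def)
  moreover have "mon_val y P = mon_val y Q"
  proof -
    have yv: "y v ^ lookup P v = z v ^ lookup P v * (if v = p then \<rho> ^ a else 1)" for v
      by (simp add: y_def a_def z_def pq)
    have "mon_val y P = mon_val z P * \<rho> ^ a"
      unfolding mon_val_def by (subst yv) (simp add: prod.distrib)
    moreover have "mon_val y Q = mon_val z Q"
      by (rule mon_val_cong) (use pq in \<open>auto simp: y_def in_keys_iff\<close>)
    ultimately show ?thesis using \<rho> mon_val_nz[OF zt] by simp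
  qed
  ultimately show ?thesis by (intro bexI[of _ y]) (auto simp: bin_torus_def y_def z_def)
qed

lemma scale_0: "scale w 0 y = (\<lambda>v. if v = p \<or> v = q then 0 else y v)"
proof
  fix v
  show "scale w 0 y v = (if v = p \<or> v = q then 0 else y v)"
    using a_pos b_pos w_simps pq(1) by (cases "v = p"; cases "v = q") (simp_all add: scale_def zero_power)
qed

text \<open>For \<open>t \<longrightarrow> 0\<close> the one-parameter group contracts \<open>T\<close> onto the torus of the linear subspace, so the
  constant coefficient of the orbit polynomial is the restriction to this subspace.\<close>

lemma vanish_lin_iff: "vanish (lin_torus p q) F \<longleftrightarrow> ge 1 F"
proof -
  have ge1: "ge 1 F \<longleftrightarrow> (\<forall>y\<in>T. mpoly_eval (scale w 0 y) F = 0)"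
    by (simp add: ge_def poly_0_coeff_0[symmetric] poly_orbit_poly)
  show ?thesis
  proof
    assume F: "vanish (lin_torus p q) F"
    have "scale w 0 y \<in> lin_torus p q" if "y \<in> T" for y
      using that T_torus by (auto simp: scale_0 lin_torus_def torus_def)
    then show "ge 1 F" using F unfolding ge1 vanish_def by blast
  next
    assume F: "ge 1 F"
    show "vanish (lin_torus p q) F"
      unfolding vanish_def
    proof
      fix x :: "3 + 3 \<Rightarrow> 'a" assume x: "x \<in> lin_torus p q"
      obtain y where y: "y \<in> T" "\<And>v. v \<noteq> p \<Longrightarrow> v \<noteq> q \<Longrightarrow> y v = x v" using lin_torus_extend[OF x] by blast
      have "scale w 0 y = x" using x y(2) by (auto simp: scale_0 lin_torus_def fun_eq_iff)
      then show "mpoly_eval x F = 0" using F y(1) unfolding ge1 by metis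
    qed
  qed
qed

definition P0 where "P0 = P - single p a"
definition Q0 where "Q0 = Q - single q b"

lemma lookup_P0: "lookup P0 v = (if v = p then 0 else lookup P v)"
  by (auto simp: P0_def a_def lookup_minus lookup_single when_def)

lemma lookup_Q0: "lookup Q0 v = (if v = q then 0 else lookup Q v)"
  by (auto simp: Q0_def b_def lookup_minus lookup_single when_def)

lemma exact_mon: "exact ge (weight w m) (mon m)"
  unfolding exact_iff
proof
  show "ge (weight w m) (mon m)" by (simp add: ge_def orbit_poly_single)
  have "component w (weight w m) (mon m) = (mon m :: 'a bipoly)"
    by (rule poly_mapping_eqI) (auto simp: lookup_component lookup_single when_def)
  then show "\<not> vanish T (component w (weight w m) (mon m))" using vanish_mon by simp
qed

text \<open>If both monomials have the same weight then the whole binomial is its own lowest component.\<close>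

lemma exact_binomial:
  assumes "\<not> vanish T (mon m - mon n)"
  shows "exact ge (min (weight w m) (weight w n)) (mon m - mon n)"
proof -
  have op: "orbit_poly w x (mon m - mon n) = monom (mon_val x m) (weight w m) - monom (mon_val x n) (weight w n)"
    for x :: "3 + 3 \<Rightarrow> 'a"
    by (simp add: orbit_poly_diff orbit_poly_single)
  obtain x where x: "x \<in> T" "mon_val x m \<noteq> mon_val x n"
    using assms by (auto simp: vanish_def mpoly_eval_simps)
  have "coeff (orbit_poly w x (mon m - mon n)) (min (weight w m) (weight w n)) \<noteq> 0"
    using x mon_val_nz[of x] T_torus unfolding op by (auto simp: min_def)
  then have "\<not> ge (Suc (min (weight w m) (weight w n))) (mon m - mon n)"
    unfolding ge_def using x(1) by blast
  moreover have "ge (min (weight w m) (weight w n)) (mon m - mon n)"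
    by (simp add: ge_def op)
  ultimately show ?thesis by (simp add: exact_def)
qed

lemma not_vanish_ge_1:
  assumes "\<And>m. m \<in> keys F \<Longrightarrow> weight w m = 0"
  shows "ge 1 F \<longleftrightarrow> vanish T F"
proof -
  have "component w 0 F = F"
    by (rule poly_mapping_eqI) (use assms in \<open>force simp: lookup_component in_keys_iff\<close>)
  then show ?thesis by (simp add: ge_def vanish_def coeff_orbit_poly)
qed

text \<open>Since \<open>a\<close> and \<open>b\<close> are coprime, two monomials in \<open>p\<close> and \<open>q\<close> of the same weight differ by exchanging
  factors \<open>p\<^sup>a\<close> and \<open>q\<^sup>b\<close>. Modulo \<open>P = Q\<close> and up to units, every weight space is therefore spanned by a
  single monomial, chosen with the smallest exponent \<open>i0\<close> of \<open>p\<close>. At most \<open>n\<close> exchanges are needed, which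
  makes the factor \<open>rep n P0\<close> uniform.\<close>

lemma reduce_monomial:
  assumes "weight w m = n" "b * i0 + a * j0 = n" "i0 < a"
  shows "\<exists>m' k. (lookup m' p = 0 \<and> lookup m' q = 0) \<and>
    m + rep n P0 + rep k Q = (single p i0 + single q j0) + m' + rep k P"
proof -
  have eq: "b * lookup m p + a * lookup m q = b * i0 + a * j0" using assms by (simp add: weight_w)
  have cop': "coprime a b" using cop by (simp add: a_def b_def)
  have "[b * lookup m p = b * i0] (mod a)"
  proof -
    have "(b * lookup m p + a * lookup m q) mod a = (b * i0 + a * j0) mod a" using eq by simp
    then show ?thesis by (simp add: cong_def)
  qed
  then have "[lookup m p = i0] (mod a)"
    using cop' by (simp add: cong_mult_lcancel_nat coprime_commute)
  then have mod: "lookup m p mod a = i0" using assms(3) by (simp add: cong_def)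
  define k where "k = lookup m p div a"
  have mp: "lookup m p = i0 + a * k" unfolding k_def using mod by (metis add.commute mult_div_mod_eq)
  have j0: "j0 = lookup m q + b * k"
  proof -
    have "a * (lookup m q + b * k) = a * j0" using eq mp by (simp add: algebra_simps)
    then show ?thesis using a_pos by simp
  qed
  have "k \<le> n"
  proof -
    have "k \<le> lookup m p" unfolding k_def by simp
    also have "\<dots> \<le> b * lookup m p" using b_pos by simp
    also have "\<dots> \<le> n" using assms(1) by (simp add: weight_w)
    finally show ?thesis .
  qed
  then obtain l where l: "n = k + l" using le_Suc_ex by blast
  define m0 where "m0 = m - single p (lookup m p) - single q (lookup m q)"
  have m0: "lookup m0 v = (if v = p \<or> v = q then 0 else lookup m v)" for v
    using pq(1) by (auto simp: m0_def lookup_minus lookup_single when_def)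
  define m' where "m' = m0 + rep k Q0 + rep l P0"
  have "m + rep n P0 + rep k Q = (single p i0 + single q j0) + m' + rep k P"
  proof (rule poly_mapping_eqI)
    fix v
    consider "v = p" | "v = q" "v \<noteq> p" | "v \<noteq> p" "v \<noteq> q" by blast
    then show "lookup (m + rep n P0 + rep k Q) v = lookup (single p i0 + single q j0 + m' + rep k P) v"
      using pq by cases (simp_all add: m'_def lookup_add lookup_single m0 lookup_P0 lookup_Q0 mp j0 l
          a_def[symmetric] b_def[symmetric] algebra_simps when_def)
  qed
  moreover have "lookup m' p = 0 \<and> lookup m' q = 0"
    using pq by (simp add: m'_def lookup_add m0 lookup_P0 lookup_Q0)
  ultimately show ?thesis by blast
qed

text \<open>A monomial of weight at least \<open>a \<sqdot> b\<close> contains \<open>q\<close>, or else \<open>p\<^sup>a\<close>, which can be exchanged for \<open>q\<^sup>b\<close>.\<close>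

lemma divide_monomial:
  assumes "a * b \<le> weight w m"
  shows "\<exists>m' k. True \<and> m + P0 + rep k Q = single q 1 + m' + rep k P"
proof (cases "lookup m q = 0")
  case False
  then have "m + P0 + rep 0 Q = single q 1 + (m - single q 1 + P0) + rep 0 P"
    by (intro poly_mapping_eqI) (auto simp: lookup_add lookup_minus lookup_single when_def)
  then show ?thesis by blast
next
  case True
  then have "b * a \<le> b * lookup m p" using assms by (simp add: weight_w mult.commute)
  then have mp: "a \<le> lookup m p" using b_pos by simp
  have "m + P0 + rep 1 Q = single q 1 + ((m - single p a) + (Q - single q 1)) + rep 1 P"
  proof (rule poly_mapping_eqI)
    fix v
    show "lookup (m + P0 + rep 1 Q) v = lookup (single q 1 + ((m - single p a) + (Q - single q 1)) + rep 1 P) v"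
      using mp b_pos pq by (auto simp: lookup_add lookup_minus lookup_single lookup_P0 when_def a_def b_def)
  qed
  then show ?thesis by blast
qed

lemma large_weights:
  assumes "a * b \<le> n"
  shows "\<exists>i j. b * i + a * j = n \<and> i < a"
proof -
  obtain x where x: "[b * x = 1] (mod a)"
    using cop cong_solve_coprime_nat[of b a] by (auto simp: a_def b_def coprime_commute)
  define i where "i = (x * n) mod a"
  have "[b * i = b * (x * n)] (mod a)" unfolding i_def by (simp add: cong_def mod_mult_right_eq)
  also have "[b * (x * n) = 1 * n] (mod a)" using cong_mult[OF x cong_refl[of n]] by (simp add: mult.assoc)
  finally have c: "[b * i = n] (mod a)" by simp
  have i: "i < a" using a_pos by (simp add: i_def)
  then have "b * i \<le> b * a" by simp
  also have "\<dots> \<le> n" using assms by (simp add: mult.commute)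
  finally have le: "b * i \<le> n" .
  then have "a dvd n - b * i" using c mod_eq_dvd_iff_nat[OF le] unfolding cong_def by metis
  then obtain j where "n - b * i = a * j" by (auto elim: dvdE)
  then show ?thesis using le i by (intro exI[of _ i] exI[of _ j]) simp
qed

lemma vanishes_on_lin: "bh D F \<Longrightarrow> vanishes_on F (lin p q) \<longleftrightarrow> ge 1 F"
  using vanishes_on_closed_hull[OF lin_torus_valid, of D F p q]
  unfolding closed_hull_lin_torus vanish_lin_iff by blast

lemma lin_V: "lin p q \<subseteq> V"
proof (rule zariski_closed_subsetI[OF subvariety_closed[OF subvariety_V] subvariety_valid[OF subvariety_lin]])
  fix F D assume "bh D F" "vanishes_on F V"
  then show "vanishes_on F (lin p q)"
    using vanishes_on_V vanish_iff_ge vanishes_on_lin by blast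
qed

text \<open>Both lowest components are, up to a unit, multiples of the same monomial in \<open>p\<close> and \<open>q\<close>; the
  cofactors \<open>X\<close> and \<open>Y\<close> have weight zero and provide the units.\<close>

lemma residue:
  assumes F: "bh D F" "exact ge n F" and G: "bh E G" "exact ge n G"
  shows "\<exists>A B DA DB. bh DA A \<and> bh DB B \<and> \<not> vanishes_on A (lin p q) \<and> \<not> vanishes_on B (lin p q) \<and>
    D + DB = E + DA \<and> ge (Suc n) (F * B - G * A)"
proof -
  let ?Fn = "component w n F" and ?Gn = "component w n G"
  let ?c = "rep n P0"
  have Fn: "bh D ?Fn" "\<not> vanish T ?Fn" and Gn: "bh E ?Gn" "\<not> vanish T ?Gn"
    using F G by (simp_all add: bh_component exact_iff)
  have nz: "?Fn \<noteq> 0" "?Gn \<noteq> 0" using Fn Gn by (auto simp: vanish_def)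
  obtain m0 where "m0 \<in> keys ?Fn" using nz(1) by (metis all_not_in_conv keys_eq_empty)
  then have m0: "weight w m0 = n" by (simp add: keys_component)
  define i0 where "i0 = lookup m0 p mod a"
  define j0 where "j0 = lookup m0 q + b * (lookup m0 p div a)"
  have ij: "b * i0 + a * j0 = n" "i0 < a"
  proof -
    have "b * i0 + a * j0 = b * (i0 + a * (lookup m0 p div a)) + a * lookup m0 q"
      by (simp add: j0_def algebra_simps)
    also have "i0 + a * (lookup m0 p div a) = lookup m0 p" by (simp add: i0_def)
    finally show "b * i0 + a * j0 = n" using m0 by (simp add: weight_w)
    show "i0 < a" using a_pos by (simp add: i0_def)
  qed
  let ?\<mu> = "single p i0 + single q j0"
  have red: "\<exists>m' k. (lookup m' p = 0 \<and> lookup m' q = 0) \<and> m + ?c + rep k Q = ?\<mu> + m' + rep k P"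
    if "m \<in> keys (component w n H)" for m H
    using reduce_monomial[OF _ ij] that by (simp add: keys_component)
  obtain X DX where X: "bh DX X" "D + bideg ?c = bideg ?\<mu> + DX" "\<forall>m\<in>keys X. lookup m p = 0 \<and> lookup m q = 0"
    "vanish T (?Fn * mon ?c - mon ?\<mu> * X)"
    using rewrite_monomials[where R = "\<lambda>m. lookup m p = 0 \<and> lookup m q = 0", OF Fn(1) nz(1) red[of _ F]] by blast
  obtain Y DY where Y: "bh DY Y" "E + bideg ?c = bideg ?\<mu> + DY" "\<forall>m\<in>keys Y. lookup m p = 0 \<and> lookup m q = 0"
    "vanish T (?Gn * mon ?c - mon ?\<mu> * Y)"
    using rewrite_monomials[where R = "\<lambda>m. lookup m p = 0 \<and> lookup m q = 0", OF Gn(1) nz(2) red[of _ G]] by blast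
  have not_vanish: "\<not> vanish T Z" if "\<not> vanish T H" "vanish T (H * mon ?c - mon ?\<mu> * Z)" for H Z
  proof
    assume "vanish T Z"
    then have "vanish T (H * mon ?c)" using that(2) by (simp add: vanish_def mpoly_eval_simps)
    then show False using vanish_prime vanish_mon that(1) by blast
  qed
  have nv: "\<not> vanishes_on (Z * mon ?c) (lin p q)"
    if Z: "bh DZ Z" "\<forall>m\<in>keys Z. lookup m p = 0 \<and> lookup m q = 0" "\<not> vanish T Z" for Z DZ
  proof -
    have "weight w m = 0" if m: "m \<in> keys (Z * mon ?c)" for m
    proof -
      obtain l where "l \<in> keys Z" "m = l + ?c" using keys_mult[of Z "mon ?c"] m by auto
      then show ?thesis using Z(2) pq by (simp add: weight_w lookup_add lookup_P0)
    qed
    then have "ge 1 (Z * mon ?c) \<longleftrightarrow> vanish T (Z * mon ?c)" by (rule not_vanish_ge_1)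
    moreover have "\<not> vanish T (Z * mon ?c)" using Z(3) vanish_prime vanish_mon by blast
    ultimately show ?thesis using vanishes_on_lin[OF bh_mult[OF Z(1) bh_single]] by simp
  qed
  have lead: "ge (Suc n) (H - component w n H)" if "ge n H" for H
    unfolding ge_def
  proof (intro ballI allI impI)
    fix x k assume x: "x \<in> T" and k: "k < Suc n"
    have "component w k (component w n H) = (if k = n then component w n H else 0)"
      by (rule poly_mapping_eqI) (simp add: lookup_component)
    then show "coeff (orbit_poly w x (H - component w n H)) k = 0"
      using that x k by (auto simp: orbit_poly_diff ge_def coeff_orbit_poly less_Suc_eq)
  qed
  have geF: "ge n F" "ge n G" using F G by (simp_all add: exact_def)
  have ge0: "ge 0 H" for H by (simp add: ge_def)
  have "ge (Suc n + 0) ((F - ?Fn) * (Y * mon ?c))" "ge (Suc n + 0) ((G - ?Gn) * (X * mon ?c))"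
    by (intro ge_mult lead geF ge0)+
  moreover have "vanish T (Y * (?Fn * mon ?c - mon ?\<mu> * X) - X * (?Gn * mon ?c - mon ?\<mu> * Y))"
    using X(4) Y(4) by (simp add: vanish_def mpoly_eval_simps)
  then have "ge (Suc n) (Y * (?Fn * mon ?c - mon ?\<mu> * X) - X * (?Gn * mon ?c - mon ?\<mu> * Y))"
    using vanish_iff_ge by blast
  ultimately have "ge (Suc n) ((F - ?Fn) * (Y * mon ?c) - (G - ?Gn) * (X * mon ?c) +
      (Y * (?Fn * mon ?c - mon ?\<mu> * X) - X * (?Gn * mon ?c - mon ?\<mu> * Y)))"
    by (simp add: ge_def orbit_poly_diff orbit_poly_add)
  also have "(F - ?Fn) * (Y * mon ?c) - (G - ?Gn) * (X * mon ?c) +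
      (Y * (?Fn * mon ?c - mon ?\<mu> * X) - X * (?Gn * mon ?c - mon ?\<mu> * Y)) = F * (Y * mon ?c) - G * (X * mon ?c)"
    by (simp add: algebra_simps)
  finally have "ge (Suc n) (F * (Y * mon ?c) - G * (X * mon ?c))" .
  moreover have "D + (DY + bideg ?c) = E + (DX + bideg ?c)"
  proof -
    have "D + (DY + bideg ?c) = (D + bideg ?c) + DY" by (simp only: add_ac)
    also have "\<dots> = (E + bideg ?c) + DX" by (simp only: X(2) Y(2)) (simp only: add_ac)
    finally show ?thesis by (simp only: add_ac)
  qed
  ultimately show ?thesis
    using nv[OF X(1,3) not_vanish[OF Fn(2) X(4)]] nv[OF Y(1,3) not_vanish[OF Gn(2) Y(4)]]
      bh_mult[OF X(1) bh_single[of ?c 1]] bh_mult[OF Y(1) bh_single[of ?c 1]] by blast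
qed

lemma uniform:
  assumes F: "bh D F" "ge (a * b) F"
  shows "\<exists>U X DU DX. bh DU U \<and> \<not> vanishes_on U (lin p q) \<and> bh DX X \<and>
    DU + D = bideg (single q 1) + DX \<and> vanishes_on (U * F - Var q * X) V"
proof -
  let ?\<mu> = "single q (1::nat)"
  define F' where "F' = F - (\<Sum>k<a * b. component w k F)"
  have bF': "bh D F'" unfolding F'_def by (intro bh_diff F bh_sum bh_component)
  have FF': "vanish T (F - F')"
    using F(2) by (simp add: F'_def vanish_def mpoly_eval_sum ge_def coeff_orbit_poly)
  have keysF': "a * b \<le> weight w m" if "m \<in> keys F'" for m
  proof (rule ccontr)
    assume "\<not> a * b \<le> weight w m"
    then have "lookup F' m = 0" by (simp add: F'_def lookup_minus lookup_sum lookup_component)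
    then show False using that by (simp add: in_keys_iff)
  qed
  show ?thesis
  proof (cases "F' = 0")
    case True
    interpret local_germs "lin p q :: 'a bipoint set" by unfold_locales (rule subvariety_lin)
    obtain U where U: "bh (bideg ?\<mu>) U" "nv U" using nv_ex by blast
    have "vanish T F" using FF' True by simp
    then have "vanish T (U * F - Var q * 0)" by (simp add: vanish_def mpoly_eval_simps)
    moreover have "bh (bideg ?\<mu> + D) (U * F - Var q * 0)" using bh_mult[OF U(1) F(1)] by simp
    ultimately have "vanishes_on (U * F - Var q * 0) V" using vanishes_on_V by blast
    then show ?thesis using U bh_0 by blast
  next
    case False
    obtain X DX where X: "bh DX X" "D + bideg P0 = bideg ?\<mu> + DX" "vanish T (F' * mon P0 - mon ?\<mu> * X)"
      using rewrite_monomials[where R = "\<lambda>_. True", OF bF' False divide_monomial[OF keysF']] by blast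
    have "vanish T (mon P0 * F - Var q * X)"
      using X(3) FF' by (simp add: vanish_def mpoly_eval_simps Var_def mult.commute)
    moreover have deg: "bideg P0 + D = bideg ?\<mu> + DX" using X(2) by (simp add: add.commute)
    have bb: "bh (bideg P0 + D) (mon P0 * F - Var q * X)"
    proof (rule bh_diff)
      show "bh (bideg P0 + D) (mon P0 * F)" by (rule bh_mult[OF bh_single F(1)])
      show "bh (bideg P0 + D) (Var q * X)" unfolding deg by (rule bh_mult[OF bh_Var X(1)])
    qed
    ultimately have "vanishes_on (mon P0 * F - Var q * X) V" using vanishes_on_V[OF bb] by blast
    moreover have "\<not> vanishes_on (mon P0 :: 'a bipoly) (lin p q)"
    proof -
      have "ge 1 (mon P0) \<longleftrightarrow> vanish T (mon P0)"
        by (rule not_vanish_ge_1) (use pq in \<open>simp add: weight_w lookup_P0\<close>)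
      then show ?thesis using vanish_mon vanishes_on_lin[OF bh_single] by simp
    qed
    ultimately show ?thesis using deg X(1) bh_single[of P0 "1::'a"] by blast
  qed
qed

sublocale filtration "lin p q" V ge "Var q" "bideg (single q 1)" a "a * b" "a * b"
proof unfold_locales
  show "subvariety (lin p q :: 'a bipoint set)" by (rule subvariety_lin)
  show "subvariety V" by (rule subvariety_V)
  show "lin p q \<subseteq> V" by (rule lin_V)
  show "ge n F \<Longrightarrow> m \<le> n \<Longrightarrow> ge m F" for m n F by (auto simp: ge_def)
  show "ge n F \<Longrightarrow> ge n G \<Longrightarrow> ge n (F + G)" for n F G by (auto simp: ge_def orbit_poly_add)
  show "ge 0 F" for F by (simp add: ge_def)
  show "ge m F \<Longrightarrow> ge n G \<Longrightarrow> ge (m + n) (F * G)" for m n F G by (rule ge_mult)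
  show "vanishes_on F V \<longleftrightarrow> (\<forall>n. ge n F)" if "bh D F" for D F
    using vanishes_on_V[OF that] vanish_iff_ge by simp
  show "vanishes_on F (lin p q) \<longleftrightarrow> ge 1 F" if "bh D F" for D F by (rule vanishes_on_lin[OF that])
  show "exact ge m F \<Longrightarrow> exact ge n G \<Longrightarrow> exact ge (m + n) (F * G)" for m n F G by (rule exact_mult)
  show "\<exists>A B DA DB. bh DA A \<and> bh DB B \<and> \<not> vanishes_on A (lin p q) \<and> \<not> vanishes_on B (lin p q) \<and>
      D + DB = E + DA \<and> ge (Suc n) (F * B - G * A)"
    if "bh D F" "bh E G" "exact ge n F" "exact ge n G" for D E n F G
    by (rule residue[OF that(1,3,2,4)])
  show "bh (bideg (single q 1)) (Var q)" by (rule bh_Var)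
  show "exact ge a (Var q)"
    using exact_mon[of "single q 1"] pq by (simp add: Var_def weight_w lookup_single)
  show "0 < a" by (rule a_pos)
  show "\<exists>U X DU DX. bh DU U \<and> \<not> vanishes_on U (lin p q) \<and> bh DX X \<and>
      DU + D = bideg (single q 1) + DX \<and> vanishes_on (U * F - Var q * X) V"
    if "bh D F" "ge (a * b) F" for D F by (rule uniform[OF that])
  show "\<exists>D F. bh D F \<and> exact ge n F" if n: "a * b \<le> n" for n
  proof -
    obtain i j where ij: "b * i + a * j = n" using large_weights[OF n] by blast
    then have "weight w (single p i + single q j) = n"
      using pq by (simp add: weight_w lookup_add lookup_single when_def)
    then show ?thesis using exact_mon[of "single p i + single q j"] bh_single by metis
  qed
qed

lemma lin_psubset: "lin p q \<subset> V"
proof -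
  obtain x where x: "x \<in> T" using irreducible_T by (auto simp: irreducible_set_def)
  obtain z where z: "coords z = x" using coords_surj by blast
  have "z \<in> V" unfolding bin_var_def using x z T_valid by (intro closed_hull_superset) auto
  moreover have "z \<notin> lin p q" using x z T_torus by (auto simp: mem_lin torus_def)
  ultimately show ?thesis using lin_V by blast
qed

text \<open>A larger proper subvariety lies in \<open>q = 0\<close>, and the part of the threefold in \<open>q = 0\<close> is a union of
  linear subspaces.\<close>

lemma prime_divisor_lin: "prime_divisor V (lin p q)"
  unfolding prime_divisor_def
proof (intro conjI allI impI)
  fix Z assume Z: "subvariety Z" "lin p q \<subseteq> Z" "Z \<subseteq> V"
  show "Z = lin p q \<or> Z = V"
  proof (cases "vanishes_on (Var q) Z")
    case False
    then show ?thesis using overvariety[OF Z] by blast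
  next
    case True
    have "mon_val (coords z) P = 0" if "z \<in> Z" for z
    proof -
      have "coords z q = 0" using True that by (auto simp: vanishes_on_iff)
      then have "mon_val (coords z) Q = 0" using q by (auto simp: mon_val_eq_0)
      moreover have "z \<in> V" using that Z(3) by blast
      ultimately show ?thesis using mon_P_eq_Q by simp
    qed
    then have "vanishes_on (mon P) Z" by (simp add: vanishes_on_iff mpoly_eval_single)
    then obtain p' where p': "p' \<in> keys P" "vanishes_on (Var p') Z" using prime_mon[OF Z(1)] by blast
    have Zp': "Z \<subseteq> lin p' q"
      using True p'(2) subvariety_valid[OF Z(1)] by (auto simp: mem_lin vanishes_on_iff)
    then have "p' \<in> {p, q}" using Z(2) lin_subset_iff(1) by (metis order_trans)
    moreover have "p' \<noteq> q" using p'(1) q disj by blast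
    ultimately show ?thesis using Zp' Z(2) by auto
  qed
qed (use lin_psubset subvariety_lin in auto)

end

section \<open>Principal divisors of binomials\<close>

lemma subvariety_Union:
  assumes Z: "subvariety Z" and "finite A" and "\<And>W. W \<in> A \<Longrightarrow> zariski_closed W" and "Z \<subseteq> \<Union>A"
  shows "\<exists>W\<in>A. Z \<subseteq> W"
  using assms(2,3,4)
proof (induction A)
  case empty
  then show ?case using Z by (auto simp: subvariety_def)
next
  case (insert W A)
  have cl: "zariski_closed (\<Union>B)" if "finite B" "\<And>W. W \<in> B \<Longrightarrow> zariski_closed W" for B :: "'a bipoint set set"
    using that
  proof (induction B)
    case empty
    have "zero_locus {1 :: 'a bipoly} = {}" by (auto simp: mem_zero_locus)
    moreover have "zariski_closed (zero_locus {1 :: 'a bipoly})"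
      by (rule zariski_closed_zero_locus) (auto intro: exI[of _ 0])
    ultimately show ?case by simp
  next
    case (insert W B)
    then have W: "zariski_closed W" and B: "zariski_closed (\<Union>B)" by auto
    obtain S S' where S: "\<forall>F\<in>S. \<exists>d e. bihomogeneous d e F" "W = zero_locus S"
      and S': "\<forall>F\<in>S'. \<exists>d e. bihomogeneous d e F" "\<Union>B = zero_locus S'"
      using W B unfolding zariski_closed_def by metis
    have "W \<union> \<Union>B = zero_locus {F * G | F G. F \<in> S \<and> G \<in> S'}"
    proof (rule Set.set_eqI)
      fix P
      show "P \<in> W \<union> \<Union>B \<longleftrightarrow> P \<in> zero_locus {F * G | F G. F \<in> S \<and> G \<in> S'}"
        unfolding S S' Un_iff mem_zero_locus by (fastforce simp: mpoly_eval_mult)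
    qed
    moreover have "zariski_closed (zero_locus {F * G | F G. F \<in> S \<and> G \<in> S'})"
    proof (rule zariski_closed_zero_locus)
      fix H assume "H \<in> {F * G | F G. F \<in> S \<and> G \<in> S'}"
      then obtain F G where FG: "H = F * G" "F \<in> S" "G \<in> S'" by blast
      obtain d e where 1: "bihomogeneous d e F" using S(1) FG(2) by blast
      obtain d' e' where 2: "bihomogeneous d' e' G" using S'(1) FG(3) by blast
      show "\<exists>D. bh D H" using 1 2 bh_mult unfolding FG(1) bihomogeneous_bh by blast
    qed
    ultimately show ?case by simp
  qed
  have "Z \<subseteq> W \<union> \<Union>A" "zariski_closed W" "zariski_closed (\<Union>A)" using insert cl by auto
  then have "Z \<subseteq> W \<or> Z \<subseteq> \<Union>A" using Z unfolding subvariety_def by blast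
  then show ?case using insert by auto
qed

text \<open>Only prime divisors on which one of the two forms vanishes contribute.\<close>

lemma principal_divisor_eqI:
  assumes bh: "bh D F" "bh D G" and fin: "finite I" and inj: "inj_on Di I"
    and pd: "\<And>i. i \<in> I \<Longrightarrow> prime_divisor V (Di i)"
    and ord: "\<And>i. i \<in> I \<Longrightarrow> int (vanishing_order V (Di i) F) - int (vanishing_order V (Di i) G) = n i"
    and other: "\<And>W. prime_divisor V W \<Longrightarrow> W \<notin> Di ` I \<Longrightarrow> \<not> vanishes_on F W \<and> \<not> vanishes_on G W"
  shows "principal_divisor V F G = (\<Sum>i\<in>I. single (Di i) (n i))"
proof -
  define E where "E = (\<Sum>i\<in>I. single (Di i) (n i))"
  have "(if prime_divisor V W then int (vanishing_order V W F) - int (vanishing_order V W G) else 0) = lookup E W" for W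
  proof (cases "W \<in> Di ` I")
    case True
    then obtain i where i: "i \<in> I" "W = Di i" by blast
    have "lookup E W = (\<Sum>j\<in>I. if j = i then n i else 0)"
      unfolding E_def lookup_sum lookup_single when_def
      using i inj by (intro sum.cong) (auto simp: inj_on_def)
    then show ?thesis using i fin pd ord by simp
  next
    case False
    then have "lookup E W = 0"
      unfolding E_def lookup_sum lookup_single when_def by (intro sum.neutral) auto
    moreover have "vanishing_order V W F = 0" "vanishing_order V W G = 0" if "prime_divisor V W"
    proof -
      interpret local_germs W by unfold_locales (use that in \<open>simp add: prime_divisor_def\<close>)
      show "vanishing_order V W F = 0" "vanishing_order V W G = 0"
        using other[OF that False] vanishing_order_not_vanishing bh by blast+
    qed
    ultimately show ?thesis by simp
  qed
  then have "principal_divisor V F G = Abs_poly_mapping (lookup E)"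
    unfolding principal_divisor_def by presburger
  then show ?thesis by (simp add: E_def lookup_inverse)
qed

context local_germs
begin

text \<open>The assumption says that \<open>F\<close> generates the maximal ideal of the local ring of \<open>V\<close> along \<open>W\<close>.\<close>

lemma vanishing_order_eq_1:
  assumes F: "bh D F" "vanishes_on F W" and W: "W \<subseteq> V"
    and gen: "\<And>E H. bh E H \<Longrightarrow> vanishes_on H W \<Longrightarrow>
      \<exists>U X DU DX E'. bh DU U \<and> nv U \<and> bh DX X \<and> bh E' (U * H) \<and> bh E' (F * X) \<and> vanishes_on (U * H - F * X) V"
  shows "vanishing_order V W F = 1"
proof -
  have max: "mem_form J H" if J: "admissible V F J" and H: "bh E H" "vanishes_on H W" for J E H
  proof -
    have id: "ideal J R" and memF: "mem_form J F" and memV: "\<And>D G. bh D G \<Longrightarrow> vanishes_on G V \<Longrightarrow> mem_form J G"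
      using J by (auto simp: admissible_def)
    obtain U X DU DX E' where U: "bh DU U" "nv U" "bh DX X" "bh E' (U * H)" "bh E' (F * X)" "vanishes_on (U * H - F * X) V"
      using gen[OF H] by blast
    have "mem_form J (U * H - F * X + F * X)"
      by (rule mem_form_add[OF id memV[OF bh_diff[OF U(4,5)] U(6)] mem_form_mult[OF id memF U(3)] bh_diff[OF U(4,5)] U(5)])
    then have "mem_form J (H * U)" by (simp add: mult.commute)
    then show ?thesis using mem_form_cancel[OF id _ U(2) H(1) U(1)] by blast
  qed
  have full: "J' = carrier R" if J: "admissible V F J" "admissible V F J'" "J \<subset> J'" for J J'
  proof -
    have id: "ideal J R" "ideal J' R" using J by (simp_all add: admissible_def)
    then obtain r where r: "r \<in> J'" "r \<notin> J" using J(3) by blast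
    then have "r \<in> carrier R" using additive_subgroup.a_subset[OF ideal.axioms(1)[OF id(2)]] by blast
    then obtain E G H where G: "r = Fract G H" "is_frac E G H" by (rule carrierE)
    have "mem_form J' G" "\<not> mem_form J G"
      using r G mem_form_iff[OF id(1) G(2)] mem_form_iff[OF id(2) G(2)] by simp_all
    then have "nv G" using max[OF J(1)] G(2) by (auto simp: is_frac_def)
    then have "is_frac E G G" using G(2) by (simp add: is_frac_def)
    then have "Fract G G \<in> J'" using \<open>mem_form J' G\<close> mem_form_iff[OF id(2)] by blast
    moreover have "Fract G G = \<one>\<^bsub>R\<^esub>"
      using nv_nonzero[OF \<open>nv G\<close>] by (simp add: One_fract_def eq_fract)
    ultimately show ?thesis using ideal.one_imp_carrier[OF id(2)] by simp
  qed
  define J0 where "J0 = ideal_of (\<lambda>H. vanishes_on H W)"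
  have id0: "ideal J0 R"
    unfolding J0_def by (rule ideal_ideal_of) (auto intro: vanishes_on_add vanishes_on_mult)
  have mem0: "mem_form J0 H \<longleftrightarrow> vanishes_on H W" if "bh E H" for E H
    unfolding J0_def
    by (rule mem_form_ideal_of[OF _ _ that]) (use subvariety_prime[OF subvar] vanishes_on_mult in blast)+
  show ?thesis
  proof (rule vanishing_order_eqI[OF F(1), where J = "\<lambda>i. if i = 0 then J0 else carrier R"])
    fix m I assume I: "\<And>i. i \<le> m \<Longrightarrow> admissible V F (I i)" "\<And>i. i < m \<Longrightarrow> I i \<subset> I (Suc i)"
    show "m \<le> 1"
    proof (rule ccontr)
      assume m: "\<not> m \<le> 1"
      have "I 1 = carrier R" using full[of "I 0" "I 1"] I(1)[of 0] I(1)[of 1] I(2)[of 0] m by simp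
      moreover have "I 1 \<subset> I 2" using I(2)[of 1] m by (simp add: numeral_2_eq_2)
      moreover have "ideal (I 2) R" using I(1)[of 2] m by (simp add: admissible_def)
      then have "I 2 \<subseteq> carrier R" using additive_subgroup.a_subset[OF ideal.axioms(1)] by blast
      ultimately show False by blast
    qed
  next
    fix i :: nat assume "i \<le> 1"
    have "admissible V F J0"
      unfolding admissible_def using id0 mem0 F W vanishes_on_mono by blast
    moreover have "(\<Union>G\<in>{G. vanishes_on G V}. germs W G) \<subseteq> carrier R" using germs_in_carrier by blast
    then have "admissible V F (carrier R)"
      using germs_in_carrier[of F] ring.oneideal[OF ring_R] by (simp add: admissible_iff[OF F(1)])
    ultimately show "admissible V F (if i = 0 then J0 else carrier R)" by simp
  next
    fix i :: nat assume i: "i < 1"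
    have "J0 \<subseteq> carrier R" using additive_subgroup.a_subset[OF ideal.axioms(1)[OF id0]] .
    moreover have "1 \<notin> J0"
    proof
      assume "1 \<in> J0"
      then have "mem_form J0 1" using mem_form_iff[OF id0 is_frac_1] by (simp add: One_fract_def)
      then show False using mem0[OF bh_1] nv_1 by blast
    qed
    ultimately have "J0 \<subset> carrier R" using zero_one_carrier by blast
    then show "(if i = 0 then J0 else carrier R) \<subset> (if Suc i = 0 then J0 else carrier R)" using i by simp
  qed
qed

end

lemma lin_eq_iff:
  assumes "lin p q = (lin p' q' :: 'k::field bipoint set)"
  shows "{p, q} = {p', q'}"
  using lin_subset_iff[of p q p' q', where 'k='k] lin_subset_iff[of p' q' p q, where 'k='k] assms by auto

locale coprime_binomial = binomial +
  assumes coprime: "\<And>p q. p \<in> keys P \<Longrightarrow> q \<in> keys Q \<Longrightarrow> coprime (lookup P p) (lookup Q q)"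
begin

lemma boundary: "p \<in> keys P \<Longrightarrow> q \<in> keys Q \<Longrightarrow> boundary P Q P' r p q"
  using coprime by unfold_locales

lemma V_boundary:
  assumes z: "z \<in> V" and s: "s \<in> keys P \<union> keys Q" "coords z s = 0"
  shows "\<exists>p\<in>keys P. \<exists>q\<in>keys Q. z \<in> lin p q"
proof -
  have "mon_val (coords z) P = 0" "mon_val (coords z) Q = 0"
    using mon_P_eq_Q[OF z] s mon_val_eq_0[of "coords z" P] mon_val_eq_0[of "coords z" Q] by auto
  moreover have "valid (coords z)" using subvariety_valid[OF subvariety_V z] .
  ultimately show ?thesis by (auto simp: mon_val_eq_0 mem_lin)
qed

lemma lin_inj: "inj_on (\<lambda>(p, q). lin p q :: 'a bipoint set) (keys P \<times> keys Q)"
proof (rule inj_onI, clarify)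
  fix p q p' q' assume *: "p \<in> keys P" "q \<in> keys Q" "p' \<in> keys P" "q' \<in> keys Q"
    "lin p q = (lin p' q' :: 'a bipoint set)"
  have "{p, q} = {p', q'}" using lin_eq_iff[OF *(5)] .
  then show "p = p' \<and> q = q'" using * disj by (auto simp: doubleton_eq_iff)
qed

lemma mon_vanishes:
  assumes W: "subvariety W" "W \<subseteq> V" and g: "keys g \<subseteq> keys P \<union> keys Q" "vanishes_on (mon g) W"
  shows "\<exists>p\<in>keys P. \<exists>q\<in>keys Q. W \<subseteq> lin p q"
proof -
  obtain s where s: "s \<in> keys g" "vanishes_on (Var s) W" using prime_mon[OF W(1) g(2)] by blast
  have "W \<subseteq> \<Union>((\<lambda>(p, q). lin p q) ` (keys P \<times> keys Q))"
  proof
    fix z assume z: "z \<in> W"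
    then have "coords z s = 0" using s(2) by (auto simp: vanishes_on_iff)
    then show "z \<in> \<Union>((\<lambda>(p, q). lin p q) ` (keys P \<times> keys Q))"
      using V_boundary[of z s] z W(2) s(1) g(1) by auto
  qed
  moreover have "zariski_closed Z" if "Z \<in> (\<lambda>(p, q). lin p q) ` (keys P \<times> keys Q)" for Z :: "'a bipoint set"
    using that subvariety_closed[OF subvariety_lin] by auto
  ultimately have "\<exists>Z\<in>(\<lambda>(p, q). lin p q) ` (keys P \<times> keys Q). W \<subseteq> Z"
    by (intro subvariety_Union[OF W(1)]) simp_all
  then show ?thesis by auto
qed

lemma prime_divisor_in_lin:
  assumes W: "prime_divisor V W" and mem: "p \<in> keys P" "q \<in> keys Q" "W \<subseteq> lin p q"
  shows "W \<in> (\<lambda>(p, q). lin p q) ` (keys P \<times> keys Q)"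
proof -
  interpret boundary ty P Q P' r p q by (rule boundary[OF mem(1,2)])
  have "\<And>Z. subvariety Z \<Longrightarrow> W \<subseteq> Z \<Longrightarrow> Z \<subseteq> V \<Longrightarrow> Z = W \<or> Z = V"
    using W by (simp add: prime_divisor_def)
  from this[OF subvariety_lin mem(3) lin_V] have "lin p q = W" using lin_psubset by blast
  then show ?thesis using mem by (intro image_eqI[of _ _ "(p, q)"]) simp_all
qed

lemma prime_divisor_mon_vanishes:
  assumes W: "prime_divisor V W" and g: "keys g \<subseteq> keys P \<union> keys Q" "vanishes_on (mon g) W"
  shows "W \<in> (\<lambda>(p, q). lin p q) ` (keys P \<times> keys Q)"
proof -
  have "subvariety W" "W \<subseteq> V" using W by (simp_all add: prime_divisor_def psubset_imp_subset)
  from mon_vanishes[OF this g] obtain p q where "p \<in> keys P" "q \<in> keys Q" "W \<subseteq> lin p q" by auto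
  then show ?thesis by (rule prime_divisor_in_lin[OF W])
qed

theorem principal_divisor_mon:
  assumes "keys f \<subseteq> keys P \<union> keys Q" "keys g \<subseteq> keys P \<union> keys Q" "bideg f = bideg g"
  shows "principal_divisor V (mon f) (mon g) =
    (\<Sum>(p, q)\<in>keys P \<times> keys Q. single (lin p q) (int (weight (pq_weight P Q p q) f) - int (weight (pq_weight P Q p q) g)))"
proof -
  have "principal_divisor V (mon f) (mon g) = (\<Sum>i\<in>keys P \<times> keys Q. single ((\<lambda>(p, q). lin p q) i)
      ((\<lambda>(p, q). int (weight (pq_weight P Q p q) f) - int (weight (pq_weight P Q p q) g)) i))"
  proof (rule principal_divisor_eqI[where D = "bideg f"])
    show "bh (bideg f) (mon f :: 'a bipoly)" by (rule bh_single)
    show "bh (bideg f) (mon g :: 'a bipoly)" using bh_single[of g "1::'a"] assms(3) by simp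
    show "inj_on (\<lambda>(p, q). lin p q :: 'a bipoint set) (keys P \<times> keys Q)" by (rule lin_inj)
  next
    fix i assume "i \<in> keys P \<times> keys Q"
    then obtain p q where i: "i = (p, q)" "p \<in> keys P" "q \<in> keys Q" by blast
    interpret boundary ty P Q P' r p q by (rule boundary[OF i(2,3)])
    show "prime_divisor V ((\<lambda>(p, q). lin p q) i)" using prime_divisor_lin i by simp
    show "int (vanishing_order V ((\<lambda>(p, q). lin p q) i) (mon f :: 'a bipoly)) -
        int (vanishing_order V ((\<lambda>(p, q). lin p q) i) (mon g :: 'a bipoly)) =
      ((\<lambda>(p, q). int (weight (pq_weight P Q p q) f) - int (weight (pq_weight P Q p q) g)) i)"
      using vanishing_order_eq[OF bh_single exact_mon] by (simp add: i(1))
  next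
    fix W assume "prime_divisor V W" "W \<notin> (\<lambda>(p, q). lin p q) ` (keys P \<times> keys Q)"
    then show "\<not> vanishes_on (mon f) W \<and> \<not> vanishes_on (mon g) W"
      using prime_divisor_mon_vanishes assms by blast
  qed simp
  then show ?thesis by (simp add: case_prod_unfold)
qed

lemma mon_not_vanishes_V: "\<not> vanishes_on (mon g) V"
  using vanishes_on_V[OF bh_single] vanish_mon by blast

lemma mon_rationally_trivial:
  assumes "keys f \<subseteq> keys P \<union> keys Q" "keys g \<subseteq> keys P \<union> keys Q" "bideg f = bideg g"
  shows "(\<Sum>(p, q)\<in>keys P \<times> keys Q. single (lin p q :: 'a bipoint set)
    (int (weight (pq_weight P Q p q) f) - int (weight (pq_weight P Q p q) g))) \<in> rationally_trivial"
proof -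
  have "bihomogeneous (bideg f $ 1) (bideg f $ 2) (mon f :: 'a bipoly)"
    "bihomogeneous (bideg f $ 1) (bideg f $ 2) (mon g :: 'a bipoly)"
    using bh_single[of f "1::'a"] bh_single[of g "1::'a"] assms(3) by (simp_all add: bh_def)
  from rationally_trivial.principal[OF subvariety_V this mon_not_vanishes_V mon_not_vanishes_V]
  show ?thesis unfolding principal_divisor_mon[OF assms] .
qed

end

text \<open>The surface cut out on \<open>P = Q\<close> by a further binomial \<open>\<omega> \<sqdot> C = Y\<close>, where the variable \<open>\<omega>\<close>
  does not occur elsewhere. It is the graph of \<open>\<omega> = Y / C\<close> over the remaining coordinates. Where \<open>C\<close>
  vanishes this description breaks down; \<open>cover\<close> confines these points to the linear subspaces.\<close>

locale binomial_section = coprime_binomial +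
  fixes C Y X and \<omega>
  assumes X: "X = single \<omega> 1 + C" and degX: "bideg X = bideg Y"
    and r\<omega>: "r \<noteq> \<omega>" "lookup P \<omega> = 0" "lookup Q \<omega> = 0" "lookup C \<omega> = 0" "lookup Y \<omega> = 0"
      "lookup C r = 0" "lookup Y r = 0"
    and cover: "keys C \<subseteq> keys P \<union> keys Q \<or> keys Y \<subseteq> keys P \<union> keys Q"
begin

definition "graph = {x\<in>T. mon_val x X = mon_val x Y}"
definition "\<Gamma> = closed_hull graph"
abbreviation F :: "'a bipoly" where "F \<equiv> mon X - mon Y"

lemma bh_F: "bh (bideg X) F"
  by (rule bh_diff) (use bh_single[of X "1::'a"] bh_single[of Y "1::'a"] degX in simp_all)

lemma graph_T: "graph \<subseteq> T" by (auto simp: graph_def)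

lemma mon_val_upd: "lookup m v = 0 \<Longrightarrow> mon_val (x(v := c)) m = mon_val x m"
  by (rule mon_val_cong) (auto simp: in_keys_iff)

lemma mon_val_X: "mon_val x X = x \<omega> * mon_val x C"
  by (simp add: X mon_val_add mon_val_single)

lemma mon_val_P: "mon_val x P = x r * mon_val x P'"
  by (subst P_r) (simp add: mon_val_add mon_val_single)

lemma P'_\<omega>: "lookup P' \<omega> = 0"
  using r\<omega>(2) by (simp add: P_r lookup_add)

lemma irreducible_graph: "irreducible_set graph"
proof (rule irreducible_image[where \<tau> = "\<lambda>x. x(r := mon_val x Q / mon_val x P', \<omega> := mon_val x Y / mon_val x C)"])
  let ?\<tau> = "\<lambda>x. x(r := mon_val x Q / mon_val x P', \<omega> := mon_val x Y / mon_val x C)"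
  fix v
  show "\<exists>N D :: 'a bipoly. \<forall>x\<in>torus. mpoly_eval x D \<noteq> 0 \<and> ?\<tau> x v * mpoly_eval x D = mpoly_eval x N"
  proof -
    consider "v = \<omega>" | "v = r" "v \<noteq> \<omega>" | "v \<noteq> r" "v \<noteq> \<omega>" by blast
    then show ?thesis
    proof cases
      case 1
      then show ?thesis by (intro exI[of _ "mon Y"] exI[of _ "mon C"]) (simp add: mpoly_eval_single mon_val_nz)
    next
      case 2
      then show ?thesis by (intro exI[of _ "mon Q"] exI[of _ "mon P'"]) (simp add: mpoly_eval_single mon_val_nz)
    next
      case 3
      then show ?thesis by (intro exI[of _ "Var v"] exI[of _ 1]) simp
    qed
  qed
  show "graph = ?\<tau> ` torus"
  proof (intro equalityI subsetI)
    fix x assume x: "x \<in> graph"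
    then have xt: "x \<in> torus" using graph_T T_torus by blast
    have "mon_val x P = mon_val x Q" "mon_val x X = mon_val x Y"
      using x by (simp_all add: graph_def bin_torus_def)
    then have eq: "x r * mon_val x P' = mon_val x Q" "x \<omega> * mon_val x C = mon_val x Y"
      unfolding mon_val_P mon_val_X .
    have "x r = mon_val x Q / mon_val x P'" by (rule eq_divide_imp[OF mon_val_nz[OF xt] eq(1)])
    moreover have "x \<omega> = mon_val x Y / mon_val x C" by (rule eq_divide_imp[OF mon_val_nz[OF xt] eq(2)])
    ultimately have "?\<tau> x v = x v" for v by (cases "v = \<omega>"; cases "v = r") simp_all
    then have "x = ?\<tau> x" by (intro ext) (rule sym)
    then show "x \<in> ?\<tau> ` torus" by (rule image_eqI[OF _ xt])
  next
    fix y :: "3 + 3 \<Rightarrow> 'a" assume "y \<in> ?\<tau> ` torus"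
    then obtain x where x: "x \<in> torus" "y = ?\<tau> x" by blast
    have nz: "mon_val x m \<noteq> 0" for m using mon_val_nz[OF x(1)] .
    have "y v \<noteq> 0" for v unfolding x(2) using x(1) nz by (simp add: torus_def)
    then have "y \<in> torus" by (simp add: torus_def)
    moreover have "mon_val y P = mon_val y Q"
    proof -
      have "mon_val y P' = mon_val x P'" "mon_val y Q = mon_val x Q" "y r = mon_val x Q / mon_val x P'"
        unfolding x(2) using r\<omega>(1,3) P'_\<omega> P'_r Q_r by (simp_all add: mon_val_upd)
      then show ?thesis unfolding mon_val_P using nz by simp
    qed
    moreover have "mon_val y X = mon_val y Y"
    proof -
      have "mon_val y C = mon_val x C" "mon_val y Y = mon_val x Y" "y \<omega> = mon_val x Y / mon_val x C"
        unfolding x(2) using r\<omega>(4-7) by (simp_all add: mon_val_upd)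
      then show ?thesis unfolding mon_val_X using nz by simp
    qed
    ultimately show "y \<in> graph" by (simp add: graph_def bin_torus_def)
  qed
qed (use graph_T T_valid in blast)

lemma subvariety_\<Gamma>: "subvariety \<Gamma>"
  unfolding \<Gamma>_def by (rule subvariety_closed_hull[OF irreducible_graph])

lemma vanishes_on_\<Gamma>: "bh D H \<Longrightarrow> vanishes_on H \<Gamma> \<longleftrightarrow> vanish graph H"
  unfolding \<Gamma>_def by (rule vanishes_on_closed_hull) (use graph_T T_valid in blast)

lemma \<Gamma>_V: "\<Gamma> \<subseteq> V"
proof (rule zariski_closed_subsetI[OF subvariety_closed[OF subvariety_V] subvariety_valid[OF subvariety_\<Gamma>]])
  fix H D assume "bh D H" "vanishes_on H V"
  then show "vanishes_on H \<Gamma>"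
    using vanishes_on_V vanishes_on_\<Gamma> graph_T unfolding vanish_def by blast
qed

lemma not_vanish_graph_mon: "\<not> vanish graph (mon m)"
proof -
  obtain x where "x \<in> graph" using irreducible_graph by (auto simp: irreducible_set_def)
  then have "x \<in> graph" "x \<in> torus" using graph_T T_torus by auto
  then show ?thesis using mon_val_nz by (force simp: vanish_def mpoly_eval_single)
qed

lemma F_vanishes: "vanishes_on F \<Gamma>"
  unfolding vanishes_on_\<Gamma>[OF bh_F] by (simp add: vanish_def graph_def mpoly_eval_simps)

text \<open>Pseudo-division by \<open>\<omega> \<sqdot> C - Y\<close> in the variable \<open>\<omega>\<close>. The remainder does not contain \<open>\<omega>\<close> and
  vanishes on the graph of \<open>Y / C\<close>, so it vanishes on all of \<open>T\<close>. Hence \<open>F\<close> generates the ideal of the surface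
  up to powers of \<open>C\<close>, and the quotient has a smaller degree in \<open>\<omega>\<close>.\<close>

lemma pseudo_division:
  assumes H: "bh D H" "vanish graph H" and N: "\<And>m. m \<in> keys H \<Longrightarrow> lookup m \<omega> \<le> N"
  shows "\<exists>H1 D1 E. bh D1 H1 \<and> bh E (mon (rep N C) * H) \<and> bh E (F * H1) \<and>
    vanish T (mon (rep N C) * H - F * H1) \<and> (\<forall>m\<in>keys H1. lookup m \<omega> < N)"
proof -
  define m0 where "m0 m = m - single \<omega> (lookup m \<omega>)" for m :: "3 + 3 \<Rightarrow>\<^sub>0 nat"
  have m0: "m = single \<omega> (lookup m \<omega>) + m0 m" "lookup (m0 m) \<omega> = 0" for m
    by (auto simp: m0_def lookup_minus lookup_add lookup_single when_def intro!: poly_mapping_eqI)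
  define t where "t m i = m0 m + rep (N - lookup m \<omega>) C + (rep (lookup m \<omega> - Suc i) X + rep i Y)" for m i
  define H1 where "H1 = (\<Sum>m\<in>keys H. \<Sum>i<lookup m \<omega>. single (t m i) (lookup H m))"
  have keysH1: "\<exists>m\<in>keys H. \<exists>i<lookup m \<omega>. l = t m i" if l: "l \<in> keys H1" for l
  proof -
    obtain m where m: "m \<in> keys H" "l \<in> keys (\<Sum>i<lookup m \<omega>. single (t m i) (lookup H m))"
      using l keys_sum[of "\<lambda>m. \<Sum>i<lookup m \<omega>. single (t m i) (lookup H m)" "keys H"] unfolding H1_def by blast
    then obtain i where "i < lookup m \<omega>" "l \<in> keys (single (t m i) (lookup H m))"
      using keys_sum[of "\<lambda>i. single (t m i) (lookup H m)" "{..<lookup m \<omega>}"] by blast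
    then show ?thesis using m by (auto split: if_splits)
  qed
  have X\<omega>: "lookup X \<omega> = 1" using r\<omega> by (simp add: X lookup_add)
  have deg: "bideg X + bideg (t m i) = D + bideg (rep N C)" if m: "m \<in> keys H" and i: "i < lookup m \<omega>" for m i
  proof -
    have "bideg (t m i) = bideg (m0 m + rep (N - lookup m \<omega>) C + (rep (lookup m \<omega> - Suc i) X + rep i X))"
      using bideg_rep[OF degX, of i] by (simp add: t_def bideg_add)
    then have "bideg X + bideg (t m i) =
        bideg (X + (m0 m + rep (N - lookup m \<omega>) C + (rep (lookup m \<omega> - Suc i) X + rep i X)))"
      by (simp add: bideg_add)
    also have "X + (m0 m + rep (N - lookup m \<omega>) C + (rep (lookup m \<omega> - Suc i) X + rep i X)) = m + rep N C"
    proof (rule poly_mapping_eqI)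
      fix v
      obtain l where l: "N = lookup m \<omega> + l" using N[OF m] le_Suc_ex by blast
      obtain k where k: "lookup m \<omega> = Suc (i + k)" using i less_iff_Suc_add by blast
      have "lookup m v = lookup (single \<omega> (lookup m \<omega>)) v + lookup (m0 m) v"
        using m0(1)[of m] by (metis lookup_add)
      then show "lookup (X + (m0 m + rep (N - lookup m \<omega>) C + (rep (lookup m \<omega> - Suc i) X + rep i X))) v =
          lookup (m + rep N C) v"
        using k l by (simp add: lookup_add X lookup_single when_def algebra_simps)
    qed
    finally show ?thesis using H(1) m by (simp add: bideg_add bh_iff)
  qed
  have bh1: "\<exists>D1. bh D1 H1 \<and> bh (bideg (rep N C) + D) (F * H1)"
  proof (cases "H1 = 0")
    case False
    then obtain l where "l \<in> keys H1" by (metis all_not_in_conv keys_eq_empty)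
    then obtain m i where mi: "m \<in> keys H" "i < lookup m \<omega>" using keysH1 by blast
    have "bideg l' = bideg (t m i)" if l': "l' \<in> keys H1" for l'
    proof -
      obtain m' i' where mi': "m' \<in> keys H" "i' < lookup m' \<omega>" "l' = t m' i'" using keysH1[OF l'] by blast
      have "bideg X + bideg l' = bideg X + bideg (t m i)" using deg[OF mi] deg[OF mi'(1,2)] mi'(3) by simp
      then show ?thesis by simp
    qed
    then have "bh (bideg (t m i)) H1" by (simp add: bh_iff)
    moreover have "bideg X + bideg (t m i) = bideg (rep N C) + D" using deg[OF mi] by (simp add: add.commute)
    ultimately show ?thesis using bh_mult[OF bh_F] by metis
  qed simp
  have "vanish T (mon (rep N C) * H - F * H1)"
    unfolding vanish_def
  proof
    fix x assume x: "x \<in> T"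
    then have xt: "x \<in> torus" using T_torus by blast
    let ?A = "mon_val x X" and ?B = "mon_val x Y" and ?c = "mon_val x C"
    define y where "y = x(\<omega> := ?B / ?c)"
    have nz: "?c \<noteq> 0" "?B \<noteq> 0" using mon_val_nz[OF xt] by auto
    have yt: "y \<in> torus" using xt nz by (auto simp: y_def torus_def)
    have "mon_val y P = mon_val x P" "mon_val y Q = mon_val x Q" "mon_val y C = ?c" "mon_val y Y = ?B"
      using r\<omega> by (simp_all add: y_def mon_val_upd)
    then have "y \<in> graph" using x yt nz by (simp add: graph_def bin_torus_def mon_val_X) (simp add: y_def)
    then have "mpoly_eval y H = 0" using H(2) by (simp add: vanish_def)
    then have "(\<Sum>m\<in>keys H. ?c ^ N * (lookup H m * mon_val y m)) = 0"
      by (simp add: mpoly_eval_alt flip: sum_distrib_left)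
    also have "(\<Sum>m\<in>keys H. ?c ^ N * (lookup H m * mon_val y m)) =
        (\<Sum>m\<in>keys H. lookup H m * mon_val x (m0 m) * ?c ^ (N - lookup m \<omega>) * ?B ^ lookup m \<omega>)"
    proof (rule sum.cong[OF refl])
      fix m assume m: "m \<in> keys H"
      have "mon_val y m = (?B / ?c) ^ lookup m \<omega> * mon_val x (m0 m)"
        by (subst m0(1)) (simp add: mon_val_add mon_val_single y_def mon_val_upd m0(2))
      moreover have "?c ^ N = ?c ^ (N - lookup m \<omega>) * ?c ^ lookup m \<omega>"
        using N[OF m] by (simp flip: power_add)
      ultimately show "?c ^ N * (lookup H m * mon_val y m) =
          lookup H m * mon_val x (m0 m) * ?c ^ (N - lookup m \<omega>) * ?B ^ lookup m \<omega>"
        using nz by (simp add: power_divide)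
    qed
    finally have rem: "(\<Sum>m\<in>keys H. lookup H m * mon_val x (m0 m) * ?c ^ (N - lookup m \<omega>) * ?B ^ lookup m \<omega>) = 0" .
    have "mpoly_eval x (mon (rep N C) * H) = (\<Sum>m\<in>keys H. lookup H m * mon_val x (m0 m) * ?c ^ (N - lookup m \<omega>) * ?A ^ lookup m \<omega>)"
    proof -
      have "mpoly_eval x (mon (rep N C) * H) = (\<Sum>m\<in>keys H. ?c ^ N * (lookup H m * mon_val x m))"
        by (simp add: mpoly_eval_simps mon_val_rep mpoly_eval_alt[of x H] sum_distrib_left)
      also have "\<dots> = (\<Sum>m\<in>keys H. lookup H m * mon_val x (m0 m) * ?c ^ (N - lookup m \<omega>) * ?A ^ lookup m \<omega>)"
      proof (rule sum.cong[OF refl])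
        fix m assume m: "m \<in> keys H"
        have "mon_val x m = x \<omega> ^ lookup m \<omega> * mon_val x (m0 m)"
          by (subst m0(1)) (simp add: mon_val_add mon_val_single)
        moreover have "?c ^ N = ?c ^ (N - lookup m \<omega>) * ?c ^ lookup m \<omega>"
          using N[OF m] by (simp flip: power_add)
        ultimately show "?c ^ N * (lookup H m * mon_val x m) =
            lookup H m * mon_val x (m0 m) * ?c ^ (N - lookup m \<omega>) * ?A ^ lookup m \<omega>"
          by (simp add: mon_val_X power_mult_distrib)
      qed
      finally show ?thesis .
    qed
    moreover have "mpoly_eval x (F * H1) = (\<Sum>m\<in>keys H. lookup H m * mon_val x (m0 m) * ?c ^ (N - lookup m \<omega>) * (?A ^ lookup m \<omega> - ?B ^ lookup m \<omega>))"
    proof -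
      have "mpoly_eval x (F * H1) = (\<Sum>m\<in>keys H. lookup H m * mon_val x (m0 m) * ?c ^ (N - lookup m \<omega>) *
          ((?A - ?B) * (\<Sum>i<lookup m \<omega>. ?A ^ (lookup m \<omega> - Suc i) * ?B ^ i)))"
        by (simp add: H1_def t_def mpoly_eval_simps mon_val_add mon_val_rep sum_distrib_left sum_distrib_right mult_ac)
      also have "\<dots> = (\<Sum>m\<in>keys H. lookup H m * mon_val x (m0 m) * ?c ^ (N - lookup m \<omega>) * (?A ^ lookup m \<omega> - ?B ^ lookup m \<omega>))"
      proof (rule sum.cong[OF refl])
        fix m
        have "?A ^ n - ?B ^ n = (?A - ?B) * (\<Sum>i<n. ?A ^ (n - Suc i) * ?B ^ i)" for n
          using power_diff_sumr2[of ?B n ?A] by (simp add: algebra_simps)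
        then show "lookup H m * mon_val x (m0 m) * ?c ^ (N - lookup m \<omega>) *
          ((?A - ?B) * (\<Sum>i<lookup m \<omega>. ?A ^ (lookup m \<omega> - Suc i) * ?B ^ i)) =
          lookup H m * mon_val x (m0 m) * ?c ^ (N - lookup m \<omega>) * (?A ^ lookup m \<omega> - ?B ^ lookup m \<omega>)" by simp
      qed
      finally show ?thesis .
    qed
    ultimately show "mpoly_eval x (mon (rep N C) * H - F * H1) = 0"
      using rem by (simp add: mpoly_eval_diff right_diff_distrib sum_subtractf)
  qed
  moreover have "lookup l \<omega> < N" if l: "l \<in> keys H1" for l
  proof -
    obtain m i where mi: "m \<in> keys H" "i < lookup m \<omega>" "l = t m i" using keysH1[OF l] by blast
    have "lookup (t m i) \<omega> = lookup m \<omega> - Suc i"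
      using r\<omega> X\<omega> by (simp add: t_def lookup_add m0(2))
    then show ?thesis using mi N[OF mi(1)] by simp
  qed
  ultimately show ?thesis using bh1 bh_mult[OF bh_single[of "rep N C" 1] H(1)] by blast
qed

lemma \<omega>_bound:
  fixes H :: "'a bipoly"
  shows "\<exists>N. \<forall>m\<in>keys H. lookup m \<omega> \<le> N"
  by (rule exI[of _ "Max ((\<lambda>m. lookup m \<omega>) ` keys H)"]) simp

text \<open>Where \<open>C\<close> does not vanish, pseudo-division shows that each form of the ideal of the surface vanishes
  together with \<open>F\<close>.\<close>

lemma zero_of_F:
  assumes z: "z \<in> V" "mpoly_eval (coords z) F = 0"
  shows "z \<in> \<Gamma> \<or> (\<exists>p\<in>keys P. \<exists>q\<in>keys Q. z \<in> lin p q)"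
proof (cases "mon_val (coords z) C = 0")
  case True
  then have "mon_val (coords z) Y = 0" using z(2) by (simp add: mpoly_eval_simps mon_val_X)
  then obtain s where "s \<in> keys P \<union> keys Q" "coords z s = 0"
    using True cover by (auto simp: mon_val_eq_0)
  then show ?thesis using V_boundary[OF z(1)] by blast
next
  case False
  have "z \<in> \<Gamma>"
    unfolding \<Gamma>_def mem_closed_hull
  proof (intro conjI allI impI)
    show "valid (coords z)" using subvariety_valid[OF subvariety_V z(1)] .
    fix H D assume H: "bh D H" "vanish graph H"
    obtain N where N: "\<forall>m\<in>keys H. lookup m \<omega> \<le> N" using \<omega>_bound by blast
    obtain H1 E where H1: "bh E (mon (rep N C) * H)" "bh E (F * H1)" "vanish T (mon (rep N C) * H - F * H1)"
      using pseudo_division[OF H] N by blast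
    have "vanishes_on (mon (rep N C) * H - F * H1) V"
      using vanishes_on_V[OF bh_diff[OF H1(1,2)]] H1(3) by blast
    then have "mpoly_eval (coords z) (mon (rep N C) * H - F * H1) = 0" using z(1) by (simp add: vanishes_on_iff)
    moreover have "mpoly_eval (coords z) (F * H1) = 0" using z(2) by (simp add: mpoly_eval_mult)
    ultimately have "mon_val (coords z) C ^ N * mpoly_eval (coords z) H = 0"
      by (simp add: mpoly_eval_diff mpoly_eval_mult[of _ "mon (rep N C)"] mpoly_eval_single mon_val_rep)
    then show "mpoly_eval (coords z) H = 0" using False by simp
  qed
  then show ?thesis ..
qed

lemma \<Gamma>_not_in_lin: "\<not> \<Gamma> \<subseteq> lin p q"
proof
  assume "\<Gamma> \<subseteq> lin p q"
  then have "vanishes_on (Var p :: 'a bipoly) \<Gamma>" by (auto simp: vanishes_on_iff mem_lin)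
  then show False
    using vanishes_on_\<Gamma>[OF bh_Var] not_vanish_graph_mon[of "single p 1"] by (simp add: Var_def)
qed

lemma F_vanishes_cases:
  assumes Z: "subvariety Z" "Z \<subseteq> V" "vanishes_on F Z"
  shows "Z \<subseteq> \<Gamma> \<or> (\<exists>p\<in>keys P. \<exists>q\<in>keys Q. Z \<subseteq> lin p q)"
proof -
  let ?A = "insert \<Gamma> ((\<lambda>(p, q). lin p q) ` (keys P \<times> keys Q))"
  have "Z \<subseteq> \<Union>?A"
  proof
    fix z assume z: "z \<in> Z"
    have "z \<in> V" "mpoly_eval (coords z) F = 0" using z Z by (auto simp: vanishes_on_iff)
    from zero_of_F[OF this] show "z \<in> \<Union>?A" by auto
  qed
  moreover have "zariski_closed W" if "W \<in> ?A" for W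
    using that subvariety_closed[OF subvariety_lin] subvariety_closed[OF subvariety_\<Gamma>] by auto
  ultimately have "\<exists>W\<in>?A. Z \<subseteq> W" by (intro subvariety_Union[OF Z(1)]) simp_all
  then show ?thesis by auto
qed

lemma F_not_vanishes_V: "\<not> vanishes_on F V"
proof
  assume "vanishes_on F V"
  then have F: "vanish T F" using vanishes_on_V[OF bh_F] by blast
  obtain x where x: "x \<in> T" using irreducible_T by (auto simp: irreducible_set_def)
  obtain c :: 'a where c: "c \<noteq> 0" "c \<noteq> x \<omega>"
    using ex_new_if_finite[OF infinite_alg_closed[where 'k='a], of "{0, x \<omega>}"] by auto
  define y where "y = x(\<omega> := c)"
  have y: "mon_val y P = mon_val x P" "mon_val y Q = mon_val x Q" "mon_val y C = mon_val x C"
      "mon_val y Y = mon_val x Y" "y \<omega> = c"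
    using r\<omega>(2-5) by (simp_all add: y_def mon_val_upd)
  have "y \<in> T" using x c(1) unfolding bin_torus_def by (simp add: y) (simp add: torus_def y_def)
  then have "mpoly_eval y F = 0" using F by (simp add: vanish_def)
  then have "c * mon_val x C = mon_val x Y" by (simp add: mpoly_eval_simps mon_val_X y)
  moreover have "mpoly_eval x F = 0" using F x by (simp add: vanish_def)
  then have "x \<omega> * mon_val x C = mon_val x Y" by (simp add: mpoly_eval_simps mon_val_X)
  moreover have "mon_val x C \<noteq> 0" using mon_val_nz x T_torus by blast
  ultimately show False using c(2) mult_right_cancel[of "mon_val x C" c "x \<omega>"] by simp
qed

lemma \<Gamma>_psubset: "\<Gamma> \<subset> V"
proof -
  have "\<Gamma> \<noteq> V" using F_vanishes F_not_vanishes_V by metis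
  then show ?thesis using \<Gamma>_V by (rule psubsetI[rotated])
qed

text \<open>If \<open>F\<close> does not vanish on \<open>Z\<close>, repeated pseudo-division of a form vanishing on \<open>Z\<close> lowers its degree in
  \<open>\<omega>\<close> until nothing is left.\<close>

lemma prime_divisor_\<Gamma>: "prime_divisor V \<Gamma>"
  unfolding prime_divisor_def
proof (intro conjI allI impI subvariety_\<Gamma> \<Gamma>_psubset)
  fix Z assume Z: "subvariety Z" "\<Gamma> \<subseteq> Z" "Z \<subseteq> V"
  show "Z = \<Gamma> \<or> Z = V"
  proof (cases "vanishes_on F Z")
    case True
    from F_vanishes_cases[OF Z(1,3) this] show ?thesis
    proof
      assume "\<exists>p\<in>keys P. \<exists>q\<in>keys Q. Z \<subseteq> lin p q"
      then obtain p q where "Z \<subseteq> lin p q" by blast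
      then have "\<Gamma> \<subseteq> lin p q" using Z(2) by (rule order_trans[rotated])
      then show ?thesis using \<Gamma>_not_in_lin by simp
    next
      assume "Z \<subseteq> \<Gamma>"
      then have "Z = \<Gamma>" using Z(2) by (rule equalityI)
      then show ?thesis ..
    qed
  next
    case False
    have van: "vanish T H" if "bh D H" "vanishes_on H Z" "\<And>m. m \<in> keys H \<Longrightarrow> lookup m \<omega> \<le> N" for N D H
      using that
    proof (induction N arbitrary: D H rule: less_induct)
      case (less N)
      have "vanish graph H" using vanishes_on_mono[OF less.prems(2) Z(2)] vanishes_on_\<Gamma>[OF less.prems(1)] by blast
      from pseudo_division[OF less.prems(1) this less.prems(3)] obtain H1 D1 E where H1: "bh D1 H1"
        "bh E (mon (rep N C) * H)" "bh E (F * H1)" "vanish T (mon (rep N C) * H - F * H1)"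
        "\<forall>m\<in>keys H1. lookup m \<omega> < N" by blast
      have "vanish T H1"
      proof (cases "N = 0")
        case True
        then have "keys H1 = {}" using H1(5) by auto
        then have "H1 = 0" by simp
        then show ?thesis by (simp add: vanish_def)
      next
        case N: False
        have *: "vanishes_on (mon (rep N C) * H - F * H1) V"
          using vanishes_on_V[OF bh_diff[OF H1(2,3)]] H1(4) by blast
        have "vanishes_on (mon (rep N C) * H - (mon (rep N C) * H - F * H1)) Z"
          by (rule vanishes_on_diff[OF vanishes_on_mult(2)[OF less.prems(2)] vanishes_on_mono[OF * Z(3)]])
        then have "vanishes_on (F * H1) Z" by simp
        then have "vanishes_on H1 Z" using subvariety_prime[OF Z(1) bh_F H1(1)] False by simp
        moreover have "N - 1 < N" using N by simp
        moreover have "lookup m \<omega> \<le> N - 1" if "m \<in> keys H1" for m using H1(5) that by fastforce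
        ultimately show ?thesis using less.IH[of "N - 1" D1 H1] H1(1) by blast
      qed
      then have "vanish T (mon (rep N C) * H)" using H1(4) by (simp add: vanish_def mpoly_eval_simps)
      then show "vanish T H" using vanish_prime[of "mon (rep N C)" H] vanish_mon by simp
    qed
    have "V \<subseteq> Z"
    proof (rule zariski_closed_subsetI[OF subvariety_closed[OF Z(1)] subvariety_valid[OF subvariety_V]])
      fix H D assume H: "bh D H" "vanishes_on H Z"
      obtain N where "\<forall>m\<in>keys H. lookup m \<omega> \<le> N" using \<omega>_bound by blast
      then have "vanish T H" using van[OF H] by blast
      then show "vanishes_on H V" using vanishes_on_V[OF H(1)] by simp
    qed
    then have "Z = V" using Z(3) by (rule equalityI[rotated])
    then show ?thesis ..
  qed
qed

lemma vanishing_order_\<Gamma>: "vanishing_order V \<Gamma> F = 1"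
proof -
  interpret G: local_germs \<Gamma> by unfold_locales (rule subvariety_\<Gamma>)
  show ?thesis
  proof (rule G.vanishing_order_eq_1[OF bh_F F_vanishes \<Gamma>_V])
    fix E H assume H: "bh E H" "vanishes_on H \<Gamma>"
    have vH: "vanish graph H" using H vanishes_on_\<Gamma> by blast
    obtain N where N: "\<forall>m\<in>keys H. lookup m \<omega> \<le> N" using \<omega>_bound by blast
    obtain H1 D1 E' where H1: "bh D1 H1" "bh E' (mon (rep N C) * H)" "bh E' (F * H1)"
      "vanish T (mon (rep N C) * H - F * H1)"
      using pseudo_division[OF H(1) vH] N by blast
    have "vanishes_on (mon (rep N C) * H - F * H1) V"
      using vanishes_on_V[OF bh_diff[OF H1(2,3)]] H1(4) by blast
    moreover have "\<not> vanishes_on (mon (rep N C)) \<Gamma>"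
      using not_vanish_graph_mon vanishes_on_\<Gamma>[OF bh_single] by blast
    ultimately show "\<exists>U X DU DX E'. bh DU U \<and> \<not> vanishes_on U \<Gamma> \<and> bh DX X \<and> bh E' (U * H) \<and>
        bh E' (F * X) \<and> vanishes_on (U * H - F * X) V"
      using H1 bh_single[of "rep N C" "1::'a"] by blast
  qed
qed

text \<open>The divisor of \<open>F / g\<close>: the surface appears once, and along the linear subspaces the order of \<open>F\<close> is the
  smaller one of the weights of its two monomials.\<close>

theorem section_rationally_trivial:
  assumes g: "keys g \<subseteq> keys P \<union> keys Q" "bideg g = bideg Y"
  shows "single \<Gamma> 1 + (\<Sum>(p, q)\<in>keys P \<times> keys Q. single (lin p q)
      (int (min (weight (pq_weight P Q p q) X) (weight (pq_weight P Q p q) Y)) - int (weight (pq_weight P Q p q) g)))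
    \<in> rationally_trivial"
proof -
  define n where "n p q = int (min (weight (pq_weight P Q p q) X) (weight (pq_weight P Q p q) Y))
    - int (weight (pq_weight P Q p q) g)" for p q
  let ?I = "insert None (Some ` (keys P \<times> keys Q))"
  let ?D = "\<lambda>i. case i of None \<Rightarrow> \<Gamma> | Some (p, q) \<Rightarrow> lin p q"
  let ?n = "\<lambda>i. case i of None \<Rightarrow> 1 | Some (p, q) \<Rightarrow> n p q"
  have bg: "bh (bideg X) (mon g :: 'a bipoly)" using bh_single[of g "1::'a"] degX g(2) by simp
  have not_\<Gamma>: "\<Gamma> \<noteq> lin p q" for p q using \<Gamma>_not_in_lin by blast
  have "principal_divisor V F (mon g) = (\<Sum>i\<in>?I. single (?D i) (?n i))"
  proof (rule principal_divisor_eqI[OF bh_F bg])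
    show "inj_on ?D ?I"
    proof (rule inj_onI)
      fix i j assume ij: "i \<in> ?I" "j \<in> ?I" "?D i = ?D j"
      show "i = j"
      proof (cases i)
        case None
        then show ?thesis using ij not_\<Gamma> by (cases j) auto
      next
        case (Some a)
        then obtain b where "j = Some b" using ij not_\<Gamma>[symmetric] by (cases j) auto
        then show ?thesis using Some ij lin_inj unfolding inj_on_def by auto
      qed
    qed
  next
    fix i assume "i \<in> ?I"
    then consider "i = None" | p q where "i = Some (p, q)" "p \<in> keys P" "q \<in> keys Q" by auto
    then have "prime_divisor V (?D i) \<and>
      int (vanishing_order V (?D i) F) - int (vanishing_order V (?D i) (mon g :: 'a bipoly)) = ?n i"
    proof cases
      case 1
      interpret G: local_germs \<Gamma> by unfold_locales (rule subvariety_\<Gamma>)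
      have "vanishing_order V \<Gamma> (mon g :: 'a bipoly) = 0"
        using G.vanishing_order_not_vanishing[OF bg] not_vanish_graph_mon vanishes_on_\<Gamma>[OF bg] by blast
      then show ?thesis using 1 prime_divisor_\<Gamma> vanishing_order_\<Gamma> by simp
    next
      case 2
      interpret boundary ty P Q P' r p q by (rule boundary[OF 2(2,3)])
      have "\<not> vanish T F" using F_not_vanishes_V vanishes_on_V[OF bh_F] by blast
      from vanishing_order_eq[OF bh_F exact_binomial[OF this]] vanishing_order_eq[OF bh_single[of g 1] exact_mon]
      show ?thesis using 2(1) prime_divisor_lin by (simp add: n_def)
    qed
    then show "prime_divisor V (?D i)"
      "int (vanishing_order V (?D i) F) - int (vanishing_order V (?D i) (mon g :: 'a bipoly)) = ?n i" by blast+
  next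
    fix W assume W: "prime_divisor V W" "W \<notin> ?D ` ?I"
    have notlin: "W \<notin> (\<lambda>(p, q). lin p q) ` (keys P \<times> keys Q)"
    proof
      assume "W \<in> (\<lambda>(p, q). lin p q) ` (keys P \<times> keys Q)"
      then obtain p q where "p \<in> keys P" "q \<in> keys Q" "W = lin p q" by auto
      then have "W = ?D (Some (p, q))" "Some (p, q) \<in> ?I" by auto
      then show False using W(2) by blast
    qed
    have W': "subvariety W" "W \<subseteq> V" "\<And>Z. subvariety Z \<Longrightarrow> W \<subseteq> Z \<Longrightarrow> Z \<subseteq> V \<Longrightarrow> Z = W \<or> Z = V"
      using W(1) by (auto simp: prime_divisor_def)
    have "\<not> vanishes_on F W"
    proof
      assume "vanishes_on F W"
      from F_vanishes_cases[OF W'(1,2) this] show False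
      proof
        assume "W \<subseteq> \<Gamma>"
        then have "\<Gamma> = W" using W'(3)[OF subvariety_\<Gamma> _ \<Gamma>_V] \<Gamma>_psubset by blast
        then have "W = ?D None" "None \<in> ?I" by simp_all
        then show False using W(2) by blast
      next
        assume "\<exists>p\<in>keys P. \<exists>q\<in>keys Q. W \<subseteq> lin p q"
        then show False using prime_divisor_in_lin[OF W(1)] notlin by blast
      qed
    qed
    moreover have "\<not> vanishes_on (mon g) W" using prime_divisor_mon_vanishes[OF W(1) g(1)] notlin by blast
    ultimately show "\<not> vanishes_on F W \<and> \<not> vanishes_on (mon g) W" ..
  qed simp
  also have "\<dots> = single \<Gamma> 1 + (\<Sum>(p, q)\<in>keys P \<times> keys Q. single (lin p q) (n p q))"
    by (subst sum.insert) (auto simp: sum.reindex intro!: sum.cong)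
  finally have eq: "principal_divisor V F (mon g) = single \<Gamma> 1 + (\<Sum>(p, q)\<in>keys P \<times> keys Q. single (lin p q) (n p q))" .
  have "principal_divisor V F (mon g) \<in> rationally_trivial"
    by (rule rationally_trivial.principal[OF subvariety_V _ _ F_not_vanishes_V mon_not_vanishes_V])
      (use bh_F bg in \<open>simp_all only: bh_def\<close>)
  then show ?thesis unfolding eq n_def .
qed

end

section \<open>Rational equivalences between linear subspaces\<close>

lemma rt_uminus: "\<alpha> \<in> rationally_trivial \<Longrightarrow> - \<alpha> \<in> rationally_trivial"
  using rationally_trivial.diff[OF rationally_trivial.zero] by fastforce

lemma rt_add: "\<alpha> \<in> rationally_trivial \<Longrightarrow> \<beta> \<in> rationally_trivial \<Longrightarrow> \<alpha> + \<beta> \<in> rationally_trivial"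
  using rationally_trivial.diff[OF _ rt_uminus] by fastforce

definition homologous :: "'k::field bipoint set \<Rightarrow> 'k bipoint set \<Rightarrow> bool" where
  "homologous A B \<longleftrightarrow> single A 1 - single B 1 \<in> rationally_trivial"

lemma homologous_refl: "homologous A A"
  by (simp add: homologous_def rationally_trivial.zero)

lemma homologous_trans: "homologous A B \<Longrightarrow> homologous B C \<Longrightarrow> homologous A C"
  unfolding homologous_def using rt_add by fastforce

lemma homologous_multiple: "homologous A B \<Longrightarrow> single A (int n) - single B (int n) \<in> rationally_trivial"
proof (induction n)
  case 0
  then show ?case by (simp add: rationally_trivial.zero)
next
  case (Suc n)
  have "single A (int (Suc n)) - single B (int (Suc n)) =
      (single A (int n) - single B (int n)) + (single A 1 - single B 1)"
    by (simp add: single_add algebra_simps)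
  then show ?case using rt_add Suc by (simp add: homologous_def)
qed

lemma bideg_Inl: "bideg (single (Inl i) n) = vector [n, 0]"
  and bideg_Inr: "bideg (single (Inr i) n) = vector [0, n]"
  by (simp_all add: bideg_def lookup_single when_def vec_eq_iff forall_2)

lemma vector_2_add: "(vector [a, b] :: nat^2) + vector [c, d] = vector [a + c, b + d]"
  by (simp add: vec_eq_iff forall_2)

lemmas bideg_simps = bideg_add bideg_Inl bideg_Inr vector_2_add

lemma keys_plus_nat: "keys (m + n :: 'v \<Rightarrow>\<^sub>0 nat) = keys m \<union> keys n"
  by (auto simp: in_keys_iff lookup_add)

text \<open>On the quadric \<open>x\<^sub>i y\<^sub>l = x\<^sub>k y\<^sub>j\<close> the divisor of \<open>x\<^sub>i / x\<^sub>k\<close> is the difference of the two subspaces.\<close>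

lemma homologous_mixed_aux:
  assumes "i \<noteq> k" "j \<noteq> l"
  shows "homologous (lin (Inl i) (Inr j)) (lin (Inl k) (Inr l) :: 'k::alg_closed_field bipoint set)"
proof -
  define P where "P = single (Inl i) 1 + single (Inr l :: 3 + 3) (1::nat)"
  define Q where "Q = single (Inl k) 1 + single (Inr j :: 3 + 3) (1::nat)"
  have kP: "keys P = {Inl i, Inr l}" and kQ: "keys Q = {Inl k, Inr j}"
    by (simp_all add: P_def Q_def keys_plus_nat insert_commute)
  have lP: "lookup P v = (if v = Inl i \<or> v = Inr l then 1 else 0)"
    and lQ: "lookup Q v = (if v = Inl k \<or> v = Inr j then 1 else 0)" for v
    by (auto simp: P_def Q_def lookup_add lookup_single when_def)
  interpret coprime_binomial "TYPE('k)" P Q "single (Inr l) 1" "Inl i"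
  proof unfold_locales
    show "keys P \<inter> keys Q = {}" using assms by (simp add: kP kQ)
    show "bideg P = bideg Q" by (simp add: P_def Q_def bideg_simps)
    show "P = single (Inl i) 1 + single (Inr l) 1" by (simp add: P_def)
    show "lookup (single (Inr l) 1) (Inl i) = 0" by (simp add: lookup_single)
    show "coprime (lookup P p) (lookup Q q)" if "p \<in> keys P" "q \<in> keys Q" for p q
      using that by (simp add: lP kP)
  qed
  have "(\<Sum>(p, q)\<in>keys P \<times> keys Q. single (lin p q :: 'k bipoint set)
    (int (weight (pq_weight P Q p q) (single (Inl i) 1)) - int (weight (pq_weight P Q p q) (single (Inl k) 1))))
    \<in> rationally_trivial"
    by (rule mon_rationally_trivial) (simp_all add: kP kQ bideg_simps)
  also have "(\<Sum>(p, q)\<in>keys P \<times> keys Q. single (lin p q :: 'k bipoint set)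
    (int (weight (pq_weight P Q p q) (single (Inl i) 1)) - int (weight (pq_weight P Q p q) (single (Inl k) 1))))
    = single (lin (Inl i) (Inr j)) 1 - single (lin (Inr l) (Inl k)) 1"
    using assms by (simp add: kP kQ flip: sum.cartesian_product) 
      (simp add: weight_single pq_weight_def lP lQ single_uminus)
  finally show ?thesis by (simp add: homologous_def lin_commute[of "Inr l"])
qed

lemma exists_third: "\<exists>m::3. m \<noteq> i \<and> m \<noteq> k"
proof -
  have "card {i, k} < card (UNIV :: 3 set)" by (simp add: card_insert_if)
  then have "{i, k} \<noteq> UNIV" by (intro notI) simp
  then show ?thesis by blast
qed

lemma homologous_mixed:
  "homologous (lin (Inl i) (Inr j)) (lin (Inl k) (Inr l) :: 'k::alg_closed_field bipoint set)"
proof -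
  obtain m n where "m \<noteq> i" "m \<noteq> k" "n \<noteq> j" "n \<noteq> l" using exists_third[of i k] exists_third[of j l] by blast
  then show ?thesis
    using homologous_trans[OF homologous_mixed_aux[of i m j n] homologous_mixed_aux[of m k n l]] by auto
qed

text \<open>On the quadric \<open>x\<^sub>j x\<^sub>k = x\<^sub>i\<^sup>2\<close> the divisor of \<open>x\<^sub>i / x\<^sub>k\<close> is the difference of the two subspaces.\<close>

lemma homologous_same_aux:
  fixes c :: "3 \<Rightarrow> 3 + 3"
  assumes c: "c = Inl \<or> c = Inr" and ij: "i \<noteq> j" "i \<noteq> k" "j \<noteq> k"
  shows "homologous (lin (c i) (c j)) (lin (c i) (c k) :: 'k::alg_closed_field bipoint set)"
proof -
  have ne: "c i \<noteq> c j" "c i \<noteq> c k" "c j \<noteq> c k" using c ij by auto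
  have deg: "bideg (single (c j) 1 + single (c k) 1) = bideg (single (c i) 2)"
    "bideg (single (c i) 1) = bideg (single (c k) 1)"
    using c by (auto simp: bideg_simps numeral_2_eq_2)
  define P where "P = single (c j) 1 + single (c k) (1::nat)"
  define Q where "Q = single (c i) (2::nat)"
  have kP: "keys P = {c j, c k}" and kQ: "keys Q = {c i}"
    by (simp_all add: P_def Q_def keys_plus_nat insert_commute)
  have lP: "lookup P v = (if v = c j \<or> v = c k then 1 else 0)"
    and lQ: "lookup Q v = (if v = c i then 2 else 0)" for v
    using ne by (auto simp: P_def Q_def lookup_add lookup_single when_def)
  interpret coprime_binomial "TYPE('k)" P Q "single (c k) 1" "c j"
  proof unfold_locales
    show "keys P \<inter> keys Q = {}" using ne by (simp add: kP kQ)
    show "bideg P = bideg Q" using deg by (simp add: P_def Q_def)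
    show "P = single (c j) 1 + single (c k) 1" by (simp add: P_def)
    show "lookup (single (c k) 1) (c j) = 0" using ne by (simp add: lookup_single)
    show "coprime (lookup P p) (lookup Q q)" if "p \<in> keys P" "q \<in> keys Q" for p q
      using that by (simp add: lP kP)
  qed
  have "(\<Sum>(p, q)\<in>keys P \<times> keys Q. single (lin p q :: 'k bipoint set)
    (int (weight (pq_weight P Q p q) (single (c i) 1)) - int (weight (pq_weight P Q p q) (single (c k) 1))))
    \<in> rationally_trivial"
    by (rule mon_rationally_trivial) (use deg in \<open>simp_all add: kP kQ\<close>)
  also have "(\<Sum>(p, q)\<in>keys P \<times> keys Q. single (lin p q :: 'k bipoint set)
    (int (weight (pq_weight P Q p q) (single (c i) 1)) - int (weight (pq_weight P Q p q) (single (c k) 1))))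
    = single (lin (c j) (c i)) 1 - single (lin (c k) (c i)) 1"
    using ne by (simp add: kP kQ flip: sum.cartesian_product)
      (simp add: weight_single pq_weight_def lP lQ single_uminus)
  finally show ?thesis by (simp add: homologous_def lin_commute[of "c i"])
qed

lemma homologous_same:
  fixes c :: "3 \<Rightarrow> 3 + 3"
  assumes c: "c = Inl \<or> c = Inr" and "i \<noteq> j" "k \<noteq> l"
  shows "homologous (lin (c i) (c j)) (lin (c k) (c l) :: 'k::alg_closed_field bipoint set)"
proof -
  have step: "homologous (lin (c i) (c j)) (lin (c i) (c k) :: 'k bipoint set)" if "i \<noteq> j" "i \<noteq> k" for i j k
    using homologous_same_aux[OF c, of i j k] homologous_refl that by (cases "j = k") auto
  have "i = k \<or> i = l \<or> j = k \<or> j = l"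
    using assms exhaust_3[of i] exhaust_3[of j] exhaust_3[of k] exhaust_3[of l] by metis
  then show ?thesis
    using step[of i j l] step[of i j k] step[of j i l] step[of j i k] assms
      lin_commute[of "c i" "c j", where 'a='k] lin_commute[of "c k" "c l", where 'a='k] by auto
qed

lemma hyperplanes:
  "hyperplane2 1 \<inter> hyperplane2 2 = lin (Inr 1) (Inr 2)"
  "hyperplane1 1 \<inter> hyperplane2 1 = lin (Inl 1) (Inr 1)"
  "hyperplane1 1 \<inter> hyperplane1 2 = lin (Inl 1) (Inl 2)"
  by (auto simp: hyperplane1_def hyperplane2_def lin_def mem_zero_locus)

section \<open>The closure of the graph\<close>

definition monomial_value :: "nat^3^3 \<Rightarrow> (3 + 3 \<Rightarrow> 'k::field) \<Rightarrow> 3 \<Rightarrow> 'k" where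
  "monomial_value M x j = (\<Prod>i\<in>UNIV. x (Inl i) ^ (M $ j $ i))"

text \<open>The graph is parametrized by \<open>(x, c) \<mapsto> (x, c \<sqdot> f x)\<close>. A form that vanishes on the image of the torus pulls
  back to zero and so vanishes on the whole image. The variable \<open>Inr 1\<close> plays the role of \<open>c\<close>.\<close>

lemma graph_closure_eq:
  fixes M :: "nat^3^3" and T :: "(3 + 3 \<Rightarrow> 'k::alg_closed_field) set"
  assumes T: "T = {x\<in>torus. \<exists>c. \<forall>j. x (Inr j) = c * monomial_value M x j}"
  shows "graph_closure (monomial_map M) = closed_hull T"
proof -
  define G :: "'k bipoint set" where
    "G = {(p, q). p \<noteq> 0 \<and> q \<noteq> 0 \<and> (\<exists>c. q = c *s (\<chi> i. mpoly_eval (\<lambda>j. p $ j) (monomial_map M $ i)))}"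
  have mem_G: "P \<in> G \<longleftrightarrow> valid (coords P) \<and> (\<exists>c. \<forall>j. coords P (Inr j) = c * monomial_value M (coords P) j)" for P
    by (cases P) (simp add: G_def valid_def vec_eq_iff coords_def monomial_value_def monomial_map_def
        mpoly_eval_prod mpoly_eval_power)
  have "zariski_closed hull G = closed_hull T"
  proof (rule hull_unique)
    show "zariski_closed (closed_hull T)" by (rule zariski_closed_closed_hull)
    show "G \<subseteq> closed_hull T"
    proof
      fix P assume P: "P \<in> G"
      then obtain c where c: "\<And>j. coords P (Inr j) = c * monomial_value M (coords P) j" by (auto simp: mem_G)
      have "mpoly_eval (coords P) F = 0" if F: "vanish T F" for F
      proof -
        define g :: "3 + 3 \<Rightarrow> 'k bipoly" where
          "g v = (case v of Inl i \<Rightarrow> Var (Inl i) | Inr j \<Rightarrow> Var (Inr 1) * (\<Prod>i\<in>UNIV. Var (Inl i) ^ (M $ j $ i)))" for v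
        have g: "mpoly_eval x (g v) = (case v of Inl i \<Rightarrow> x (Inl i) | Inr j \<Rightarrow> x (Inr 1) * monomial_value M x j)" for x v
          by (simp add: g_def monomial_value_def mpoly_eval_simps split: sum.split)
        have mm: "monomial_value M (\<lambda>v. mpoly_eval x (g v)) j = monomial_value M x j" for x j
          by (simp add: monomial_value_def g)
        have "mpoly_subst g F = 0"
        proof (rule vanish_torus, unfold vanish_def, rule)
          fix x :: "3 + 3 \<Rightarrow> 'k" assume x: "x \<in> torus"
          have "monomial_value M x j \<noteq> 0" for j using x by (simp add: monomial_value_def torus_def)
          then have "(\<lambda>v. mpoly_eval x (g v)) \<in> torus"
            using x by (auto simp: torus_def g split: sum.split)
          moreover have "mpoly_eval x (g (Inr j)) = x (Inr 1) * monomial_value M (\<lambda>v. mpoly_eval x (g v)) j" for j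
            unfolding mm by (simp add: g)
          ultimately have "(\<lambda>v. mpoly_eval x (g v)) \<in> T" unfolding T by blast
          then show "mpoly_eval x (mpoly_subst g F) = 0"
            using F by (simp add: mpoly_eval_subst vanish_def)
        qed
        define y where "y = (coords P)(Inr 1 := c)"
        have yl: "y (Inl i) = coords P (Inl i)" for i by (simp add: y_def)
        have "mpoly_eval y (g v) = coords P v" for v
          using c by (cases v) (simp_all add: g yl monomial_value_def, simp add: y_def)
        then have "mpoly_eval (coords P) F = mpoly_eval y (mpoly_subst g F)"
          by (simp add: mpoly_eval_subst)
        then show ?thesis using \<open>mpoly_subst g F = 0\<close> by simp
      qed
      then show "P \<in> closed_hull T" using P by (simp add: mem_closed_hull mem_G)
    qed
    fix Z assume Z: "G \<subseteq> Z" "zariski_closed Z"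
    show "closed_hull T \<subseteq> Z"
    proof (rule zariski_closed_subsetI[OF Z(2)])
      show "valid (coords P)" if "P \<in> closed_hull T" for P using that by (simp add: mem_closed_hull)
      fix F D assume F: "bh D F" "vanishes_on F Z"
      have "vanish T F"
        unfolding vanish_def
      proof
        fix x assume x: "x \<in> T"
        obtain P where P: "coords P = x" using coords_surj by blast
        have "valid x" using x torus_valid unfolding T by auto
        then have "P \<in> G" unfolding mem_G P using x unfolding T by blast
        then show "mpoly_eval x F = 0" using Z(1) F(2) P by (auto simp: vanishes_on_iff)
      qed
      then show "vanishes_on F (closed_hull T)" unfolding vanishes_on_iff by (metis F(1) mem_closed_hull)
    qed
  qed
  then show ?thesis by (simp add: graph_closure_def G_def)
qed

lemma UNIV_distinct3:
  fixes i1 :: 3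
  assumes "i1 \<noteq> i2" "i1 \<noteq> i3" "i2 \<noteq> i3"
  shows "UNIV = {i1, i2, i3}"
proof -
  have "card {i1, i2, i3} = card (UNIV :: 3 set)" using assms by simp
  then show ?thesis by (metis card_subset_eq finite subset_UNIV)
qed

lemma prod_distinct3:
  fixes i1 :: 3
  assumes "i1 \<noteq> i2" "i1 \<noteq> i3" "i2 \<noteq> i3"
  shows "(\<Prod>i\<in>UNIV. f i) = f i1 * f i2 * (f i3 :: 'a::comm_monoid_mult)"
  by (subst UNIV_distinct3[OF assms]) (use assms in \<open>simp add: mult.assoc\<close>)

lemma all_distinct3:
  fixes i1 :: 3
  assumes "i1 \<noteq> i2" "i1 \<noteq> i3" "i2 \<noteq> i3"
  shows "(\<forall>i. R i) \<longleftrightarrow> R i1 \<and> R i2 \<and> R i3"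
  using UNIV_distinct3[OF assms] by (metis UNIV_I empty_iff insert_iff)

section \<open>The multidegree of the two types of maps\<close>

lemma has_multidegreeI:
  fixes f :: "((3, 'k::alg_closed_field) mpoly)^3"
  assumes G: "single (graph_closure f) 1 - single A 1 - single B (int m) - single C (int n) - single D 1
      \<in> rationally_trivial"
    and A: "homologous A (lin (Inr 1) (Inr 2))" and B: "homologous B (lin (Inl 1) (Inr 1))"
    and C: "homologous C (lin (Inl 1) (Inr 1))" and D: "homologous D (lin (Inl 1) (Inl 2))"
  shows "has_multidegree f (1, m + n, 1)"
proof -
  let ?H22 = "lin (Inr 1) (Inr 2) :: 'k bipoint set" and ?H12 = "lin (Inl 1) (Inr 1) :: 'k bipoint set"
    and ?H11 = "lin (Inl 1) (Inl 2) :: 'k bipoint set"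
  have "(single (graph_closure f) 1 - single A 1 - single B (int m) - single C (int n) - single D 1)
      + (single A (int 1) - single ?H22 (int 1)) + (single B (int m) - single ?H12 (int m))
      + (single C (int n) - single ?H12 (int n)) + (single D (int 1) - single ?H11 (int 1)) \<in> rationally_trivial"
    by (intro rt_add G homologous_multiple A B C D)
  also have "(single (graph_closure f) 1 - single A 1 - single B (int m) - single C (int n) - single D 1)
      + (single A (int 1) - single ?H22 (int 1)) + (single B (int m) - single ?H12 (int m))
      + (single C (int n) - single ?H12 (int n)) + (single D (int 1) - single ?H11 (int 1)) =
      single (graph_closure f) 1 - (single ?H22 (int 1) + single ?H12 (int (m + n)) + single ?H11 (int 1))"
    by (simp add: single_add algebra_simps)
  finally show ?thesis
    by (simp add: has_multidegree_def rationally_equivalent_def hyperplanes)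
qed

lemma coprime_of_det:
  fixes a b c d :: nat
  assumes "a * d = b * c + 1"
  shows "coprime (a + b) a" "coprime (a + b) b"
proof -
  have unit: "is_unit t" if t: "t dvd a" "t dvd b" for t
  proof -
    have "t dvd a * d" "t dvd b * c" using t by simp_all
    then show "is_unit t" using assms by (metis dvd_add_right_iff)
  qed
  show "coprime (a + b) a"
    by (rule coprimeI) (use unit in \<open>auto simp: dvd_add_right_iff\<close>)
  show "coprime (a + b) b"
    by (rule coprimeI) (use unit in \<open>auto simp: dvd_add_left_iff\<close>)
qed

text \<open>With source coordinates \<open>x, y, z\<close> and target coordinates \<open>u, v, w\<close> the graph is the surface
  \<open>w z\<^bsup>c + d\<^esup> = u x\<^sup>c y\<^sup>d\<close> on the threefold \<open>v z\<^sup>\<delta> = u x\<^sup>a y\<^sup>b\<close>. Comparison with \<open>g = v z\<^bsup>c + d\<^esup>\<close>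
  gives the coefficients \<open>1, a, b\<close> of the subspaces \<open>v = u = 0\<close>, \<open>v = x = 0\<close>, \<open>v = y = 0\<close>. Along \<open>z = x = 0\<close> the
  weights of \<open>x\<^sup>c\<close> and \<open>z\<^bsup>c + d\<^esup>\<close> are \<open>\<delta> c\<close> and \<open>a (c + d) = \<delta> c + 1\<close>, whence the last coefficient
  is \<open>1\<close>; along \<open>z = y = 0\<close> the smaller one is that of \<open>z\<^bsup>c + d\<^esup>\<close>, and nothing remains.\<close>

theorem multidegree_type_III:
  fixes M :: "nat^3^3"
  assumes i: "i1 \<noteq> i2" "i1 \<noteq> i3" "i2 \<noteq> i3" and j: "j1 \<noteq> j2" "j1 \<noteq> j3" "j2 \<noteq> j3"
    and row1: "M $ j1 $ i1 = 0" "M $ j1 $ i2 = 0" "M $ j1 $ i3 = \<delta>"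
    and row2: "M $ j2 $ i1 = a" "M $ j2 $ i2 = b" "M $ j2 $ i3 = 0"
    and row3: "M $ j3 $ i1 = c" "M $ j3 $ i2 = d" "M $ j3 $ i3 = e"
    and sums: "a + b = \<delta>" "c + d + e = \<delta>" and det: "a * d = b * c + 1"
  shows "has_multidegree (monomial_map M :: ((3, 'k::alg_closed_field) mpoly)^3) (1, \<delta>, 1)"
proof -
  define x y z :: "3 + 3" where "x = Inl i1" and "y = Inl i2" and "z = Inl i3"
  define u v w :: "3 + 3" where "u = Inr j1" and "v = Inr j2" and "w = Inr j3"
  note defs = x_def y_def z_def u_def v_def w_def
  have dist: "distinct [x, y, z, u, v, w]" using i j by (simp add: defs)
  then have ne: "x \<noteq> y" "x \<noteq> z" "x \<noteq> u" "x \<noteq> v" "x \<noteq> w" "y \<noteq> z" "y \<noteq> u" "y \<noteq> v" "y \<noteq> w"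
    "z \<noteq> u" "z \<noteq> v" "z \<noteq> w" "u \<noteq> v" "u \<noteq> w" "v \<noteq> w" by auto
  note ne' = ne ne[symmetric]
  define P where "P = single v 1 + single z \<delta>"
  define Q where "Q = single u 1 + single x a + single y b"
  define C where "C = single z (c + d)"
  define X where "X = single w 1 + C"
  define Y where "Y = single u 1 + single x c + single y d"
  define g where "g = single v 1 + single z (c + d)"
  have pos: "0 < a" "0 < d" "0 < \<delta>" using det sums by (auto intro!: Nat.gr0I)
  have lP: "lookup P s = (if s = v then 1 else if s = z then \<delta> else 0)"
    and lQ: "lookup Q s = (if s = u then 1 else if s = x then a else if s = y then b else 0)" for s
    using ne' by (auto simp: P_def Q_def lookup_add lookup_single when_def)
  have kP: "keys P = {v, z}" and kQ: "keys Q \<subseteq> {u, x, y}"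
    using pos by (auto simp: in_keys_iff lP lQ split: if_splits)
  interpret binomial_section "TYPE('k)" P Q "single z \<delta>" v C Y X w
  proof unfold_locales
    show "keys P \<inter> keys Q = {}" using ne' kQ by (auto simp: kP)
    show "bideg P = bideg Q" using sums by (simp add: P_def Q_def defs bideg_simps)
    show "P = single v 1 + single z \<delta>" by (simp add: P_def)
    show "coprime (lookup P p) (lookup Q q)" if "p \<in> keys P" "q \<in> keys Q" for p q
      using that kQ kP ne' coprime_of_det[OF det] sums(1) by (auto simp: lP lQ)
    show "X = single w 1 + C" by (simp add: X_def)
    show "bideg X = bideg Y" by (simp add: X_def C_def Y_def defs bideg_simps)
    show "keys C \<subseteq> keys P \<union> keys Q \<or> keys Y \<subseteq> keys P \<union> keys Q" by (simp add: C_def kP)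
  qed (use ne' in \<open>simp_all add: lP lQ C_def Y_def lookup_add lookup_single when_def\<close>)
  have mv: "mon_val s P = s v * s z ^ \<delta>" "mon_val s Q = s u * s x ^ a * s y ^ b"
    "mon_val s X = s w * s z ^ (c + d)" "mon_val s Y = s u * s x ^ c * s y ^ d" for s :: "3 + 3 \<Rightarrow> 'k"
    by (simp_all add: P_def Q_def X_def Y_def C_def mon_val_add mon_val_single)
  have mm: "monomial_value M s j1 = s z ^ \<delta>" "monomial_value M s j2 = s x ^ a * s y ^ b"
    "monomial_value M s j3 = s x ^ c * s y ^ d * s z ^ e" for s :: "3 + 3 \<Rightarrow> 'k"
    unfolding monomial_value_def prod_distinct3[OF i] by (simp_all add: row1 row2 row3 defs)
  have "graph = {s\<in>torus. \<exists>t. \<forall>j. s (Inr j) = t * monomial_value M s j}"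
  proof (intro equalityI subsetI)
    fix s assume "s \<in> graph"
    then have s: "s \<in> torus" "s v * s z ^ \<delta> = s u * s x ^ a * s y ^ b" "s w * s z ^ (c + d) = s u * s x ^ c * s y ^ d"
      unfolding graph_def bin_torus_def mem_Collect_eq mv by blast+
    have z0: "s z \<noteq> 0" using s(1) by (simp add: torus_def)
    define t where "t = s u / s z ^ \<delta>"
    have tu: "s u = t * s z ^ \<delta>" using z0 by (simp add: t_def)
    have "s v = t * (s x ^ a * s y ^ b)"
      using s(2) z0 unfolding tu by (simp add: mult_ac)
    moreover have "s w = t * (s x ^ c * s y ^ d * s z ^ e)"
    proof -
      have "s z ^ \<delta> = s z ^ (c + d) * s z ^ e" by (simp flip: power_add add: sums(2))
      then have "s w * s z ^ (c + d) = t * (s x ^ c * s y ^ d * s z ^ e) * s z ^ (c + d)"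
        using s(3) unfolding tu by (simp add: mult_ac)
      then show ?thesis using z0 by simp
    qed
    ultimately have "\<forall>j. s (Inr j) = t * monomial_value M s j"
      unfolding all_distinct3[OF j] mm using tu by (simp add: u_def v_def w_def)
    then show "s \<in> {s\<in>torus. \<exists>t. \<forall>j. s (Inr j) = t * monomial_value M s j}" using s(1) by blast
  next
    fix s :: "3 + 3 \<Rightarrow> 'k" assume "s \<in> {s\<in>torus. \<exists>t. \<forall>j. s (Inr j) = t * monomial_value M s j}"
    then obtain t where s: "s \<in> torus" and t: "\<And>j. s (Inr j) = t * monomial_value M s j" by blast
    have "s u = t * s z ^ \<delta>" "s v = t * (s x ^ a * s y ^ b)" "s w = t * (s x ^ c * s y ^ d * s z ^ e)"
      using t[of j1] t[of j2] t[of j3] by (simp_all add: mm u_def v_def w_def)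
    moreover have "s z ^ \<delta> = s z ^ (c + d) * s z ^ e" by (simp flip: power_add add: sums(2))
    ultimately have "s v * s z ^ \<delta> = s u * s x ^ a * s y ^ b" "s w * s z ^ (c + d) = s u * s x ^ c * s y ^ d"
      by (simp_all add: mult_ac)
    then show "s \<in> graph" unfolding graph_def bin_torus_def mem_Collect_eq mv using s by blast
  qed
  then have gc: "graph_closure (monomial_map M) = \<Gamma>" unfolding \<Gamma>_def by (rule graph_closure_eq)
  define n where "n p q = int (min (weight (pq_weight P Q p q) X) (weight (pq_weight P Q p q) Y))
    - int (weight (pq_weight P Q p q) g)" for p q
  have wX: "weight h X = h w + h z * (c + d)" "weight h Y = h u + h x * c + h y * d"
    "weight h g = h v + h z * (c + d)" for h :: "3 + 3 \<Rightarrow> nat"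
    by (simp_all add: X_def Y_def C_def g_def weight_add weight_single)
  have e1: "a * (c + d) = \<delta> * c + 1"
  proof -
    have "a * (c + d) = a * c + a * d" by (simp add: algebra_simps)
    also have "\<dots> = (a + b) * c + 1" by (simp add: det algebra_simps)
    finally show ?thesis by (simp add: sums)
  qed
  have e2: "\<delta> * d = b * (c + d) + 1"
  proof -
    have "\<delta> * d = a * d + b * d" by (simp add: sums(1)[symmetric] algebra_simps)
    then show ?thesis by (simp add: det algebra_simps)
  qed
  have n: "n v u = - 1" "n v x = - int a" "n v y = - int b" "n z u = 0" "n z x = - 1" "n z y = 0"
  proof -
    show "n v u = - 1" "n v x = - int a" "n v y = - int b"
      using ne' by (simp_all add: n_def wX pq_weight_def lP lQ)
    show "n z u = 0" using ne' sums(2) by (simp add: n_def wX pq_weight_def lP lQ)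
    show "n z x = - 1" using ne' e1 by (simp add: n_def wX pq_weight_def lP lQ)
    show "n z y = 0" using ne' e2 by (simp add: n_def wX pq_weight_def lP lQ)
  qed
  \<comment> \<open>For \<open>b = 0\<close> the variable \<open>y\<close> does not occur in \<open>Q\<close>, but its two coefficients vanish anyway.\<close>
  have "(\<Sum>(p, q)\<in>keys P \<times> keys Q. single (lin p q :: 'k bipoint set) (n p q)) =
      (\<Sum>(p, q)\<in>{v, z} \<times> {u, x, y}. single (lin p q) (n p q))"
  proof (rule sum.mono_neutral_left)
    show "keys P \<times> keys Q \<subseteq> {v, z} \<times> {u, x, y}" using kQ by (auto simp: kP)
    have "q = y \<and> b = 0" if "q \<in> {u, x, y} - keys Q" for q
      using that pos ne' by (auto simp: in_keys_iff lQ split: if_splits)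
    then have "n p q = 0" if "p \<in> {v, z}" "q \<in> {u, x, y} - keys Q" for p q
      using that n(3,6) by fastforce
    note n0 = this
    show "\<forall>i\<in>{v, z} \<times> {u, x, y} - keys P \<times> keys Q. (case i of (p, q) \<Rightarrow> single (lin p q :: 'k bipoint set) (n p q)) = 0"
    proof
      fix i assume i: "i \<in> {v, z} \<times> {u, x, y} - keys P \<times> keys Q"
      obtain p q where pq: "i = (p, q)" by (cases i)
      then have "p \<in> {v, z}" "q \<in> {u, x, y} - keys Q" using i unfolding kP by blast+
      from n0[OF this] show "(case i of (p, q) \<Rightarrow> single (lin p q :: 'k bipoint set) (n p q)) = 0"
        by (simp add: pq)
    qed
  qed simp
  also have "\<dots> = - single (lin v u) 1 - single (lin v x) (int a) - single (lin v y) (int b) - single (lin z x) 1"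
    using ne' by (simp add: n single_uminus flip: sum.cartesian_product)
  finally have sum: "(\<Sum>(p, q)\<in>keys P \<times> keys Q. single (lin p q :: 'k bipoint set) (n p q)) =
    - single (lin v u) 1 - single (lin v x) (int a) - single (lin v y) (int b) - single (lin z x) 1" .
  have "single \<Gamma> 1 + (\<Sum>(p, q)\<in>keys P \<times> keys Q. single (lin p q) (n p q)) \<in> rationally_trivial"
    unfolding n_def
  proof (rule section_rationally_trivial)
    show "keys g \<subseteq> keys P \<union> keys Q" by (simp add: g_def keys_plus_nat kP)
    show "bideg g = bideg Y" by (simp add: g_def Y_def defs bideg_simps)
  qed
  then have main: "single (graph_closure (monomial_map M :: ((3, 'k) mpoly)^3)) 1 - single (lin v u) 1
      - single (lin v x) (int a) - single (lin v y) (int b) - single (lin z x) 1 \<in> rationally_trivial"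
    unfolding sum gc by (simp add: algebra_simps)
  have "has_multidegree (monomial_map M :: ((3, 'k) mpoly)^3) (1, a + b, 1)"
  proof (rule has_multidegreeI[OF main])
    show "homologous (lin v u) (lin (Inr 1) (Inr 2) :: 'k bipoint set)"
      using homologous_same[of Inr j2 j1 1 2] j by (simp add: defs)
    show "homologous (lin v x) (lin (Inl 1) (Inr 1) :: 'k bipoint set)"
      "homologous (lin v y) (lin (Inl 1) (Inr 1) :: 'k bipoint set)"
      unfolding defs lin_commute[of "Inr j2"] by (rule homologous_mixed)+
    show "homologous (lin z x) (lin (Inl 1) (Inl 2) :: 'k bipoint set)"
      using homologous_same[of Inl i3 i1 1 2] i by (simp add: defs)
  qed
  then show ?thesis by (simp add: sums)
qed

text \<open>Here the graph is the surface \<open>w x = u z\<close> on \<open>v y = u z\<close>. Since \<open>w x\<close> has weight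
  zero along the four linear subspaces of this threefold, \<open>w x - u z\<close> vanishes on none of them.\<close>

theorem multidegree_type_I:
  fixes M :: "nat^3^3"
  assumes i: "i1 \<noteq> i2" "i1 \<noteq> i3" "i2 \<noteq> i3" and j: "j1 \<noteq> j2" "j1 \<noteq> j3" "j2 \<noteq> j3"
    and row1: "M $ j1 $ i1 = 1" "M $ j1 $ i2 = 1" "M $ j1 $ i3 = 0"
    and row2: "M $ j2 $ i1 = 1" "M $ j2 $ i2 = 0" "M $ j2 $ i3 = 1"
    and row3: "M $ j3 $ i1 = 0" "M $ j3 $ i2 = 1" "M $ j3 $ i3 = 1"
  shows "has_multidegree (monomial_map M :: ((3, 'k::alg_closed_field) mpoly)^3) (1, 2, 1)"
proof -
  define x y z :: "3 + 3" where "x = Inl i1" and "y = Inl i2" and "z = Inl i3"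
  define u v w :: "3 + 3" where "u = Inr j1" and "v = Inr j2" and "w = Inr j3"
  note defs = x_def y_def z_def u_def v_def w_def
  have dist: "distinct [x, y, z, u, v, w]" using i j by (simp add: defs)
  then have ne: "x \<noteq> y" "x \<noteq> z" "x \<noteq> u" "x \<noteq> v" "x \<noteq> w" "y \<noteq> z" "y \<noteq> u" "y \<noteq> v" "y \<noteq> w"
    "z \<noteq> u" "z \<noteq> v" "z \<noteq> w" "u \<noteq> v" "u \<noteq> w" "v \<noteq> w" by auto
  note ne' = ne ne[symmetric]
  define P where "P = single v 1 + single y (1::nat)"
  define Q where "Q = single u 1 + single z (1::nat)"
  define X where "X = single w 1 + single x (1::nat)"
  have lP: "lookup P s = (if s = v \<or> s = y then 1 else 0)"
    and lQ: "lookup Q s = (if s = u \<or> s = z then 1 else 0)" for s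
    using ne' by (auto simp: P_def Q_def lookup_add lookup_single when_def)
  have kP: "keys P = {v, y}" and kQ: "keys Q = {u, z}"
    by (auto simp: in_keys_iff lP lQ split: if_splits)
  interpret binomial_section "TYPE('k)" P Q "single y 1" v "single x 1" Q X w
  proof unfold_locales
    show "keys P \<inter> keys Q = {}" using ne' by (auto simp: kP kQ)
    show "bideg P = bideg Q" by (simp add: P_def Q_def defs bideg_simps)
    show "P = single v 1 + single y 1" by (simp add: P_def)
    show "coprime (lookup P p) (lookup Q q)" if "p \<in> keys P" "q \<in> keys Q" for p q
      using that by (auto simp: lP kP)
    show "X = single w 1 + single x 1" by (simp add: X_def)
    show "bideg X = bideg Q" by (simp add: X_def Q_def defs bideg_simps)
  qed (use ne' in \<open>simp_all add: lP lQ lookup_add lookup_single when_def\<close>)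
  have mv: "mon_val s P = s v * s y" "mon_val s Q = s u * s z" "mon_val s X = s w * s x" for s :: "3 + 3 \<Rightarrow> 'k"
    by (simp_all add: P_def Q_def X_def mon_val_add mon_val_single)
  have mm: "monomial_value M s j1 = s x * s y" "monomial_value M s j2 = s x * s z"
    "monomial_value M s j3 = s y * s z" for s :: "3 + 3 \<Rightarrow> 'k"
    unfolding monomial_value_def prod_distinct3[OF i] by (simp_all add: row1 row2 row3 defs)
  have "graph = {s\<in>torus. \<exists>t. \<forall>j. s (Inr j) = t * monomial_value M s j}"
  proof (intro equalityI subsetI)
    fix s assume "s \<in> graph"
    then have s: "s \<in> torus" "s v * s y = s u * s z" "s w * s x = s u * s z"
      unfolding graph_def bin_torus_def mem_Collect_eq mv by blast+
    have nz: "s x \<noteq> 0" "s y \<noteq> 0" using s(1) by (simp_all add: torus_def)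
    define t where "t = s u / (s x * s y)"
    have tu: "s u = t * (s x * s y)" using nz by (simp add: t_def)
    have "s v = t * (s x * s z)" using s(2) nz unfolding tu by (simp add: mult_ac)
    moreover have "s w = t * (s y * s z)" using s(3) nz unfolding tu by (simp add: mult_ac)
    ultimately have "\<forall>j. s (Inr j) = t * monomial_value M s j"
      unfolding all_distinct3[OF j] mm using tu by (simp add: u_def v_def w_def)
    then show "s \<in> {s\<in>torus. \<exists>t. \<forall>j. s (Inr j) = t * monomial_value M s j}" using s(1) by blast
  next
    fix s :: "3 + 3 \<Rightarrow> 'k" assume "s \<in> {s\<in>torus. \<exists>t. \<forall>j. s (Inr j) = t * monomial_value M s j}"
    then obtain t where s: "s \<in> torus" and t: "\<And>j. s (Inr j) = t * monomial_value M s j" by blast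
    have "s u = t * (s x * s y)" "s v = t * (s x * s z)" "s w = t * (s y * s z)"
      using t[of j1] t[of j2] t[of j3] by (simp_all add: mm u_def v_def w_def)
    then have "s v * s y = s u * s z" "s w * s x = s u * s z" by (simp_all add: mult_ac)
    then show "s \<in> graph" unfolding graph_def bin_torus_def mem_Collect_eq mv using s by blast
  qed
  then have gc: "graph_closure (monomial_map M) = \<Gamma>" unfolding \<Gamma>_def by (rule graph_closure_eq)
  define n where "n p q = int (min (weight (pq_weight P Q p q) X) (weight (pq_weight P Q p q) Q))
    - int (weight (pq_weight P Q p q) P)" for p q
  have wX: "weight h X = h w + h x" "weight h Q = h u + h z" "weight h P = h v + h y" for h :: "3 + 3 \<Rightarrow> nat"
    by (simp_all add: X_def P_def Q_def weight_add weight_single)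
  have n: "n v u = - 1" "n v z = - 1" "n y u = - 1" "n y z = - 1"
    using ne' by (simp_all add: n_def wX pq_weight_def lP lQ)
  have sum: "(\<Sum>(p, q)\<in>keys P \<times> keys Q. single (lin p q :: 'k bipoint set) (n p q)) =
    - single (lin v u) 1 - single (lin v z) 1 - single (lin y u) 1 - single (lin y z) 1"
    using ne' by (simp add: kP kQ n single_uminus flip: sum.cartesian_product)
  have "single \<Gamma> 1 + (\<Sum>(p, q)\<in>keys P \<times> keys Q. single (lin p q) (n p q)) \<in> rationally_trivial"
    unfolding n_def by (rule section_rationally_trivial) (use bideg_eq in simp_all)
  then have main: "single (graph_closure (monomial_map M :: ((3, 'k) mpoly)^3)) 1 - single (lin v u) 1
      - single (lin v z) (int 1) - single (lin y u) (int 1) - single (lin y z) 1 \<in> rationally_trivial"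
    unfolding sum gc by (simp add: algebra_simps)
  have "has_multidegree (monomial_map M :: ((3, 'k) mpoly)^3) (1, 1 + 1, 1)"
  proof (rule has_multidegreeI[OF main])
    show "homologous (lin v u) (lin (Inr 1) (Inr 2) :: 'k bipoint set)"
      using homologous_same[of Inr j2 j1 1 2] j by (simp add: defs)
    show "homologous (lin v z) (lin (Inl 1) (Inr 1) :: 'k bipoint set)"
      unfolding defs lin_commute[of "Inr j2"] by (rule homologous_mixed)
    show "homologous (lin y u) (lin (Inl 1) (Inr 1) :: 'k bipoint set)"
      unfolding defs by (rule homologous_mixed)
    show "homologous (lin y z) (lin (Inl 1) (Inl 2) :: 'k bipoint set)"
      using homologous_same[of Inl i2 i3 1 2] i by (simp add: defs)
  qed
  then show ?thesis by (simp add: numeral_2_eq_2)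
qed

section \<open>Monomial Cremona transformations\<close>

definition row_exp :: "nat^3^3 \<Rightarrow> 3 \<Rightarrow> (3 \<Rightarrow>\<^sub>0 nat)" where
  "row_exp M i = Abs_poly_mapping (\<lambda>j. M $ i $ j)"

text \<open>The effect of the substitution on exponents, that is multiplication by the transposed matrix.\<close>

definition push :: "nat^3^3 \<Rightarrow> (3 \<Rightarrow>\<^sub>0 nat) \<Rightarrow> (3 \<Rightarrow>\<^sub>0 nat)" where
  "push M m = (\<Sum>k\<in>UNIV. rep (lookup m k) (row_exp M k))"

lemma lookup_row_exp [simp]: "lookup (row_exp M i) j = M $ i $ j"
  by (simp add: row_exp_def)

lemma lookup_push: "lookup (push M m) l = (\<Sum>k\<in>UNIV. lookup m k * M $ k $ l)"
  by (simp add: push_def lookup_sum)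

lemma monomial_map_row: "monomial_map M $ i = mon (row_exp M i)"
  by (simp add: monomial_map_def mon_eq_prod_Var)

lemma mon_power: "mon m ^ n = (mon (rep n m) :: ('v, 'k::comm_ring_1) mpoly)"
  by (induction n) (simp_all add: mult_single)

lemma prod_mon: "(\<Prod>v\<in>A. mon (f v)) = (mon (\<Sum>v\<in>A. f v) :: ('v, 'k::comm_ring_1) mpoly)"
  by (induction A rule: infinite_finite_induct) (simp_all add: mult_single)

lemma subst_monomial_map:
  "mpoly_subst (\<lambda>j. monomial_map M $ j) F = (\<Sum>m\<in>keys F. single (push M m) (lookup F m))"
  by (simp add: mpoly_subst_def monomial_map_row mon_power prod_mon mult_single push_def)

lemma compose_monomial_map:
  "compose_map (monomial_map K) (monomial_map M) $ i = (mon (push M (row_exp K i)) :: (3, 'k::field) mpoly)"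
  by (simp add: compose_map_def subst_monomial_map monomial_map_row[of K])

lemma homogeneous_mon: "homogeneous d (mon m) \<longleftrightarrow> (\<Sum>v\<in>UNIV. lookup m v) = d"
  by (simp add: homogeneous_def)

lemma sum_push:
  assumes "\<And>k. (\<Sum>l\<in>UNIV. M $ k $ l) = \<delta>"
  shows "(\<Sum>l\<in>UNIV. lookup (push M m) l) = (\<Sum>k\<in>UNIV. lookup m k) * \<delta>"
proof -
  have "(\<Sum>l\<in>UNIV. lookup (push M m) l) = (\<Sum>k\<in>UNIV. \<Sum>l\<in>UNIV. lookup m k * M $ k $ l)"
    unfolding lookup_push by (rule sum.swap)
  also have "\<dots> = (\<Sum>k\<in>UNIV. lookup m k * \<delta>)" by (simp add: assms flip: sum_distrib_left)
  finally show ?thesis by (simp add: sum_distrib_right)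
qed

lemma rational_monomial_map:
  assumes "\<And>i. (\<Sum>j\<in>UNIV. M $ i $ j) = \<delta>"
  shows "rational_map (monomial_map M :: ((3, 'k::field) mpoly)^3)"
  unfolding rational_map_def monomial_map_row
proof
  show "\<exists>d. \<forall>i. homogeneous d (mon (row_exp M i) :: (3, 'k) mpoly)"
    by (rule exI[of _ \<delta>]) (simp add: homogeneous_mon assms)
  show "\<exists>i. (mon (row_exp M i) :: (3, 'k) mpoly) \<noteq> 0"
    by (metis keys_single keys_zero one_neq_zero insert_not_empty)
qed

text \<open>The map is projective, so the product of the matrices has to be the identity only up to adding the
  same vector to all rows.\<close>

definition left_inverse :: "nat^3^3 \<Rightarrow> nat^3^3 \<Rightarrow> bool" where
  "left_inverse K M \<longleftrightarrow> (\<exists>v. \<forall>i l. (\<Sum>k\<in>UNIV. K $ i $ k * M $ k $ l) = v l + (if l = i then 1 else 0))"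

lemma compose_left_inverse:
  assumes K: "\<And>i. (\<Sum>j\<in>UNIV. K $ i $ j) = \<kappa>" and M: "\<And>i. (\<Sum>j\<in>UNIV. M $ i $ j) = \<delta>"
    and inv: "left_inverse K M"
  shows "rational_map (compose_map (monomial_map K) (monomial_map M) :: ((3, 'k::field) mpoly)^3)"
    and "same_map (compose_map (monomial_map K) (monomial_map M) :: ((3, 'k) mpoly)^3) identity_map"
proof -
  show "rational_map (compose_map (monomial_map K) (monomial_map M) :: ((3, 'k) mpoly)^3)"
    unfolding rational_map_def compose_monomial_map
  proof
    show "\<exists>d. \<forall>i. homogeneous d (mon (push M (row_exp K i)) :: (3, 'k) mpoly)"
      by (rule exI[of _ "\<kappa> * \<delta>"]) (simp add: homogeneous_mon sum_push[OF M] K)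
    show "\<exists>i. (mon (push M (row_exp K i)) :: (3, 'k) mpoly) \<noteq> 0"
      by (metis keys_single keys_zero one_neq_zero insert_not_empty)
  qed
  obtain v where v: "\<And>i l. (\<Sum>k\<in>UNIV. K $ i $ k * M $ k $ l) = v l + (if l = i then 1 else 0)"
    using inv by (auto simp: left_inverse_def)
  have "push M (row_exp K i) + single j 1 = push M (row_exp K j) + single i 1" for i j
    by (rule poly_mapping_eqI) (simp add: lookup_add lookup_push v lookup_single when_def)
  then show "same_map (compose_map (monomial_map K) (monomial_map M) :: ((3, 'k) mpoly)^3) identity_map"
    unfolding same_map_def identity_map_def compose_monomial_map by (simp add: Var_def mult_single)
qed

lemma cremonaI:
  assumes "\<And>i. (\<Sum>j\<in>UNIV. K $ i $ j) = \<kappa>" "\<And>i. (\<Sum>j\<in>UNIV. M $ i $ j) = \<delta>"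
    and "left_inverse K M" "left_inverse M K"
  shows "cremona (monomial_map M :: ((3, 'k::field) mpoly)^3)"
  unfolding cremona_def
  using rational_monomial_map[OF assms(1)] rational_monomial_map[OF assms(2)]
    compose_left_inverse[OF assms(1,2,3)] compose_left_inverse[OF assms(2,1,4)] by blast

lemma sum_distinct3:
  fixes i1 :: 3
  assumes "i1 \<noteq> i2" "i1 \<noteq> i3" "i2 \<noteq> i3"
  shows "(\<Sum>i\<in>UNIV. f i) = f i1 + f i2 + (f i3 :: 'a::comm_monoid_add)"
  by (subst UNIV_distinct3[OF assms]) (use assms in \<open>simp add: add.assoc\<close>)

text \<open>On the chart \<open>u = z = 1\<close> the inverse is \<open>x = v\<^sup>d w\<^bsup>-b\<^esup>\<close>, \<open>y = v\<^bsup>-c\<^esup> w\<^sup>a\<close>; multiplication by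
  \<open>v\<^sup>c w\<^sup>b\<close> and homogenization with powers of \<open>u\<close> give the matrix \<open>K\<close>.\<close>

lemma cremona_type_III:
  fixes M :: "nat^3^3"
  assumes i: "i1 \<noteq> i2" "i1 \<noteq> i3" "i2 \<noteq> i3" and j: "j1 \<noteq> j2" "j1 \<noteq> j3" "j2 \<noteq> j3"
    and row1: "M $ j1 $ i1 = 0" "M $ j1 $ i2 = 0" "M $ j1 $ i3 = \<delta>"
    and row2: "M $ j2 $ i1 = a" "M $ j2 $ i2 = b" "M $ j2 $ i3 = 0"
    and row3: "M $ j3 $ i1 = c" "M $ j3 $ i2 = d" "M $ j3 $ i3 = e"
    and sums: "a + b = \<delta>" "c + d + e = \<delta>" and det: "a * d = b * c + 1"
  shows "cremona (monomial_map M :: ((3, 'k::field) mpoly)^3)"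
proof -
  define K :: "nat^3^3" where "K = (\<chi> i j.
     if i = i1 then (if j = j1 then a + b else if j = j2 then c + d else 0)
     else if i = i2 then (if j = j1 then c + d else if j = j2 then 0 else a + b)
     else (if j = j1 then a + d else if j = j2 then c else b))"
  note ne = i i[symmetric] j j[symmetric]
  have K: "K $ i1 $ j1 = a + b" "K $ i1 $ j2 = c + d" "K $ i1 $ j3 = 0"
    "K $ i2 $ j1 = c + d" "K $ i2 $ j2 = 0" "K $ i2 $ j3 = a + b"
    "K $ i3 $ j1 = a + d" "K $ i3 $ j2 = c" "K $ i3 $ j3 = b"
    using ne by (simp_all add: K_def)
  note ent = K row1 row2 row3
  have detI: "int a * int d = int b * int c + 1"
    using arg_cong[OF det, of int] by simp
  have sumI: "int \<delta> = int a + int b" "int e = int a + int b - int c - int d"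
    using sums by simp_all
  have nat_eq: "int m = int n \<Longrightarrow> m = n" for m n by simp
  show ?thesis
  proof (rule cremonaI)
    have "\<forall>i. (\<Sum>j\<in>UNIV. K $ i $ j) = a + b + c + d"
      unfolding all_distinct3[OF i] sum_distinct3[OF j] by (simp add: K)
    then show "(\<Sum>j\<in>UNIV. K $ i $ j) = a + b + c + d" for i by blast
    have "\<forall>j. (\<Sum>i\<in>UNIV. M $ j $ i) = \<delta>"
      unfolding all_distinct3[OF j] sum_distinct3[OF i] using sums by (simp add: row1 row2 row3)
    then show "(\<Sum>i\<in>UNIV. M $ j $ i) = \<delta>" for j by blast
    define v where "v l = (if l = i1 then c * a + b * c else if l = i2 then c * b + b * d else \<delta> * \<delta>)" for l
    have v: "v i1 = c * a + b * c" "v i2 = c * b + b * d" "v i3 = \<delta> * \<delta>"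
      using ne by (simp_all add: v_def)
    have "\<forall>i l. (\<Sum>k\<in>UNIV. K $ i $ k * M $ k $ l) = v l + (if l = i then 1 else 0)"
      unfolding all_distinct3[OF i] sum_distinct3[OF j]
      by (intro conjI; rule nat_eq;
          simp only: ne ent v if_True if_False refl of_nat_add of_nat_mult of_nat_0 of_nat_1 sumI
            mult_zero_left mult_zero_right add_0_left add_0_right; simp add: detI algebra_simps)
    then show "left_inverse K M" unfolding left_inverse_def by blast
    define v' where "v' l = (if l = j1 then a * a + a * b + b * c + b * d else if l = j2 then \<delta> * c else \<delta> * b)" for l
    have v': "v' j1 = a * a + a * b + b * c + b * d" "v' j2 = \<delta> * c" "v' j3 = \<delta> * b"
      using ne by (simp_all add: v'_def)
    have "\<forall>i l. (\<Sum>k\<in>UNIV. M $ i $ k * K $ k $ l) = v' l + (if l = i then 1 else 0)"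
      unfolding all_distinct3[OF j] sum_distinct3[OF i]
      by (intro conjI; rule nat_eq;
          simp only: ne ent v' if_True if_False refl of_nat_add of_nat_mult of_nat_0 of_nat_1 sumI
            mult_zero_left mult_zero_right add_0_left add_0_right; simp add: detI algebra_simps)
    then show "left_inverse M K" unfolding left_inverse_def by blast
  qed
qed

lemma cremona_type_I:
  fixes M :: "nat^3^3"
  assumes i: "i1 \<noteq> i2" "i1 \<noteq> i3" "i2 \<noteq> i3" and j: "j1 \<noteq> j2" "j1 \<noteq> j3" "j2 \<noteq> j3"
    and row1: "M $ j1 $ i1 = 1" "M $ j1 $ i2 = 1" "M $ j1 $ i3 = 0"
    and row2: "M $ j2 $ i1 = 1" "M $ j2 $ i2 = 0" "M $ j2 $ i3 = 1"
    and row3: "M $ j3 $ i1 = 0" "M $ j3 $ i2 = 1" "M $ j3 $ i3 = 1"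
  shows "cremona (monomial_map M :: ((3, 'k::field) mpoly)^3)"
proof -
  define K :: "nat^3^3" where "K = (\<chi> i j. M $ j $ i)"
  have K: "K $ p $ q = M $ q $ p" for p q by (simp add: K_def)
  note ne = i i[symmetric] j j[symmetric]
  show ?thesis
  proof (rule cremonaI)
    have "\<forall>i. (\<Sum>j\<in>UNIV. K $ i $ j) = 2"
      unfolding all_distinct3[OF i] sum_distinct3[OF j] K by (simp add: row1 row2 row3)
    then show "(\<Sum>j\<in>UNIV. K $ i $ j) = 2" for i by blast
    have "\<forall>j. (\<Sum>i\<in>UNIV. M $ j $ i) = 2"
      unfolding all_distinct3[OF j] sum_distinct3[OF i] by (simp add: row1 row2 row3)
    then show "(\<Sum>i\<in>UNIV. M $ j $ i) = 2" for j by blast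
    have "\<forall>i l. (\<Sum>k\<in>UNIV. K $ i $ k * M $ k $ l) = 1 + (if l = i then 1 else 0)"
      unfolding all_distinct3[OF i] sum_distinct3[OF j] K using ne by (simp add: row1 row2 row3)
    then show "left_inverse K M" unfolding left_inverse_def by (intro exI[of _ "\<lambda>_. 1"])
    have "\<forall>i l. (\<Sum>k\<in>UNIV. M $ i $ k * K $ k $ l) = 1 + (if l = i then 1 else 0)"
      unfolding all_distinct3[OF j] sum_distinct3[OF i] K using ne by (simp add: row1 row2 row3)
    then show "left_inverse M K" unfolding left_inverse_def by (intro exI[of _ "\<lambda>_. 1"])
  qed
qed

text \<open>Let \<open>h\<^sub>i = g\<^sub>i (f)\<close>, where \<open>f\<close> is the given map and \<open>g\<close> its inverse. All exponents in \<open>h\<^sub>i\<close> are combinations of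
  the rows of the matrix with the same sum of coefficients, and \<open>h\<^sub>i x\<^sub>j = h\<^sub>j x\<^sub>i\<close>; comparing a common
  monomial expresses \<open>e\<^sub>j - e\<^sub>i\<close> through differences of rows. This argument works in every characteristic.\<close>

lemma cremona_lattice:
  assumes "cremona (monomial_map M :: ((3, 'k::field) mpoly)^3)"
  shows "\<exists>n :: 3 \<Rightarrow> int. (\<Sum>k\<in>UNIV. n k) = 0 \<and>
    (\<forall>l. (\<Sum>k\<in>UNIV. n k * int (M $ k $ l)) = (if l = j then 1 else 0) - (if l = i then 1 else 0))"
proof -
  obtain g :: "((3, 'k) mpoly)^3" where g: "rational_map g" "rational_map (compose_map g (monomial_map M))"
    "same_map (compose_map g (monomial_map M)) identity_map"
    using assms unfolding cremona_def by blast
  obtain e where e: "\<And>i. homogeneous e (g $ i)" using g(1) by (auto simp: rational_map_def)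
  define h where "h i = compose_map g (monomial_map M) $ i" for i
  have h_eq: "h i = (\<Sum>m\<in>keys (g $ i). single (push M m) (lookup (g $ i) m))" for i
    by (simp add: h_def compose_map_def subst_monomial_map)
  have h_keys: "\<exists>a. m = push M a \<and> (\<Sum>v\<in>UNIV. lookup a v) = e" if m: "m \<in> keys (h i)" for i m
  proof -
    have "m \<in> (\<Union>a\<in>keys (g $ i). keys (single (push M a) (lookup (g $ i) a)))"
      using m keys_sum[of "\<lambda>a. single (push M a) (lookup (g $ i) a)" "keys (g $ i)"] unfolding h_eq by blast
    then obtain a where "a \<in> keys (g $ i)" "m = push M a" by (auto split: if_splits)
    then show ?thesis using e[of i] by (auto simp: homogeneous_def)
  qed
  have same: "h i * Var j = h j * Var i" for i j
    using g(3) by (simp add: same_map_def identity_map_def h_def)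
  have Var_nz: "(Var v :: (3, 'k) mpoly) \<noteq> 0" for v
    by (metis Var_def keys_single keys_zero one_neq_zero insert_not_empty)
  obtain i0 where "h i0 \<noteq> 0" using g(2) by (auto simp: rational_map_def h_def)
  then have "h i \<noteq> 0" using same[of i0 i] Var_nz by (metis mult_eq_0_iff)
  then have "h i * Var j \<noteq> 0" using Var_nz by simp
  then obtain l where l: "l \<in> keys (h i * Var j)" by (metis all_not_in_conv keys_eq_empty)
  have kV: "keys (Var v :: (3, 'k) mpoly) = {single v 1}" for v by (simp add: Var_def)
  obtain m where m: "m \<in> keys (h i)" "l = m + single j 1"
    using l keys_mult[of "h i" "Var j"] unfolding kV by blast
  obtain m' where m': "m' \<in> keys (h j)" "l = m' + single i 1"
    using l keys_mult[of "h j" "Var i"] unfolding same[of i j] kV by blast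
  obtain a a' where a: "m = push M a" "(\<Sum>v\<in>UNIV. lookup a v) = e"
    and a': "m' = push M a'" "(\<Sum>v\<in>UNIV. lookup a' v) = e"
    using h_keys m(1) m'(1) by blast
  define n where "n k = int (lookup a' k) - int (lookup a k)" for k
  have "(\<Sum>k\<in>UNIV. n k) = int (\<Sum>v\<in>UNIV. lookup a' v) - int (\<Sum>v\<in>UNIV. lookup a v)"
    by (simp add: n_def sum_subtractf)
  then have "(\<Sum>k\<in>UNIV. n k) = 0" using a(2) a'(2) by simp
  moreover have "(\<Sum>k\<in>UNIV. n k * int (M $ k $ t)) = (if t = j then 1 else 0) - (if t = i then 1 else 0)" for t
  proof -
    have "lookup (push M a + single j 1) t = lookup (push M a' + single i 1) t"
      using m(2) m'(2) a(1) a'(1) by simp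
    then have "int ((\<Sum>k\<in>UNIV. lookup a k * M $ k $ t) + (if j = t then 1 else 0)) =
        int ((\<Sum>k\<in>UNIV. lookup a' k * M $ k $ t) + (if i = t then 1 else 0))"
      by (simp only: lookup_add lookup_push lookup_single when_def)
    then have "(\<Sum>k\<in>UNIV. int (lookup a' k) * int (M $ k $ t)) - (\<Sum>k\<in>UNIV. int (lookup a k) * int (M $ k $ t)) =
        int (if j = t then 1 else 0) - int (if i = t then 1 else 0)"
      unfolding of_nat_add of_nat_sum of_nat_mult by (simp only: algebra_simps)
    then show ?thesis by (simp add: n_def left_diff_distrib sum_subtractf eq_commute[of t])
  qed
  ultimately show ?thesis by blast
qed

definition type_I :: "nat^3^3 \<Rightarrow> 3 \<Rightarrow> 3 \<Rightarrow> 3 \<Rightarrow> 3 \<Rightarrow> 3 \<Rightarrow> 3 \<Rightarrow> bool" where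
  "type_I M i1 i2 i3 j1 j2 j3 \<longleftrightarrow>
    M $ j1 $ i1 = 1 \<and> M $ j1 $ i2 = 1 \<and> M $ j1 $ i3 = 0 \<and>
    M $ j2 $ i1 = 1 \<and> M $ j2 $ i2 = 0 \<and> M $ j2 $ i3 = 1 \<and>
    M $ j3 $ i1 = 0 \<and> M $ j3 $ i2 = 1 \<and> M $ j3 $ i3 = 1"

definition type_III :: "nat^3^3 \<Rightarrow> nat \<Rightarrow> 3 \<Rightarrow> 3 \<Rightarrow> 3 \<Rightarrow> 3 \<Rightarrow> 3 \<Rightarrow> 3 \<Rightarrow> bool" where
  "type_III M \<delta> i1 i2 i3 j1 j2 j3 \<longleftrightarrow>
    M $ j1 $ i1 = 0 \<and> M $ j1 $ i2 = 0 \<and> M $ j1 $ i3 = \<delta> \<and> M $ j2 $ i3 = 0 \<and>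
    M $ j2 $ i1 * M $ j3 $ i2 = M $ j2 $ i2 * M $ j3 $ i1 + 1"

text \<open>By reducedness every column contains a zero. If one row contains two of them, the lattice condition
  says that the \<open>2 \<times> 2\<close> minor is \<open>\<plusminus>1\<close>, and the sign is corrected by exchanging two columns. Otherwise the
  zeros form a permutation matrix, and with rows \<open>(a, b, 0)\<close>, \<open>(c, 0, d)\<close>, \<open>(0, e, f)\<close> the lattice condition
  becomes \<open>a d e + b c f = \<delta> = a + b\<close>; as all entries are positive, this leaves only ones.\<close>

lemma classification:
  fixes M :: "nat^3^3"
  assumes sums: "\<And>i. (\<Sum>j\<in>UNIV. M $ i $ j) = \<delta>" and red: "reduced_form M"
    and lat: "\<And>j i. \<exists>n :: 3 \<Rightarrow> int. (\<Sum>k\<in>UNIV. n k) = 0 \<and>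
      (\<forall>l. (\<Sum>k\<in>UNIV. n k * int (M $ k $ l)) = (if l = j then 1 else 0) - (if l = i then 1 else 0))"
  shows "\<exists>i1 i2 i3 j1 j2 j3. i1 \<noteq> i2 \<and> i1 \<noteq> i3 \<and> i2 \<noteq> i3 \<and> j1 \<noteq> j2 \<and> j1 \<noteq> j3 \<and> j2 \<noteq> j3 \<and>
    (type_I M i1 i2 i3 j1 j2 j3 \<or> type_III M \<delta> i1 i2 i3 j1 j2 j3)"
proof (cases "\<exists>r l l'. l \<noteq> l' \<and> M $ r $ l = 0 \<and> M $ r $ l' = 0")
  case True
  then obtain r l l' where l: "l \<noteq> l'" "M $ r $ l = 0" "M $ r $ l' = 0" by blast
  obtain m where m: "m \<noteq> l" "m \<noteq> l'" using exists_third by blast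
  note dl = l(1) m(1)[symmetric] m(2)[symmetric]
  have rm: "M $ r $ m = \<delta>" using sums[of r] l by (simp add: sum_distinct3[OF dl])
  obtain s where s: "M $ s $ m = 0" using red by (auto simp: reduced_form_def)
  have "\<delta> \<noteq> 0"
  proof
    assume "\<delta> = 0"
    then have "M $ k $ t = 0" for k t using sums[of k] by simp
    moreover obtain n :: "3 \<Rightarrow> int" where "\<forall>t. (\<Sum>k\<in>UNIV. n k * int (M $ k $ t)) = (if t = l then 1 else 0) - (if t = m then 1 else 0)"
      using lat[of l m] by blast
    then have "(\<Sum>k\<in>UNIV. n k * int (M $ k $ l)) = 1" using m by simp
    ultimately show False by simp
  qed
  then have "r \<noteq> s" using s rm by auto
  then obtain t where t: "t \<noteq> r" "t \<noteq> s" using exists_third by blast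
  note dr = \<open>r \<noteq> s\<close> t(1)[symmetric] t(2)[symmetric]
  obtain n where n: "(\<Sum>k\<in>UNIV. n k * int (M $ k $ t)) = (if t = l then 1 else 0) - (if t = m then 1 else 0)" for t
    using lat[of l m] by blast
  obtain n' where n': "(\<Sum>k\<in>UNIV. n' k * int (M $ k $ t)) = (if t = l' then 1 else 0) - (if t = m then 1 else 0)" for t
    using lat[of l' m] by blast
  let ?a = "int (M $ s $ l)" and ?b = "int (M $ s $ l')" and ?c = "int (M $ t $ l)" and ?d = "int (M $ t $ l')"
  have eqs: "n s * ?a + n t * ?c = 1" "n s * ?b + n t * ?d = 0" "n' s * ?a + n' t * ?c = 0" "n' s * ?b + n' t * ?d = 1"
    using n[of l] n[of l'] n'[of l] n'[of l'] l dl by (simp_all add: sum_distinct3[OF dr])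
  have "(n s * n' t - n t * n' s) * (?a * ?d - ?b * ?c) =
      (n s * ?a + n t * ?c) * (n' s * ?b + n' t * ?d) - (n s * ?b + n t * ?d) * (n' s * ?a + n' t * ?c)"
    by (simp add: algebra_simps)
  then have "(n s * n' t - n t * n' s) * (?a * ?d - ?b * ?c) = 1" unfolding eqs by simp
  then have "?a * ?d - ?b * ?c = 1 \<or> ?a * ?d - ?b * ?c = - 1"
    using zmult_eq_1_iff[of "n s * n' t - n t * n' s"] by blast
  then show ?thesis
  proof
    assume "?a * ?d - ?b * ?c = 1"
    then have "int (M $ s $ l * M $ t $ l') = int (M $ s $ l' * M $ t $ l + 1)"
      unfolding of_nat_add of_nat_mult of_nat_1 by linarith
    then have "M $ s $ l * M $ t $ l' = M $ s $ l' * M $ t $ l + 1" by (simp only: of_nat_eq_iff)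
    then have "type_III M \<delta> l l' m r s t" using l rm s by (simp add: type_III_def)
    then show ?thesis
      by (intro exI[of _ l] exI[of _ l'] exI[of _ m] exI[of _ r] exI[of _ s] exI[of _ t] conjI dl dr disjI2)
  next
    assume "?a * ?d - ?b * ?c = - 1"
    then have "int (M $ s $ l' * M $ t $ l) = int (M $ s $ l * M $ t $ l' + 1)"
      unfolding of_nat_add of_nat_mult of_nat_1 by linarith
    then have "M $ s $ l' * M $ t $ l = M $ s $ l * M $ t $ l' + 1" by (simp only: of_nat_eq_iff)
    then have "type_III M \<delta> l' l m r s t" using l rm s by (simp add: type_III_def)
    then show ?thesis
      by (intro exI[of _ l'] exI[of _ l] exI[of _ m] exI[of _ r] exI[of _ s] exI[of _ t] conjI
          dl dl(1)[symmetric] dr disjI2)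
  qed
next
  case False
  obtain r1 r2 r3 where r: "M $ r1 $ 1 = 0" "M $ r2 $ 2 = 0" "M $ r3 $ 3 = 0"
    using red unfolding reduced_form_def by metis
  note no2 = False
  have pos: "M $ k $ l' > 0" if kl: "M $ k $ l = 0" "l' \<noteq> l" for k l l'
  proof (rule ccontr)
    assume "\<not> M $ k $ l' > 0"
    then have "M $ k $ l' = 0" by simp
    then show False using kl no2 by blast
  qed
  have d: "r3 \<noteq> r2" "r3 \<noteq> r1" "r2 \<noteq> r1"
    using pos[OF r(3), of 2] pos[OF r(3), of 1] pos[OF r(2), of 1] r by auto
  let ?a = "M $ r3 $ 1" and ?b = "M $ r3 $ 2" and ?c = "M $ r2 $ 1" and ?d = "M $ r2 $ 3"
    and ?e = "M $ r1 $ 2" and ?f = "M $ r1 $ 3"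
  have p: "?a > 0" "?b > 0" "?c > 0" "?d > 0" "?e > 0" "?f > 0"
    using pos[OF r(3), of 1] pos[OF r(3), of 2] pos[OF r(2), of 1] pos[OF r(2), of 3]
      pos[OF r(1), of 2] pos[OF r(1), of 3] by simp_all
  have sm: "?a + ?b = \<delta>" "?c + ?d = \<delta>" "?e + ?f = \<delta>"
    using sums[of r3] sums[of r2] sums[of r1] r by (simp_all add: sum_3)
  obtain n where n0: "(\<Sum>k\<in>UNIV. n k) = 0"
    and n: "(\<Sum>k\<in>UNIV. n k * int (M $ k $ t)) = (if t = 1 then 1 else 0) - (if t = 3 then 1 else 0)" for t
    using lat[of 1 3] by blast
  obtain n' where n'0: "(\<Sum>k\<in>UNIV. n' k) = 0"
    and n': "(\<Sum>k\<in>UNIV. n' k * int (M $ k $ t)) = (if t = 2 then 1 else 0) - (if t = 3 then 1 else 0)" for t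
    using lat[of 2 3] by blast
  have eqs: "n r3 * int ?a + n r2 * int ?c = 1" "n r3 * int ?b + n r1 * int ?e = 0"
    "n' r3 * int ?a + n' r2 * int ?c = 0" "n' r3 * int ?b + n' r1 * int ?e = 1"
    "n r3 + n r2 + n r1 = 0" "n' r3 + n' r2 + n' r1 = 0"
    using n[of 1] n[of 2] n'[of 1] n'[of 2] n0 n'0 r by (simp_all add: sum_distinct3[OF d])
  \<comment> \<open>the determinant of the map that the matrix induces on vectors with coefficient sum zero\<close>
  define E where "E = int ?a * int ?e + int ?b * int ?c - int ?c * int ?e"
  have smI: "int ?a + int ?b = int \<delta>" "int ?c + int ?d = int \<delta>" "int ?e + int ?f = int \<delta>"
    using sm by (simp_all flip: of_nat_add)
  have dE: "int \<delta> * E = int (?a * ?d * ?e + ?b * ?c * ?f)"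
  proof -
    have "int \<delta> * E = (int ?c + int ?d) * (int ?a * int ?e) + (int ?e + int ?f) * (int ?b * int ?c)
        - (int ?a + int ?b) * (int ?c * int ?e)"
      unfolding smI E_def by (simp add: algebra_simps)
    then show ?thesis by (simp add: algebra_simps)
  qed
  have r1: "n r1 = - n r3 - n r2" "n' r1 = - n' r3 - n' r2" using eqs(5,6) by linarith+
  have "(n r2 * n' r3 - n r3 * n' r2) * E =
      (n r3 * int ?a + n r2 * int ?c) * (n' r3 * int ?b + n' r1 * int ?e)
      - (n r3 * int ?b + n r1 * int ?e) * (n' r3 * int ?a + n' r2 * int ?c)"
    unfolding r1 E_def by (simp add: algebra_simps)
  then have "(n r2 * n' r3 - n r3 * n' r2) * E = 1" unfolding eqs by simp
  then have "E = 1 \<or> E = - 1" using zmult_eq_1_iff[of "n r2 * n' r3 - n r3 * n' r2" E] by blast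
  moreover have "E \<noteq> - 1"
  proof
    assume "E = - 1"
    then have "int \<delta> * (- 1) \<ge> 0" using dE by simp
    then show False using sm(1) p(1) by simp
  qed
  ultimately have "E = 1" by blast
  then have "int \<delta> = int (?a * ?d * ?e + ?b * ?c * ?f)" using dE by (simp only: mult_1_right)
  then have "\<delta> = ?a * ?d * ?e + ?b * ?c * ?f" by (simp only: of_nat_eq_iff)
  then have key: "?a + ?b = ?a * (?d * ?e) + ?b * (?c * ?f)" by (simp only: sm(1) mult.assoc)
  have ge: "1 \<le> ?d * ?e" "1 \<le> ?c * ?f" using p by (simp_all add: Suc_le_eq)
  have "?a \<le> ?a * (?d * ?e)" "?b \<le> ?b * (?c * ?f)"
    using mult_le_mono2[OF ge(1), of ?a] mult_le_mono2[OF ge(2), of ?b] by (simp_all only: mult_1_right)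
  then have "?a * (?d * ?e) = ?a * 1" "?b * (?c * ?f) = ?b * 1" using key by linarith+
  then have "?d * ?e = 1" "?c * ?f = 1" using p(1,2) by (simp_all only: mult_cancel1) simp_all
  then have one: "?d = 1" "?e = 1" "?c = 1" "?f = 1" by (simp_all only: nat_mult_eq_1_iff)
  then have "?a + ?b = 2" using sm by simp
  then have "?a = 1" "?b = 1" using p(1,2) by linarith+
  then have "type_I M 1 2 3 r3 r2 r1" using one r by (simp add: type_I_def)
  then show ?thesis 
    by (intro exI[of _ 1] exI[of _ 2] exI[of _ 3] exI[of _ r3] exI[of _ r2] exI[of _ r1] conjI d disjI1) simp_all
qed

lemma perm_of_triple:
  assumes "(j1 :: 3) \<noteq> j2" "j1 \<noteq> j3" "j2 \<noteq> j3"
  obtains \<sigma> where "\<sigma> permutes UNIV" "\<sigma> 1 = j1" "\<sigma> 2 = j2" "\<sigma> 3 = j3"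
proof
  define \<sigma> :: "3 \<Rightarrow> 3" where "\<sigma> i = (if i = 1 then j1 else if i = 2 then j2 else j3)" for i
  show "\<sigma> 1 = j1" "\<sigma> 2 = j2" "\<sigma> 3 = j3" by (simp_all add: \<sigma>_def)
  have "inj \<sigma>"
  proof (rule injI)
    fix p q assume "\<sigma> p = \<sigma> q"
    then show "p = q" using assms exhaust_3[of p] exhaust_3[of q] by (auto simp: \<sigma>_def)
  qed
  then show "\<sigma> permutes UNIV" 
    by (intro bij_imp_permutes) (simp_all add: bij_def finite_UNIV_inj_surj)
qed

lemma matrix_vector3:
  "(N :: nat^3^3) = vector [vector [a, b, c], vector [d, e, f], vector [g, h, k]] \<longleftrightarrow>
    N $ 1 $ 1 = a \<and> N $ 1 $ 2 = b \<and> N $ 1 $ 3 = c \<and> N $ 2 $ 1 = d \<and> N $ 2 $ 2 = e \<and> N $ 2 $ 3 = f \<and>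
    N $ 3 $ 1 = g \<and> N $ 3 $ 2 = h \<and> N $ 3 $ 3 = k"
  by (auto simp: vec_eq_iff forall_3)

lemma mon_inject: "(mon m :: ('v, 'k::field) mpoly) = mon n \<longleftrightarrow> m = n"
  by (metis keys_single one_neq_zero singleton_inject)

lemma monomial_map_standard_involution:
  "(monomial_map N :: ((3, 'k::field) mpoly)^3) = standard_involution \<longleftrightarrow> type_I N 1 2 3 1 2 3"
proof -
  have si: "(standard_involution :: ((3, 'k) mpoly)^3) $ 1 = mon (single 1 1 + single 2 1)"
    "(standard_involution :: ((3, 'k) mpoly)^3) $ 2 = mon (single 1 1 + single 3 1)"
    "(standard_involution :: ((3, 'k) mpoly)^3) $ 3 = mon (single 2 1 + single 3 1)"
    by (simp_all add: standard_involution_def Var_def mult_single)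
  show ?thesis
    unfolding vec_eq_iff forall_3 monomial_map_row si mon_inject
    unfolding poly_mapping_eq_iff fun_eq_iff
    by (simp add: forall_3 lookup_add lookup_single when_def type_I_def)
qed

theorem mainTheorem1:
  fixes \<phi> :: "((3, 'k::alg_closed_field) mpoly)^3"
    and M :: "nat^3^3" and \<delta> :: nat
  assumes "\<phi> = monomial_map M"
    and "\<And>i. (\<Sum>j\<in>UNIV. M $ i $ j) = \<delta>"
    and "reduced_form M"
  shows "(cremona \<phi> \<longleftrightarrow>
           (\<exists>N. equal_up_to_permutation M N \<and>
             ((monomial_map N :: ((3, 'k) mpoly)^3) = standard_involution
              \<or> (1 \<le> \<delta> \<and>
                 N = vector [vector [0, 0,     \<delta>],
                             vector [1, \<delta> - 1, 0],
                             vector [0, 1,     \<delta> - 1]])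
              \<or> (\<exists>a b c d e.
                 N = vector [vector [0, 0, \<delta>],
                             vector [a, b, 0],
                             vector [c, d, e]]
                 \<and> a + b = \<delta> \<and> c + d + e = \<delta>
                 \<and> int a * int d - int b * int c = 1))))
         \<and> (cremona \<phi> \<longrightarrow> has_multidegree \<phi> (1, \<delta>, 1))"
    (is "(_ \<longleftrightarrow> ?normal) \<and> _")
proof -
  note \<phi> = assms(1) and sums = assms(2) and red = assms(3)
  let ?typed = "\<exists>i1 i2 i3 j1 j2 j3. i1 \<noteq> i2 \<and> i1 \<noteq> i3 \<and> i2 \<noteq> i3 \<and> j1 \<noteq> j2 \<and> j1 \<noteq> j3 \<and> j2 \<noteq> j3 \<and>
    (type_I M i1 i2 i3 j1 j2 j3 \<or> type_III M \<delta> i1 i2 i3 j1 j2 j3)"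
  have 1: ?typed if "cremona \<phi>"
    using classification[OF sums red cremona_lattice] that unfolding \<phi> by blast
  have 2: "cremona \<phi> \<and> has_multidegree \<phi> (1, \<delta>, 1)" if typed: ?typed
  proof -
    obtain i1 i2 i3 j1 j2 j3 where i: "i1 \<noteq> i2" "i1 \<noteq> i3" "i2 \<noteq> i3" and j: "j1 \<noteq> j2" "j1 \<noteq> j3" "j2 \<noteq> j3"
      and M: "type_I M i1 i2 i3 j1 j2 j3 \<or> type_III M \<delta> i1 i2 i3 j1 j2 j3"
      using typed by blast
    from M show ?thesis
    proof
      assume M: "type_I M i1 i2 i3 j1 j2 j3"
      have "\<delta> = 2" using sums[of j1] M by (simp add: sum_distinct3[OF i] type_I_def)
      then show ?thesis
        using cremona_type_I[OF i j] multidegree_type_I[OF i j] M unfolding type_I_def \<phi> by blast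
    next
      assume M: "type_III M \<delta> i1 i2 i3 j1 j2 j3"
      then have M': "M $ j1 $ i1 = 0" "M $ j1 $ i2 = 0" "M $ j1 $ i3 = \<delta>" "M $ j2 $ i3 = 0"
        "M $ j2 $ i1 * M $ j3 $ i2 = M $ j2 $ i2 * M $ j3 $ i1 + 1"
        unfolding type_III_def by blast+
      have s: "M $ j2 $ i1 + M $ j2 $ i2 = \<delta>" "M $ j3 $ i1 + M $ j3 $ i2 + M $ j3 $ i3 = \<delta>"
        using sums[of j2] sums[of j3] M'(4) by (simp_all add: sum_distinct3[OF i])
      show ?thesis
        unfolding \<phi>
        using cremona_type_III[OF i j M'(1-3) refl refl M'(4) refl refl refl s M'(5)]
          multidegree_type_III[OF i j M'(1-3) refl refl M'(4) refl refl refl s M'(5)] by blast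
    qed
  qed
  have 3: ?normal if typed: ?typed
  proof -
    obtain i1 i2 i3 j1 j2 j3 where i: "i1 \<noteq> i2" "i1 \<noteq> i3" "i2 \<noteq> i3" and j: "j1 \<noteq> j2" "j1 \<noteq> j3" "j2 \<noteq> j3"
      and M: "type_I M i1 i2 i3 j1 j2 j3 \<or> type_III M \<delta> i1 i2 i3 j1 j2 j3"
      using typed by blast
    obtain \<tau> where \<tau>: "\<tau> permutes UNIV" "\<tau> 1 = i1" "\<tau> 2 = i2" "\<tau> 3 = i3" using perm_of_triple[OF i] .
    obtain \<sigma> where \<sigma>: "\<sigma> permutes UNIV" "\<sigma> 1 = j1" "\<sigma> 2 = j2" "\<sigma> 3 = j3" using perm_of_triple[OF j] .
    define N :: "nat^3^3" where "N = (\<chi> i j. M $ \<sigma> i $ \<tau> j)"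
    have N: "N $ p $ q = M $ \<sigma> p $ \<tau> q" for p q by (simp add: N_def)
    have eq: "equal_up_to_permutation M N"
      unfolding equal_up_to_permutation_def N_def using \<sigma>(1) \<tau>(1) by blast
    from M show ?thesis
    proof
      assume "type_I M i1 i2 i3 j1 j2 j3"
      then have "(monomial_map N :: ((3, 'k) mpoly)^3) = standard_involution"
        unfolding monomial_map_standard_involution type_I_def N \<sigma> \<tau> .
      then show ?thesis using eq by blast
    next
      assume M: "type_III M \<delta> i1 i2 i3 j1 j2 j3"
      have "M $ j2 $ i1 + M $ j2 $ i2 = \<delta>" "M $ j3 $ i1 + M $ j3 $ i2 + M $ j3 $ i3 = \<delta>"
        using sums[of j2] sums[of j3] M by (simp_all add: sum_distinct3[OF i] type_III_def)
      moreover have "N = vector [vector [0, 0, \<delta>], vector [M $ j2 $ i1, M $ j2 $ i2, 0],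
          vector [M $ j3 $ i1, M $ j3 $ i2, M $ j3 $ i3]]"
        unfolding matrix_vector3 N \<sigma> \<tau> using M by (simp add: type_III_def)
      moreover have "int (M $ j2 $ i1) * int (M $ j3 $ i2) - int (M $ j2 $ i2) * int (M $ j3 $ i1) = 1"
      proof -
        have "M $ j2 $ i1 * M $ j3 $ i2 = M $ j2 $ i2 * M $ j3 $ i1 + 1" using M unfolding type_III_def by blast
        from arg_cong[OF this, of int] show ?thesis unfolding of_nat_add of_nat_mult of_nat_1 by linarith
      qed
      ultimately show ?thesis using eq by blast
    qed
  qed
  have 4: ?typed if normal: ?normal
  proof -
    obtain N where N: "equal_up_to_permutation M N" and
      forms: "(monomial_map N :: ((3, 'k) mpoly)^3) = standard_involution
              \<or> (1 \<le> \<delta> \<and> N = vector [vector [0, 0, \<delta>], vector [1, \<delta> - 1, 0], vector [0, 1, \<delta> - 1]])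
              \<or> (\<exists>a b c d e. N = vector [vector [0, 0, \<delta>], vector [a, b, 0], vector [c, d, e]]
                 \<and> a + b = \<delta> \<and> c + d + e = \<delta> \<and> int a * int d - int b * int c = 1)"
      using normal by blast
    obtain \<sigma> \<tau> where perm: "\<sigma> permutes UNIV" "\<tau> permutes UNIV" and "N = (\<chi> i j. M $ \<sigma> i $ \<tau> j)"
      using N unfolding equal_up_to_permutation_def by blast
    then have N: "N $ p $ q = M $ \<sigma> p $ \<tau> q" for p q by simp
    have ne: "f 1 \<noteq> f 2" "f 1 \<noteq> f 3" "f 2 \<noteq> f 3" if "f permutes UNIV" for f :: "3 \<Rightarrow> 3"
      using permutes_inj[OF that] by (simp_all add: inj_eq)
    have "type_I N 1 2 3 1 2 3 \<or> type_III N \<delta> 1 2 3 1 2 3"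
      using forms
    proof (elim disjE conjE exE)
      assume "(monomial_map N :: ((3, 'k) mpoly)^3) = standard_involution"
      then show ?thesis unfolding monomial_map_standard_involution ..
    next
      assume "1 \<le> \<delta>" "N = vector [vector [0, 0, \<delta>], vector [1, \<delta> - 1, 0], vector [0, 1, \<delta> - 1]]"
      then show ?thesis unfolding matrix_vector3 by (simp add: type_III_def)
    next
      fix a b c d e assume *: "N = vector [vector [0, 0, \<delta>], vector [a, b, 0], vector [c, d, e]]"
        and det: "int a * int d - int b * int c = 1"
      have "int (a * d) = int (b * c + 1)" using det unfolding of_nat_add of_nat_mult of_nat_1 by linarith
      then have "a * d = b * c + 1" by (simp only: of_nat_eq_iff)
      then show ?thesis using * unfolding matrix_vector3 by (simp add: type_III_def)
    qed
    then have "type_I M (\<tau> 1) (\<tau> 2) (\<tau> 3) (\<sigma> 1) (\<sigma> 2) (\<sigma> 3) \<or> type_III M \<delta> (\<tau> 1) (\<tau> 2) (\<tau> 3) (\<sigma> 1) (\<sigma> 2) (\<sigma> 3)"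
      unfolding type_I_def type_III_def N .
    then show ?thesis
      by (intro exI[of _ "\<tau> 1"] exI[of _ "\<tau> 2"] exI[of _ "\<tau> 3"] exI[of _ "\<sigma> 1"] exI[of _ "\<sigma> 2"] exI[of _ "\<sigma> 3"]
          conjI ne perm)
  qed
  show ?thesis
  proof (intro conjI iffI impI)
    assume "cremona \<phi>"
    from 3[OF 1[OF this]] show ?normal .
  next
    assume ?normal
    from 2[OF 4[OF this]] show "cremona \<phi>" ..
  next
    assume "cremona \<phi>"
    from 2[OF 1[OF this]] show "has_multidegree \<phi> (1, \<delta>, 1)" ..
  qed
qed

end
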